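(* Let $(M^n,g)$ be an oriented Riemannian spin manifold, $n\ge4$, with a 3-form $T\in\Lambda^3(M)$ satisfying $\nabla^cT=0$, and let $s=\frac{n-1}{4(n-3)}$. For a spinor field $\psi$, the twistor equation $P^s\psi=0$ is equivalent to $$\nabla^c_X\psi+\frac1nX\cdot\not{D}\psi+\frac{1}{2(n-3)}(X\wedge T)\cdot\psi=0\quad\text{for all vector fields }X,$$ and each such twistor spinor satisfies $$\not{D}^2\psi=\left[\frac{n}{4(n-1)}\mathrm{Scal}^g+\frac{n(n-5)}{8(n-3)^2}\|T\|^2+\frac{n(4-n)}{4(n-3)^2}T^2\right]\psi .$$
   Context: Conventions: Clifford multiplication on the complex spinor bundle $\Sigma M$ satisfies $X\cdot X=-g(X,X)$; a differential form acts on spinors by $e_{i_1}\wedge\dots\wedge e_{i_k}\mapsto e_{i_1}\cdots e_{i_k}$ for orthonormal frames; vectors and 1-forms are identified via $g$; $T^2\psi=T\cdot(T\cdot\psi)$; $\|T\|^2=\sum_{i<j<k}T(e_i,e_j,e_k)^2$. $\nabla^g$ is the Levi-Civita connection, $\mathrm{Scal}^g$ its scalar curvature, $D^g$ the Riemannian Dirac operator. For $s\in\mathbb R$, $\nabla^s_XY=\nabla^g_XY+2s\,T(X,Y,-)$, lifted to spinors as $\nabla^s_X\psi=\nabla^g_X\psi+s(X\lrcorner T)\cdot\psi$; $D^s=\sum_i e_i\cdot\nabla^s_{e_i}=D^g+3sT$. $\nabla^c:=\nabla^{1/4}$ has torsion $T$. $\not{D}:=D^g+\frac14T$. The twistor operator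 is $P^s\psi=\sum_{k=1}^n e_k\otimes\{\nabla^s_{e_k}\psi+\frac1n e_k\cdot D^s\psi\}$. *)

theory Defs
  imports "HOL-Analysis.Analysis"
begin

section \<open>Smooth functions and derivatives\<close>

abbreviation dd :: "('a::real_normed_vector \<Rightarrow> 'b::real_normed_vector) \<Rightarrow> 'a \<Rightarrow> 'a \<Rightarrow> 'b" where
  "dd f x u \<equiv> frechet_derivative f (at x) u"

primrec k_smooth_on ::
    "nat \<Rightarrow> 'a::real_normed_vector set \<Rightarrow> ('a \<Rightarrow> 'b::real_normed_vector) \<Rightarrow> bool" where
  "k_smooth_on 0 S f \<longleftrightarrow> continuous_on S f"
| "k_smooth_on (Suc k) S f \<longleftrightarrow>
     (\<forall>x\<in>S. f differentiable (at x)) \<and> (\<forall>u. k_smooth_on k S (\<lambda>x. dd f x u))"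

text \<open>Only used for open \<open>S\<close>.\<close>

definition smooth_on ::
    "'a::real_normed_vector set \<Rightarrow> ('a \<Rightarrow> 'b::real_normed_vector) \<Rightarrow> bool" where
  "smooth_on S f \<longleftrightarrow> (\<forall>k. k_smooth_on k S f)"

section \<open>Spin manifolds\<close>

text \<open>
  All bundles are given by local trivialisations and transition functions over an atlas indexed by
  \<open>charts\<close>. The chart domain \<open>cdom i\<close> carries coordinates \<open>crd i\<close>, and the spin bundle is trivialised
  over it; every spin manifold has such an atlas (for instance one with contractible chart domains).
  Sections are families of local representatives, as functions of the coordinate
  \<open>x \<in> crd i ` cdom i\<close>. Tangent vectors are written in the coordinate basis of chart \<open>i\<close>.

  \<open>metric i x u v\<close> is the Riemannian metric, \<open>frame i x a\<close> is the \<open>a\<close>-th vector of an oriented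
  orthonormal frame on \<open>cdom i\<close>, \<open>cliff\<close> is Clifford multiplication of the model space \<open>real ^ 'n\<close> on the
  complex spinor module \<open>complex ^ 'm\<close>, and \<open>spin_lift i j\<close> is the transition function, with values in the
  spin group, of the principal spin bundle. The dimension of the manifold is \<open>CARD('n)\<close>; the order on
  \<open>'n\<close> only serves to write sums over \<open>a < b < \<dots>\<close>.
\<close>

record ('p, 'i, 'n, 'm) spin_data =
  points :: "'p topology"
  charts :: "'i set"
  cdom :: "'i \<Rightarrow> 'p set"
  crd :: "'i \<Rightarrow> 'p \<Rightarrow> real ^ 'n"
  metric :: "'i \<Rightarrow> real ^ 'n \<Rightarrow> real ^ 'n \<Rightarrow> real ^ 'n \<Rightarrow> real"
  frame :: "'i \<Rightarrow> real ^ 'n \<Rightarrow> 'n \<Rightarrow> real ^ 'n"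
  cliff :: "real ^ 'n \<Rightarrow> complex ^ 'm ^ 'm"
  spin_lift :: "'i \<Rightarrow> 'i \<Rightarrow> real ^ 'n \<Rightarrow> complex ^ 'm ^ 'm"

definition cimg :: "('p, 'i, 'n::finite, 'm::finite) spin_data \<Rightarrow> 'i \<Rightarrow> (real ^ 'n) set" where
  "cimg M i = crd M i ` cdom M i"

definition overlap :: "('p, 'i, 'n::finite, 'm::finite) spin_data \<Rightarrow> 'i \<Rightarrow> 'i \<Rightarrow> (real ^ 'n) set" where
  "overlap M i j = crd M i ` (cdom M i \<inter> cdom M j)"

definition transition ::
    "('p, 'i, 'n::finite, 'm::finite) spin_data \<Rightarrow> 'i \<Rightarrow> 'i \<Rightarrow> real ^ 'n \<Rightarrow> real ^ 'n" where
  "transition M i j x = crd M j (the_inv_into (cdom M i) (crd M i) x)"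

abbreviation dtransition ::
    "('p, 'i, 'n::finite, 'm::finite) spin_data \<Rightarrow> 'i \<Rightarrow> 'i \<Rightarrow> real ^ 'n \<Rightarrow> real ^ 'n \<Rightarrow> real ^ 'n" where
  "dtransition M i j x u \<equiv> dd (transition M i j) x u"

definition oriented_manifold :: "('p, 'i, 'n::finite, 'm::finite) spin_data \<Rightarrow> bool" where
  "oriented_manifold M \<longleftrightarrow>
     Hausdorff_space (points M) \<and> second_countable (points M) \<and>
     (\<Union>i\<in>charts M. cdom M i) = topspace (points M) \<and>
     (\<forall>i\<in>charts M. openin (points M) (cdom M i) \<and> open (cimg M i) \<and>
        homeomorphic_map (subtopology (points M) (cdom M i)) (top_of_set (cimg M i)) (crd M i)) \<and>
     (\<forall>i\<in>charts M. \<forall>j\<in>charts M.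
        smooth_on (overlap M i j) (transition M i j) \<and>
        (\<forall>x\<in>overlap M i j. det (matrix (dtransition M i j x)) > 0))"

definition riemannian_metric :: "('p, 'i, 'n::finite, 'm::finite) spin_data \<Rightarrow> bool" where
  "riemannian_metric M \<longleftrightarrow>
     (\<forall>i\<in>charts M.
        (\<forall>u v. smooth_on (cimg M i) (\<lambda>x. metric M i x u v)) \<and>
        (\<forall>x\<in>cimg M i. bilinear (metric M i x) \<and>
           (\<forall>u v. metric M i x u v = metric M i x v u) \<and>
           (\<forall>u. u \<noteq> 0 \<longrightarrow> metric M i x u u > 0))) \<and>
     (\<forall>i\<in>charts M. \<forall>j\<in>charts M. \<forall>x\<in>overlap M i j. \<forall>u v.
        metric M j (transition M i j x) (dtransition M i j x u) (dtransition M i j x v)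
          = metric M i x u v)"

definition oriented_orthonormal_frames :: "('p, 'i, 'n::finite, 'm::finite) spin_data \<Rightarrow> bool" where
  "oriented_orthonormal_frames M \<longleftrightarrow>
     (\<forall>i\<in>charts M.
        (\<forall>a. smooth_on (cimg M i) (\<lambda>x. frame M i x a)) \<and>
        (\<forall>x\<in>cimg M i.
           (\<forall>a b. metric M i x (frame M i x a) (frame M i x b) = (if a = b then 1 else 0)) \<and>
           det (\<chi> a. frame M i x a) > 0))"

text \<open>
  The irreducible complex representation of the Clifford algebra with \<open>v \<cdot> v = - |v|^2\<close>:
  irreducibility is expressed by the dimension \<open>2 ^ (n div 2)\<close>.
\<close>

definition clifford_module :: "(real ^ 'n::finite \<Rightarrow> complex ^ 'm ^ 'm::finite) \<Rightarrow> bool" where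
  "clifford_module \<gamma> \<longleftrightarrow>
     CARD('m) = 2 ^ (CARD('n) div 2) \<and> linear \<gamma> \<and>
     (\<forall>v. \<gamma> v ** \<gamma> v = - (v \<bullet> v) *\<^sub>R mat 1)"

text \<open>
  The spin group consists of the products of an even number of unit vectors. It is realised here by its
  image under the spinor representation, which is faithful on the even part of the Clifford algebra.
\<close>

inductive_set spin_group :: "(real ^ 'n::finite \<Rightarrow> complex ^ 'm ^ 'm::finite) \<Rightarrow> (complex ^ 'm ^ 'm) set"
  for \<gamma> :: "real ^ 'n::finite \<Rightarrow> complex ^ 'm ^ 'm::finite" where
  one: "mat 1 \<in> spin_group \<gamma>"
| step: "norm u = 1 \<Longrightarrow> norm v = 1 \<Longrightarrow> A \<in> spin_group \<gamma> \<Longrightarrow> \<gamma> u ** \<gamma> v ** A \<in> spin_group \<gamma>"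

definition frame_coords ::
    "('p, 'i, 'n::finite, 'm::finite) spin_data \<Rightarrow> 'i \<Rightarrow> real ^ 'n \<Rightarrow> real ^ 'n \<Rightarrow> real ^ 'n" where
  "frame_coords M i x u = (\<chi> a. metric M i x u (frame M i x a))"

text \<open>
  A spin structure lifts the \<open>SO(n)\<close>-valued transition functions of the orthonormal frames to a cocycle
  of \<open>Spin(n)\<close>-valued ones. The last conjunct says that the rotation covered by \<open>L = spin_lift i j x\<close>,
  namely \<open>w \<mapsto> L w L\<^sup>-\<^sup>1\<close>, takes frame coordinates with respect to frame \<open>j\<close> to those with respect
  to frame \<open>i\<close>.
\<close>

definition spin_structure :: "('p, 'i, 'n::finite, 'm::finite) spin_data \<Rightarrow> bool" where
  "spin_structure M \<longleftrightarrow>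
     (\<forall>i\<in>charts M. \<forall>j\<in>charts M.
        smooth_on (overlap M i j) (spin_lift M i j) \<and>
        (\<forall>x\<in>overlap M i j. spin_lift M i j x \<in> spin_group (cliff M))) \<and>
     (\<forall>i\<in>charts M. \<forall>j\<in>charts M. \<forall>k\<in>charts M.
        \<forall>x\<in>crd M i ` (cdom M i \<inter> cdom M j \<inter> cdom M k).
          spin_lift M i k x = spin_lift M i j x ** spin_lift M j k (transition M i j x)) \<and>
     (\<forall>i\<in>charts M. \<forall>j\<in>charts M. \<forall>x\<in>overlap M i j. \<forall>u.
        cliff M (frame_coords M i x u) ** spin_lift M i j x =
        spin_lift M i j x **
          cliff M (frame_coords M j (transition M i j x) (dtransition M i j x u)))"

definition oriented_riemannian_spin_manifold ::
    "('p, 'i, 'n::finite, 'm::finite) spin_data \<Rightarrow> bool" where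
  "oriented_riemannian_spin_manifold M \<longleftrightarrow>
     oriented_manifold M \<and> riemannian_metric M \<and> oriented_orthonormal_frames M \<and>
     clifford_module (cliff M) \<and> spin_structure M"

section \<open>Vector fields, 3-forms and spinor fields\<close>

text \<open>Unlike \<open>real ^ 'n\<close>, these do not fix the sort of the index type to \<open>finite\<close>.\<close>

type_synonym 'n rvec = "(real, 'n) vec"
type_synonym 'm cvec = "(complex, 'm) vec"
type_synonym ('i, 'n) vfield = "'i \<Rightarrow> 'n rvec \<Rightarrow> 'n rvec"
type_synonym ('i, 'n) form3 = "'i \<Rightarrow> 'n rvec \<Rightarrow> 'n rvec \<Rightarrow> 'n rvec \<Rightarrow> 'n rvec \<Rightarrow> real"
type_synonym ('i, 'n, 'm) spinor = "'i \<Rightarrow> 'n rvec \<Rightarrow> 'm cvec"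

definition vector_field ::
    "('p, 'i, 'n::finite, 'm::finite) spin_data \<Rightarrow> ('i, 'n) vfield \<Rightarrow> bool" where
  "vector_field M X \<longleftrightarrow>
     (\<forall>i\<in>charts M. smooth_on (cimg M i) (X i)) \<and>
     (\<forall>i\<in>charts M. \<forall>j\<in>charts M. \<forall>x\<in>overlap M i j.
        X j (transition M i j x) = dtransition M i j x (X i x))"

definition three_form ::
    "('p, 'i, 'n::finite, 'm::finite) spin_data \<Rightarrow> ('i, 'n) form3 \<Rightarrow> bool" where
  "three_form M T \<longleftrightarrow>
     (\<forall>i\<in>charts M.
        (\<forall>u v w. smooth_on (cimg M i) (\<lambda>x. T i x u v w)) \<and>
        (\<forall>x\<in>cimg M i. \<forall>u v w.
           linear (\<lambda>u. T i x u v w) \<and>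
           T i x v u w = - T i x u v w \<and> T i x u w v = - T i x u v w)) \<and>
     (\<forall>i\<in>charts M. \<forall>j\<in>charts M. \<forall>x\<in>overlap M i j. \<forall>u v w.
        T j (transition M i j x) (dtransition M i j x u) (dtransition M i j x v) (dtransition M i j x w)
          = T i x u v w)"

definition spinor_field ::
    "('p, 'i, 'n::finite, 'm::finite) spin_data \<Rightarrow> ('i, 'n, 'm) spinor \<Rightarrow> bool" where
  "spinor_field M \<psi> \<longleftrightarrow>
     (\<forall>i\<in>charts M. smooth_on (cimg M i) (\<psi> i)) \<and>
     (\<forall>i\<in>charts M. \<forall>j\<in>charts M. \<forall>x\<in>overlap M i j.
        \<psi> i x = spin_lift M i j x *v \<psi> j (transition M i j x))"

section \<open>Levi-Civita connection, curvature and the connections with torsion\<close>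

definition inv_gram ::
    "('p, 'i, 'n::finite, 'm::finite) spin_data \<Rightarrow> 'i \<Rightarrow> real ^ 'n \<Rightarrow> real ^ 'n ^ 'n" where
  "inv_gram M i x = matrix_inv (\<chi> k l. metric M i x (axis k 1) (axis l 1))"

definition sharp ::
    "('p, 'i, 'n::finite, 'm::finite) spin_data \<Rightarrow> 'i \<Rightarrow> real ^ 'n \<Rightarrow> (real ^ 'n \<Rightarrow> real) \<Rightarrow> real ^ 'n" where
  "sharp M i x \<alpha> = inv_gram M i x *v (\<chi> l. \<alpha> (axis l 1))"

text \<open>
  Christoffel symbols as a bilinear map: the component \<open>k\<close> of
  \<open>christoffel M i x (axis p 1) (axis q 1)\<close> is
  \<open>1/2 \<Sum>l. g^{kl} (\<partial>_p g_{ql} + \<partial>_q g_{pl} - \<partial>_l g_{pq})\<close>.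
\<close>

definition christoffel ::
    "('p, 'i, 'n::finite, 'm::finite) spin_data \<Rightarrow> 'i \<Rightarrow> real ^ 'n \<Rightarrow> real ^ 'n \<Rightarrow> real ^ 'n \<Rightarrow> real ^ 'n" where
  "christoffel M i x u v =
     sharp M i x (\<lambda>w. (dd (\<lambda>y. metric M i y v w) x u + dd (\<lambda>y. metric M i y u w) x v
                        - dd (\<lambda>y. metric M i y u v) x w) / 2)"

definition riemann ::
    "('p, 'i, 'n::finite, 'm::finite) spin_data \<Rightarrow>
       'i \<Rightarrow> real ^ 'n \<Rightarrow> real ^ 'n \<Rightarrow> real ^ 'n \<Rightarrow> real ^ 'n \<Rightarrow> real ^ 'n" where
  "riemann M i x u v w =
     dd (\<lambda>y. christoffel M i y v w) x u - dd (\<lambda>y. christoffel M i y u w) x v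
     + christoffel M i x u (christoffel M i x v w) - christoffel M i x v (christoffel M i x u w)"

definition ricci ::
    "('p, 'i, 'n::finite, 'm::finite) spin_data \<Rightarrow> 'i \<Rightarrow> real ^ 'n \<Rightarrow> real ^ 'n \<Rightarrow> real ^ 'n \<Rightarrow> real" where
  "ricci M i x v w = (\<Sum>k\<in>UNIV. riemann M i x (axis k 1) v w $ k)"

definition scal ::
    "('p, 'i, 'n::finite, 'm::finite) spin_data \<Rightarrow> 'i \<Rightarrow> real ^ 'n \<Rightarrow> real" where
  "scal M i x = (\<Sum>k\<in>UNIV. \<Sum>l\<in>UNIV. inv_gram M i x $ k $ l * ricci M i x (axis k 1) (axis l 1))"

text \<open>Connection coefficients of \<open>\<nabla>^s Y = \<nabla>^g Y + 2 s T(_, Y, -)\<close>.\<close>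

definition conn ::
    "('p, 'i, 'n::finite, 'm::finite) spin_data \<Rightarrow> ('i, 'n) form3 \<Rightarrow> real \<Rightarrow>
       'i \<Rightarrow> real ^ 'n \<Rightarrow> real ^ 'n \<Rightarrow> real ^ 'n \<Rightarrow> real ^ 'n" where
  "conn M T s i x u v = christoffel M i x u v + (2 * s) *\<^sub>R sharp M i x (T i x u v)"

text \<open>\<open>(\<nabla>^s_u T)(v, w, z)\<close>, evaluated by extending \<open>v, w, z\<close> constantly in the coordinates of chart \<open>i\<close>.\<close>

definition nabla_T ::
    "('p, 'i, 'n::finite, 'm::finite) spin_data \<Rightarrow> ('i, 'n) form3 \<Rightarrow> real \<Rightarrow>
       'i \<Rightarrow> real ^ 'n \<Rightarrow> real ^ 'n \<Rightarrow> real ^ 'n \<Rightarrow> real ^ 'n \<Rightarrow> real ^ 'n \<Rightarrow> real" where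
  "nabla_T M T s i x u v w z =
     dd (\<lambda>y. T i y v w z) x u
     - T i x (conn M T s i x u v) w z - T i x v (conn M T s i x u w) z
     - T i x v w (conn M T s i x u z)"

definition parallel_torsion ::
    "('p, 'i, 'n::finite, 'm::finite) spin_data \<Rightarrow> ('i, 'n) form3 \<Rightarrow> bool" where
  "parallel_torsion M T \<longleftrightarrow>
     (\<forall>i\<in>charts M. \<forall>x\<in>cimg M i. \<forall>u v w z. nabla_T M T (1/4) i x u v w z = 0)"

section \<open>Clifford multiplication by vectors and forms\<close>

definition cmul ::
    "('p, 'i, 'n::finite, 'm::finite) spin_data \<Rightarrow> 'i \<Rightarrow> 'n rvec \<Rightarrow> 'n rvec \<Rightarrow> 'm cvec \<Rightarrow> 'm cvec"
  where "cmul M i x u \<phi> = cliff M (frame_coords M i x u) *v \<phi>"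

definition cmul2 ::
    "('p, 'i, 'n::{finite,linorder}, 'm::finite) spin_data \<Rightarrow> 'i \<Rightarrow> 'n rvec \<Rightarrow>
       ('n rvec \<Rightarrow> 'n rvec \<Rightarrow> real) \<Rightarrow> 'm cvec \<Rightarrow> 'm cvec" where
  "cmul2 M i x \<omega> \<phi> = (let e = frame M i x in
     \<Sum>(a, b)\<in>{(a, b). a < b}. \<omega> (e a) (e b) *\<^sub>R cmul M i x (e a) (cmul M i x (e b) \<phi>))"

definition cmul3 ::
    "('p, 'i, 'n::{finite,linorder}, 'm::finite) spin_data \<Rightarrow> 'i \<Rightarrow> 'n rvec \<Rightarrow>
       ('n rvec \<Rightarrow> 'n rvec \<Rightarrow> 'n rvec \<Rightarrow> real) \<Rightarrow> 'm cvec \<Rightarrow> 'm cvec" where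
  "cmul3 M i x \<omega> \<phi> = (let e = frame M i x in
     \<Sum>(a, b, c)\<in>{(a, b, c). a < b \<and> b < c}.
       \<omega> (e a) (e b) (e c) *\<^sub>R cmul M i x (e a) (cmul M i x (e b) (cmul M i x (e c) \<phi>)))"

definition cmul4 ::
    "('p, 'i, 'n::{finite,linorder}, 'm::finite) spin_data \<Rightarrow> 'i \<Rightarrow> 'n rvec \<Rightarrow>
       ('n rvec \<Rightarrow> 'n rvec \<Rightarrow> 'n rvec \<Rightarrow> 'n rvec \<Rightarrow> real) \<Rightarrow> 'm cvec \<Rightarrow> 'm cvec" where
  "cmul4 M i x \<omega> \<phi> = (let e = frame M i x in
     \<Sum>(a, b, c, d)\<in>{(a, b, c, d). a < b \<and> b < c \<and> c < d}.
       \<omega> (e a) (e b) (e c) (e d) *\<^sub>R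
         cmul M i x (e a) (cmul M i x (e b) (cmul M i x (e c) (cmul M i x (e d) \<phi>))))"

text \<open>\<open>u \<and> \<omega>\<close> for a vector \<open>u\<close>, identified with a 1-form by the metric, and a 3-form \<open>\<omega>\<close>.\<close>

definition wedge3 ::
    "('p, 'i, 'n::finite, 'm::finite) spin_data \<Rightarrow> 'i \<Rightarrow> 'n rvec \<Rightarrow> 'n rvec \<Rightarrow>
       ('n rvec \<Rightarrow> 'n rvec \<Rightarrow> 'n rvec \<Rightarrow> real) \<Rightarrow>
       'n rvec \<Rightarrow> 'n rvec \<Rightarrow> 'n rvec \<Rightarrow> 'n rvec \<Rightarrow> real" where
  "wedge3 M i x u \<omega> v1 v2 v3 v4 =
     metric M i x u v1 * \<omega> v2 v3 v4 - metric M i x u v2 * \<omega> v1 v3 v4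
     + metric M i x u v3 * \<omega> v1 v2 v4 - metric M i x u v4 * \<omega> v1 v2 v3"

definition norm3_sq ::
    "('p, 'i, 'n::{finite,linorder}, 'm::finite) spin_data \<Rightarrow> ('i, 'n) form3 \<Rightarrow> 'i \<Rightarrow> 'n rvec \<Rightarrow> real" where
  "norm3_sq M T i x = (let e = frame M i x in
     \<Sum>(a, b, c)\<in>{(a, b, c). a < b \<and> b < c}. (T i x (e a) (e b) (e c))\<^sup>2)"

section \<open>Spinorial connections, Dirac operators and the twistor operator\<close>

text \<open>
  The spinorial lift of the Levi-Civita connection,
  \<open>\<nabla>^g_u \<psi> = d\<psi>(u) + 1/2 \<Sum>a<b. g(\<nabla>^g_u e_a, e_b) e_a e_b \<psi>\<close>.
\<close>

definition nabla_g ::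
    "('p, 'i, 'n::{finite,linorder}, 'm::finite) spin_data \<Rightarrow>
       ('i, 'n, 'm) spinor \<Rightarrow> 'i \<Rightarrow> 'n rvec \<Rightarrow> 'n rvec \<Rightarrow> 'm cvec" where
  "nabla_g M \<psi> i x u = (let e = frame M i in
     dd (\<psi> i) x u + (1/2) *\<^sub>R (\<Sum>(a, b)\<in>{(a, b). a < b}.
       metric M i x (dd (\<lambda>y. e y a) x u + christoffel M i x u (e x a)) (e x b) *\<^sub>R
         cmul M i x (e x a) (cmul M i x (e x b) (\<psi> i x))))"

definition nabla ::
    "('p, 'i, 'n::{finite,linorder}, 'm::finite) spin_data \<Rightarrow> ('i, 'n) form3 \<Rightarrow> real \<Rightarrow>
       ('i, 'n, 'm) spinor \<Rightarrow> 'i \<Rightarrow> 'n rvec \<Rightarrow> 'n rvec \<Rightarrow> 'm cvec" where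
  "nabla M T s \<psi> i x u = nabla_g M \<psi> i x u + s *\<^sub>R cmul2 M i x (T i x u) (\<psi> i x)"

definition dirac_g ::
    "('p, 'i, 'n::{finite,linorder}, 'm::finite) spin_data \<Rightarrow> ('i, 'n, 'm) spinor \<Rightarrow> ('i, 'n, 'm) spinor" where
  "dirac_g M \<psi> i x =
     (\<Sum>a\<in>UNIV. cmul M i x (frame M i x a) (nabla_g M \<psi> i x (frame M i x a)))"

definition dirac ::
    "('p, 'i, 'n::{finite,linorder}, 'm::finite) spin_data \<Rightarrow> ('i, 'n) form3 \<Rightarrow> real \<Rightarrow>
       ('i, 'n, 'm) spinor \<Rightarrow> ('i, 'n, 'm) spinor" where
  "dirac M T s \<psi> i x =
     (\<Sum>a\<in>UNIV. cmul M i x (frame M i x a) (nabla M T s \<psi> i x (frame M i x a)))"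

definition dirac_slash ::
    "('p, 'i, 'n::{finite,linorder}, 'm::finite) spin_data \<Rightarrow> ('i, 'n) form3 \<Rightarrow>
       ('i, 'n, 'm) spinor \<Rightarrow> ('i, 'n, 'm) spinor" where
  "dirac_slash M T \<psi> i x = dirac_g M \<psi> i x + (1/4) *\<^sub>R cmul3 M i x (T i x) (\<psi> i x)"

text \<open>
  Sections of \<open>TM \<otimes> \<Sigma>M\<close> are represented by their components with respect to the frame: the vector
  \<open>(\<chi> k. \<phi> k)\<close> of spinors stands for \<open>\<Sum>k. e_k \<otimes> \<phi> k\<close>.
\<close>

definition twistor_op ::
    "('p, 'i, 'n::{finite,linorder}, 'm::finite) spin_data \<Rightarrow> ('i, 'n) form3 \<Rightarrow> real \<Rightarrow>
       ('i, 'n, 'm) spinor \<Rightarrow> 'i \<Rightarrow> 'n rvec \<Rightarrow> ('m cvec, 'n) vec" where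
  "twistor_op M T s \<psi> i x = (\<chi> k.
     nabla M T s \<psi> i x (frame M i x k)
     + (1 / real CARD('n)) *\<^sub>R cmul M i x (frame M i x k) (dirac M T s \<psi> i x))"

definition twistor_spinor ::
    "('p, 'i, 'n::{finite,linorder}, 'm::finite) spin_data \<Rightarrow> ('i, 'n) form3 \<Rightarrow> real \<Rightarrow>
       ('i, 'n, 'm) spinor \<Rightarrow> bool" where
  "twistor_spinor M T s \<psi> \<longleftrightarrow> (\<forall>i\<in>charts M. \<forall>x\<in>cimg M i. twistor_op M T s \<psi> i x = 0)"

end

theory Submission
  imports Defs
begin

text \<open>
  Work in a chart with the orthonormal frame \<open>e\<close>. Let \<open>\<nabla>\<close> be the Levi-Civita spin connection, \<open>D\<close> its Dirac
  operator, and write \<open>\<theta>\<close> for the Clifford action of the torsion form and \<open>X\<close> for Clifford multiplication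
  by a vector. All operators in the statement are combinations of \<open>\<theta>\<close> and \<open>X\<close>, since
  \<open>X \<lrcorner> T = - (X \<theta> + \<theta> X) / 2\<close> and \<open>X \<and> T = (X \<theta> - \<theta> X) / 2\<close>. For the given \<open>s\<close> the two forms of the twistor equation
  then have the same coefficients, and a bump function extends each tangent vector to a vector field.

  Parallelism of the torsion becomes \<open>[\<nabla>\<^sub>X, \<theta>] = [X, \<theta>\<^sup>2] / 8\<close>. The twistor equation says
  \<open>\<nabla>\<^sub>X \<psi> = X \<eta> + (s / 2) \<theta> X \<psi>\<close> with \<open>\<eta>\<close> a combination of \<open>\<theta> \<psi>\<close> and \<open>D \<psi>\<close>. Differentiating it once more and taking the trace
  expresses \<open>\<Sum>a. \<nabla>\<^sup>2(e\<^sub>a, e\<^sub>a) \<psi>\<close> through \<open>D\<^sup>2 \<psi>\<close>, \<open>\<theta> D \<psi>\<close>, \<open>\<theta>\<^sup>2 \<psi>\<close> and \<open>\<psi>\<close>, by the identities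
  \<open>\<Sum>a. e\<^sub>a \<theta> e\<^sub>a = (n - 6) \<theta>\<close> and \<open>\<Sum>a. e\<^sub>a \<theta>\<^sup>2 e\<^sub>a = (8 - n) \<theta>\<^sup>2 - 8 |T|\<^sup>2\<close>; the Lichnerowicz formula
  \<open>D\<^sup>2 = - \<Sum>a. \<nabla>\<^sup>2(e\<^sub>a, e\<^sub>a) + Scal / 4\<close> turns this into an equation for \<open>D\<^sup>2 \<psi>\<close>.
\<close>

section \<open>Clifford algebra\<close>

text \<open>The number \<open>s\<close> and the factor 1/(2(n-3)) are forced. With an unknown factor
  c in front of X \<and> T in the second equation, the \<theta> X terms agree iff s = c + 1/4, and
  the X \<theta> terms then require s (n-3)/n = (n-1)/(4n). The same value of \<open>s\<close>
  closes the computation of the square. Expanding \<open>(D + \<theta>/4)\<^sup>2\<close> leaves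
  D(\<theta> \<psi>), which contains the contraction of T with \<nabla> \<psi>; the twistor equation
  trades this first-order term for \<theta> and D. In the result the mixed term \<theta> D \<psi>
  carries a multiple of 1 - 4 s (n-3)/(n-1), so it disappears exactly for this \<open>s\<close>.
  Since \<eta> contains D \<psi>, the term \<open>D\<^sup>2 \<psi>\<close> occurs on both sides of
  the traced equation, with net factor (n-1)/n; this is the origin of n/(n-1) in front of
  Scal/4.\<close>

lemma sum_rotate3:
  "(\<Sum>a\<in>A. \<Sum>b\<in>B. \<Sum>c\<in>C. f a b c) = (\<Sum>c\<in>C. \<Sum>a\<in>A. \<Sum>b\<in>B. f a b c)"
proof -
  have "(\<Sum>a\<in>A. \<Sum>b\<in>B. \<Sum>c\<in>C. f a b c) = (\<Sum>a\<in>A. \<Sum>c\<in>C. \<Sum>b\<in>B. f a b c)"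
    by (intro sum.cong refl sum.swap)
  also have "\<dots> = (\<Sum>c\<in>C. \<Sum>a\<in>A. \<Sum>b\<in>B. f a b c)"
    by (rule sum.swap)
  finally show ?thesis .
qed

lemma sum_rotate4:
  "(\<Sum>a\<in>A. \<Sum>b\<in>B. \<Sum>c\<in>C. \<Sum>d\<in>D. f a b c d) = (\<Sum>d\<in>D. \<Sum>a\<in>A. \<Sum>b\<in>B. \<Sum>c\<in>C. f a b c d)"
proof -
  have "(\<Sum>a\<in>A. \<Sum>b\<in>B. \<Sum>c\<in>C. \<Sum>d\<in>D. f a b c d) = (\<Sum>a\<in>A. \<Sum>d\<in>D. \<Sum>b\<in>B. \<Sum>c\<in>C. f a b c d)"
    by (intro sum.cong refl sum_rotate3)
  also have "\<dots> = (\<Sum>d\<in>D. \<Sum>a\<in>A. \<Sum>b\<in>B. \<Sum>c\<in>C. f a b c d)"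
    by (rule sum.swap)
  finally show ?thesis .
qed

lemma sum_pairs_ordered:
  fixes f :: "'n::{finite,linorder} \<Rightarrow> 'n \<Rightarrow> 'a::real_vector"
  assumes "\<And>a b. f b a = f a b" "\<And>a. f a a = 0"
  shows "(\<Sum>a\<in>UNIV. \<Sum>b\<in>UNIV. f a b) = 2 *\<^sub>R (\<Sum>(a, b)\<in>{(a, b). a < b}. f a b)"
proof -
  have "(\<Sum>(a, b)\<in>{(a, b). a < b}. f a b) = (\<Sum>(a, b)\<in>UNIV. if a < b then f a b else 0)"
    by (rule sum.mono_neutral_cong_left) (auto split: if_splits)
  also have "\<dots> = (\<Sum>a\<in>UNIV. \<Sum>b\<in>UNIV. if a < b then f a b else 0)"
    by (simp add: sum.cartesian_product)
  finally have *: "(\<Sum>(a, b)\<in>{(a, b). a < b}. f a b) = (\<Sum>a\<in>UNIV. \<Sum>b\<in>UNIV. if a < b then f a b else 0)" .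
  have expand: "f a b = (if a < b then f a b else 0) + (if b < a then f b a else 0)" for a b
    using assms by (cases a b rule: linorder_cases) auto
  have "(\<Sum>a\<in>UNIV. \<Sum>b\<in>UNIV. f a b)
    = (\<Sum>a\<in>UNIV. \<Sum>b\<in>UNIV. (if a < b then f a b else 0) + (if b < a then f b a else 0))"
    by (rule sum.cong[OF refl], rule sum.cong[OF refl], rule expand)
  also have "\<dots> = (\<Sum>a\<in>UNIV. \<Sum>b\<in>UNIV. if a < b then f a b else 0) + (\<Sum>b\<in>UNIV. \<Sum>a\<in>UNIV. if b < a then f b a else 0)"
    by (simp only: sum.distrib) (subst (2) sum.swap, rule refl)
  finally show ?thesis by (simp add: * scaleR_2)
qed

lemma sum_triples_ordered:
  fixes f :: "'n::{finite,linorder} \<Rightarrow> 'n \<Rightarrow> 'n \<Rightarrow> 'a::real_vector"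
  assumes sym: "\<And>a b c. f b a c = f a b c" "\<And>a b c. f a c b = f a b c"
    and diag: "\<And>a c. f a a c = 0"
  shows "(\<Sum>a\<in>UNIV. \<Sum>b\<in>UNIV. \<Sum>c\<in>UNIV. f a b c) = 6 *\<^sub>R (\<Sum>(a, b, c)\<in>{(a, b, c). a < b \<and> b < c}. f a b c)"
proof -
  define g where "g a b c = (if a < b \<and> b < c then f a b c else 0)" for a b c
  define G where "G = (\<Sum>a\<in>UNIV. \<Sum>b\<in>UNIV. \<Sum>c\<in>UNIV. g a b c)"
  have "(\<Sum>(a, b, c)\<in>{(a, b, c). a < b \<and> b < c}. f a b c) = (\<Sum>(a, b, c)\<in>UNIV. g a b c)"
    by (rule sum.mono_neutral_cong_left) (auto simp: g_def split: if_splits)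
  also have "\<dots> = G"
    by (simp add: sum.cartesian_product G_def)
  finally have *: "(\<Sum>(a, b, c)\<in>{(a, b, c). a < b \<and> b < c}. f a b c) = G" .
  have diag': "f a b a = 0" "f b a a = 0" for a b
    by (metis sym diag)+
  have expand: "f a b c = g a b c + g a c b + g b a c + g b c a + g c a b + g c b a" for a b c
    by (cases a b rule: linorder_cases; cases b c rule: linorder_cases; cases a c rule: linorder_cases)
      (auto simp: g_def diag diag' sym dest: order.strict_trans; metis sym)+
  have "(\<Sum>a\<in>UNIV. \<Sum>b\<in>UNIV. \<Sum>c\<in>UNIV. g a c b) = G"
    unfolding G_def by (rule sum.cong[OF refl], rule sum.swap)
  moreover have "(\<Sum>a\<in>UNIV. \<Sum>b\<in>UNIV. \<Sum>c\<in>UNIV. g b a c) = G"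
    unfolding G_def by (rule sum.swap)
  moreover have "(\<Sum>a\<in>UNIV. \<Sum>b\<in>UNIV. \<Sum>c\<in>UNIV. g c a b) = G"
    unfolding G_def by (rule sum_rotate3)
  moreover have "(\<Sum>a\<in>UNIV. \<Sum>b\<in>UNIV. \<Sum>c\<in>UNIV. g b c a) = G"
    unfolding G_def by (rule sum_rotate3[symmetric])
  moreover have "(\<Sum>a\<in>UNIV. \<Sum>b\<in>UNIV. \<Sum>c\<in>UNIV. g c b a) = G"
    unfolding G_def by (subst sum_rotate3, rule sum.cong[OF refl], rule sum.swap)
  ultimately have "(\<Sum>a\<in>UNIV. \<Sum>b\<in>UNIV. \<Sum>c\<in>UNIV. f a b c) = G + G + G + G + G + G"
    unfolding expand by (simp add: sum.distrib G_def)
  also have "\<dots> = 6 *\<^sub>R G"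
    using scaleR_left_distrib[of 3 3 G] scaleR_left_distrib[of 2 1 G] by (simp add: scaleR_2 add.assoc)
  finally show ?thesis by (simp add: *)
qed

text \<open>Sorting the last three indices by the lemma on triples gives a factor 6; the first index
  then has four places in the sorted triple. So 24 arises as 6 times 4, with four orderings to
  compare instead of 24.\<close>

lemma sum_quadruples_ordered:
  fixes f :: "'n::{finite,linorder} \<Rightarrow> 'n \<Rightarrow> 'n \<Rightarrow> 'n \<Rightarrow> 'a::real_vector"
  assumes sym: "\<And>a b c d. f b a c d = f a b c d" "\<And>a b c d. f a c b d = f a b c d"
    "\<And>a b c d. f a b d c = f a b c d"
    and diag: "\<And>a c d. f a a c d = 0"
  shows "(\<Sum>a\<in>UNIV. \<Sum>b\<in>UNIV. \<Sum>c\<in>UNIV. \<Sum>d\<in>UNIV. f a b c d)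
    = 24 *\<^sub>R (\<Sum>(a, b, c, d)\<in>{(a, b, c, d). a < b \<and> b < c \<and> c < d}. f a b c d)"
proof -
  define g where "g a b c d = (if a < b \<and> b < c \<and> c < d then f a b c d else 0)" for a b c d
  define G where "G = (\<Sum>a\<in>UNIV. \<Sum>b\<in>UNIV. \<Sum>c\<in>UNIV. \<Sum>d\<in>UNIV. g a b c d)"
  have "(\<Sum>(a, b, c, d)\<in>{(a, b, c, d). a < b \<and> b < c \<and> c < d}. f a b c d) = (\<Sum>(a, b, c, d)\<in>UNIV. g a b c d)"
    by (rule sum.mono_neutral_cong_left) (auto simp: g_def split: if_splits)
  also have "\<dots> = G"
    by (simp add: sum.cartesian_product G_def)
  finally have *: "(\<Sum>(a, b, c, d)\<in>{(a, b, c, d). a < b \<and> b < c \<and> c < d}. f a b c d) = G" .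
  have triples: "(\<Sum>(b, c, d)\<in>{(b, c, d). b < c \<and> c < d}. h b c d)
      = (\<Sum>b\<in>UNIV. \<Sum>c\<in>UNIV. \<Sum>d\<in>UNIV. if b < c \<and> c < d then h b c d else 0)" for h :: "'n \<Rightarrow> 'n \<Rightarrow> 'n \<Rightarrow> 'a"
  proof -
    have "(\<Sum>(b, c, d)\<in>{(b, c, d). b < c \<and> c < d}. h b c d) = (\<Sum>(b, c, d)\<in>UNIV. if b < c \<and> c < d then h b c d else 0)"
      by (rule sum.mono_neutral_cong_left) (auto split: if_splits)
    then show ?thesis by (simp add: sum.cartesian_product)
  qed
  have diag': "f a b a d = 0" "f a b c a = 0" "f a b b d = 0" for a b c d
    by (metis sym diag)+
  have "(\<Sum>a\<in>UNIV. \<Sum>b\<in>UNIV. \<Sum>c\<in>UNIV. \<Sum>d\<in>UNIV. f a b c d)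
    = (\<Sum>a\<in>UNIV. 6 *\<^sub>R (\<Sum>b\<in>UNIV. \<Sum>c\<in>UNIV. \<Sum>d\<in>UNIV. if b < c \<and> c < d then f a b c d else 0))"
    unfolding triples[symmetric]
    by (rule sum.cong[OF refl], rule sum_triples_ordered) (auto simp: sym diag')
  also have "\<dots> = 6 *\<^sub>R (\<Sum>a\<in>UNIV. \<Sum>b\<in>UNIV. \<Sum>c\<in>UNIV. \<Sum>d\<in>UNIV. if b < c \<and> c < d then f a b c d else 0)"
    by (simp add: scaleR_sum_right)
  \<comment> \<open>\<open>a\<close> is inserted before, between or after \<open>b < c < d\<close>;
    if it equals one of them, both sides vanish.\<close>
  also have "(\<lambda>a b c d. if b < c \<and> c < d then f a b c d else 0)
      = (\<lambda>a b c d. g a b c d + g b a c d + g b c a d + g b c d a)" (is "?l = ?r")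
  proof (intro ext)
    fix a b c d
    have "f b a c d = f a b c d" "f b c a d = f a b c d" "f b c d a = f a b c d"
      by (simp_all add: sym)
    then show "?l a b c d = ?r a b c d"
      by (cases a b rule: linorder_cases; cases a c rule: linorder_cases; cases a d rule: linorder_cases)
        (auto simp: g_def diag diag')
  qed
  also have "(\<Sum>a\<in>UNIV. \<Sum>b\<in>UNIV. \<Sum>c\<in>UNIV. \<Sum>d\<in>UNIV. g a b c d + g b a c d + g b c a d + g b c d a) = G + G + G + G"
  proof -
    have "(\<Sum>a\<in>UNIV. \<Sum>b\<in>UNIV. \<Sum>c\<in>UNIV. \<Sum>d\<in>UNIV. g b a c d) = G"
      unfolding G_def by (rule sum.swap)
    moreover have "(\<Sum>a\<in>UNIV. \<Sum>b\<in>UNIV. \<Sum>c\<in>UNIV. \<Sum>d\<in>UNIV. g b c a d) = G"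
      unfolding G_def by (rule sum_rotate3[symmetric])
    moreover have "(\<Sum>a\<in>UNIV. \<Sum>b\<in>UNIV. \<Sum>c\<in>UNIV. \<Sum>d\<in>UNIV. g b c d a) = G"
      unfolding G_def by (rule sum_rotate4[symmetric])
    ultimately show ?thesis by (simp add: sum.distrib G_def)
  qed
  also have "6 *\<^sub>R (G + G + G + G) = 24 *\<^sub>R G"
    using scaleR_left_distrib[of 2 2 G] scaleR_scaleR[of 6 4 G] by (simp add: scaleR_2 add.assoc)
  finally show ?thesis by (simp only: *)
qed

section \<open>Clifford relations and the action of 2-forms\<close>

locale clifford_generators =
  fixes \<gamma> :: "'n::finite \<Rightarrow> 'a::real_algebra_1"
  assumes clifford: "\<gamma> a * \<gamma> b + \<gamma> b * \<gamma> a = (if a = b then - 2 else 0)"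
begin

text \<open>Sums run over all index tuples, so that indices need no order, can be renamed freely,
  and the coefficients may also be symmetric. A 2-form is thereby counted twice and a 3-form six
  times; the factors 1/2 and 1/6 in \<iota>, \<theta> and \<open>N\<close> correct this.\<close>

definition bivector :: "('n \<Rightarrow> 'n \<Rightarrow> real) \<Rightarrow> 'a" where
  "bivector \<Omega> = (\<Sum>a\<in>UNIV. \<Sum>b\<in>UNIV. \<Omega> a b *\<^sub>R (\<gamma> a * \<gamma> b))"

definition trivector :: "('n \<Rightarrow> 'n \<Rightarrow> 'n \<Rightarrow> real) \<Rightarrow> 'a" where
  "trivector t = (\<Sum>a\<in>UNIV. \<Sum>b\<in>UNIV. \<Sum>c\<in>UNIV. t a b c *\<^sub>R (\<gamma> a * \<gamma> b * \<gamma> c))"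

lemma generator_swap: "\<gamma> a * \<gamma> b = - (\<gamma> b * \<gamma> a) - (if a = b then 2 else 0)"
  using clifford[of a b, folded eq_diff_eq] by simp

lemma generator_square: "\<gamma> a * \<gamma> a = - 1"
proof -
  have "(2::real) *\<^sub>R (\<gamma> a * \<gamma> a) = 2 *\<^sub>R (- 1)"
    using clifford[of a a] by (simp add: scaleR_2)
  then show ?thesis
    by (simp only: scaleR_cancel_left) simp
qed

lemma generator_commutator:
  "\<gamma> e * \<gamma> f * \<gamma> a - \<gamma> a * (\<gamma> e * \<gamma> f)
     = (if e = a then 2 *\<^sub>R \<gamma> f else 0) - (if f = a then 2 *\<^sub>R \<gamma> e else 0)"
proof -
  have "\<gamma> e * \<gamma> f * \<gamma> a = \<gamma> e * (- (\<gamma> a * \<gamma> f) - (if f = a then 2 else 0))"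
    by (simp only: mult.assoc generator_swap[of f a])
  also have "\<dots> = - (\<gamma> e * \<gamma> a * \<gamma> f) - (if f = a then 2 *\<^sub>R \<gamma> e else 0)"
    by (simp add: algebra_simps scaleR_2 mult_2_right)
  also have "\<gamma> e * \<gamma> a * \<gamma> f = - (\<gamma> a * \<gamma> e * \<gamma> f) - (if e = a then 2 *\<^sub>R \<gamma> f else 0)"
    by (subst generator_swap[of e a]) (simp add: algebra_simps scaleR_2 mult_2)
  finally show ?thesis by (simp add: algebra_simps)
qed

text \<open>Each index of \<Omega> contributes a factor 2 through
  \<open>generator_commutator\<close>, and skewness makes the two contributions equal. So a quarter
  of \<open>bivector \<Omega>\<close> is the spin lift of the infinitesimal rotation
  \<Omega>.\<close>

lemma bivector_commutator:
  assumes "\<And>a b. \<Omega> b a = - \<Omega> a b"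
  shows "bivector \<Omega> * \<gamma> a - \<gamma> a * bivector \<Omega> = 4 *\<^sub>R (\<Sum>b\<in>UNIV. \<Omega> a b *\<^sub>R \<gamma> b)"
proof -
  have "bivector \<Omega> * \<gamma> a - \<gamma> a * bivector \<Omega>
      = (\<Sum>e\<in>UNIV. \<Sum>f\<in>UNIV. \<Omega> e f *\<^sub>R (\<gamma> e * \<gamma> f * \<gamma> a - \<gamma> a * (\<gamma> e * \<gamma> f)))"
    by (simp add: bivector_def sum_distrib_left sum_distrib_right sum_subtractf scaleR_diff_right)
  also have "\<dots> = (\<Sum>e\<in>UNIV. \<Sum>f\<in>UNIV. if e = a then (2 * \<Omega> e f) *\<^sub>R \<gamma> f else 0)
      - (\<Sum>e\<in>UNIV. \<Sum>f\<in>UNIV. if f = a then (2 * \<Omega> e f) *\<^sub>R \<gamma> e else 0)"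
    unfolding generator_commutator sum_subtractf[symmetric]
    by (intro sum.cong refl) (auto simp: scaleR_diff_right)
  also have "(\<Sum>e\<in>UNIV. \<Sum>f\<in>UNIV. if e = a then (2 * \<Omega> e f) *\<^sub>R \<gamma> f else 0)
      = (\<Sum>f\<in>UNIV. (2 * \<Omega> a f) *\<^sub>R \<gamma> f)"
    by (subst sum.swap) simp
  also have "(\<Sum>e\<in>UNIV. \<Sum>f\<in>UNIV. if f = a then (2 * \<Omega> e f) *\<^sub>R \<gamma> e else 0)
      = (\<Sum>e\<in>UNIV. (2 * \<Omega> e a) *\<^sub>R \<gamma> e)"
    by simp
  also have "\<dots> = - (\<Sum>f\<in>UNIV. (2 * \<Omega> a f) *\<^sub>R \<gamma> f)"
    by (subst assms) (simp add: sum_negf)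
  finally show ?thesis
    by (simp add: scaleR_sum_right sum.distrib[symmetric] scaleR_left_distrib[symmetric])
qed

text \<open>Only the anticommutators of the generators survive, which leaves the trace.\<close>

lemma bivector_symmetric:
  assumes "\<And>a b. \<Omega> b a = \<Omega> a b"
  shows "bivector \<Omega> = - of_real (\<Sum>a\<in>UNIV. \<Omega> a a)"
proof -
  have "2 *\<^sub>R bivector \<Omega>
      = (\<Sum>a\<in>UNIV. \<Sum>b\<in>UNIV. \<Omega> a b *\<^sub>R (\<gamma> a * \<gamma> b)) + (\<Sum>b\<in>UNIV. \<Sum>a\<in>UNIV. \<Omega> a b *\<^sub>R (\<gamma> a * \<gamma> b))"
    unfolding scaleR_2 bivector_def by (subst (2) sum.swap) simp
  also have "\<dots> = (\<Sum>a\<in>UNIV. \<Sum>b\<in>UNIV. \<Omega> a b *\<^sub>R (\<gamma> a * \<gamma> b + \<gamma> b * \<gamma> a))"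
    by (simp add: scaleR_right_distrib sum.distrib assms)
  also have "\<dots> = (\<Sum>a\<in>UNIV. \<Sum>b\<in>UNIV. if a = b then \<Omega> a b *\<^sub>R (- 2) else 0)"
    unfolding clifford by (intro sum.cong refl) simp
  also have "\<dots> = 2 *\<^sub>R (- of_real (\<Sum>a\<in>UNIV. \<Omega> a a))"
    by (simp add: of_real_def scaleR_sum_left sum_negf scaleR_2 sum.distrib[symmetric])
       (simp add: scaleR_right_distrib sum.distrib flip: one_add_one)
  finally show ?thesis by (simp only: scaleR_cancel_left) simp
qed

lemma bivector_mult:
  "bivector \<Omega> * x = (\<Sum>a\<in>UNIV. \<Sum>b\<in>UNIV. \<Omega> a b *\<^sub>R (\<gamma> a * \<gamma> b * x))"
  by (simp add: bivector_def sum_distrib_right)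

text \<open>Commutation with \<open>bivector \<Omega>\<close> is a derivation, so
  \<open>bivector_commutator\<close> applies to each generator in \<open>bivector \<Psi>\<close>.
  The matrix order is reversed, \<Psi> \<Omega> - \<Omega> \<Psi>, because \<Omega> replaces
  \<gamma> a by its row of coefficients; the quadratic term of \<open>curv_form\<close> has the same
  order.\<close>

lemma bivector_commutator_bivector:
  assumes "\<And>a b. \<Omega> b a = - \<Omega> a b"
  shows "bivector \<Omega> * bivector \<Psi> - bivector \<Psi> * bivector \<Omega>
    = 4 *\<^sub>R bivector (\<lambda>a b. \<Sum>f\<in>UNIV. \<Psi> a f * \<Omega> f b - \<Omega> a f * \<Psi> f b)"
proof -
  have 1: "bivector \<Omega> * (\<gamma> a * \<gamma> b) - \<gamma> a * \<gamma> b * bivector \<Omega>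
      = 4 *\<^sub>R (\<Sum>f\<in>UNIV. \<Omega> a f *\<^sub>R (\<gamma> f * \<gamma> b)) + 4 *\<^sub>R (\<Sum>f\<in>UNIV. \<Omega> b f *\<^sub>R (\<gamma> a * \<gamma> f))" for a b
  proof -
    have "bivector \<Omega> * (\<gamma> a * \<gamma> b) - \<gamma> a * \<gamma> b * bivector \<Omega>
        = (bivector \<Omega> * \<gamma> a - \<gamma> a * bivector \<Omega>) * \<gamma> b + \<gamma> a * (bivector \<Omega> * \<gamma> b - \<gamma> b * bivector \<Omega>)"
      by (simp add: algebra_simps)
    then show ?thesis
      by (simp add: bivector_commutator[OF assms] sum_distrib_left sum_distrib_right)
  qed
  have "bivector \<Omega> * bivector \<Psi> - bivector \<Psi> * bivector \<Omega>
    = (\<Sum>a\<in>UNIV. \<Sum>b\<in>UNIV. \<Psi> a b *\<^sub>R (bivector \<Omega> * (\<gamma> a * \<gamma> b) - \<gamma> a * \<gamma> b * bivector \<Omega>))"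
    unfolding bivector_def[of \<Psi>]
    by (simp add: sum_distrib_left sum_distrib_right scaleR_diff_right sum_subtractf)
  also have "\<dots> = 4 *\<^sub>R ((\<Sum>a\<in>UNIV. \<Sum>b\<in>UNIV. \<Sum>f\<in>UNIV. (\<Psi> a b * \<Omega> a f) *\<^sub>R (\<gamma> f * \<gamma> b))
      + (\<Sum>a\<in>UNIV. \<Sum>b\<in>UNIV. \<Sum>f\<in>UNIV. (\<Psi> a b * \<Omega> b f) *\<^sub>R (\<gamma> a * \<gamma> f)))"
    unfolding 1 by (simp add: scaleR_right_distrib sum.distrib scaleR_sum_right mult.commute mult.left_commute)
  also have "(\<Sum>a\<in>UNIV. \<Sum>b\<in>UNIV. \<Sum>f\<in>UNIV. (\<Psi> a b * \<Omega> a f) *\<^sub>R (\<gamma> f * \<gamma> b))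
      = - (\<Sum>f\<in>UNIV. \<Sum>b\<in>UNIV. \<Sum>a\<in>UNIV. (\<Omega> f a * \<Psi> a b) *\<^sub>R (\<gamma> f * \<gamma> b))"
  proof -
    have "(\<Sum>a\<in>UNIV. \<Sum>b\<in>UNIV. \<Sum>f\<in>UNIV. (\<Psi> a b * \<Omega> a f) *\<^sub>R (\<gamma> f * \<gamma> b))
      = (\<Sum>f\<in>UNIV. \<Sum>a\<in>UNIV. \<Sum>b\<in>UNIV. (\<Psi> a b * \<Omega> a f) *\<^sub>R (\<gamma> f * \<gamma> b))"
      by (rule sum_rotate3)
    also have "\<dots> = (\<Sum>f\<in>UNIV. \<Sum>b\<in>UNIV. \<Sum>a\<in>UNIV. (\<Psi> a b * \<Omega> a f) *\<^sub>R (\<gamma> f * \<gamma> b))"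
      by (rule sum.cong[OF refl], rule sum.swap)
    also have "\<dots> = - (\<Sum>f\<in>UNIV. \<Sum>b\<in>UNIV. \<Sum>a\<in>UNIV. (\<Omega> f a * \<Psi> a b) *\<^sub>R (\<gamma> f * \<gamma> b))"
      by (subst assms) (simp add: sum_negf mult.commute)
    finally show ?thesis .
  qed
  also have "(\<Sum>a\<in>UNIV. \<Sum>b\<in>UNIV. \<Sum>f\<in>UNIV. (\<Psi> a b * \<Omega> b f) *\<^sub>R (\<gamma> a * \<gamma> f))
      = (\<Sum>a\<in>UNIV. \<Sum>f\<in>UNIV. \<Sum>b\<in>UNIV. (\<Psi> a b * \<Omega> b f) *\<^sub>R (\<gamma> a * \<gamma> f))"
    by (rule sum.cong[OF refl], rule sum.swap)
  finally show ?thesis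
    by (simp add: bivector_def scaleR_sum_left sum_subtractf scaleR_left_diff_distrib add.commute)
qed

text \<open>The algebraic core of the Lichnerowicz formula. The triple product of generators is its
  skew part plus traces; the traces leave a Ricci contraction, which is symmetric, so that the
  fourth generator reduces it to the scalar trace.\<close>

lemma bivector_curvature:
  fixes R :: "'n \<Rightarrow> 'n \<Rightarrow> 'n \<Rightarrow> 'n \<Rightarrow> real"
  assumes skew: "\<And>a b c d. R b a c d = - R a b c d" "\<And>a b c d. R a b d c = - R a b c d"
    and bianchi: "\<And>a b c d. R a b c d + R b c a d + R c a b d = 0"
  shows "(\<Sum>a\<in>UNIV. \<Sum>b\<in>UNIV. \<gamma> a * \<gamma> b * bivector (R a b)) = of_real (2 * (\<Sum>a\<in>UNIV. \<Sum>b\<in>UNIV. R a b b a))"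
proof -
  define kd where "kd a b = (if a = b then 1 else 0::real)" for a b :: 'n
  \<comment> \<open>the totally skew part of the triple product, annihilated by the Bianchi identity\<close>
  define E where "E a b c = \<gamma> a * \<gamma> b * \<gamma> c + kd a b *\<^sub>R \<gamma> c + kd b c *\<^sub>R \<gamma> a - kd a c *\<^sub>R \<gamma> b" for a b c
  have swap': "\<gamma> a * \<gamma> b = - (\<gamma> b * \<gamma> a) - (2 * kd a b) *\<^sub>R 1" for a b
    using generator_swap[of a b] by (auto simp: kd_def scaleR_2)
  have kdc: "kd a b = kd b a" for a b by (simp add: kd_def)
  have cyc: "E b c a = E a b c" for a b c
  proof -
    have "\<gamma> b * \<gamma> c * \<gamma> a = \<gamma> a * (\<gamma> b * \<gamma> c) + (kd b a *\<^sub>R \<gamma> c + kd b a *\<^sub>R \<gamma> c) - (kd c a *\<^sub>R \<gamma> b + kd c a *\<^sub>R \<gamma> b)"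
      using generator_commutator[of b c a]
      by (simp add: kd_def algebra_simps scaleR_2 split: if_splits)
    then show ?thesis
      unfolding E_def by (simp add: kdc scaleR_2 algebra_simps)
  qed
  have E0: "(\<Sum>a\<in>UNIV. \<Sum>b\<in>UNIV. \<Sum>c\<in>UNIV. R a b c d *\<^sub>R E a b c) = 0" (is "?S = 0") for d
  proof -
    \<comment> \<open>Renaming the indices cyclically fixes \<open>E\<close> and rotates
      \<open>R\<close>; the three versions add up to the Bianchi sum.\<close>
    have 1: "?S = (\<Sum>a\<in>UNIV. \<Sum>b\<in>UNIV. \<Sum>c\<in>UNIV. R b c a d *\<^sub>R E a b c)"
      by (subst sum_rotate3) (simp add: cyc)
    have 2: "\<dots> = (\<Sum>a\<in>UNIV. \<Sum>b\<in>UNIV. \<Sum>c\<in>UNIV. R c a b d *\<^sub>R E a b c)"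
      by (subst sum_rotate3) (simp add: cyc)
    have "?S + ?S + ?S = (\<Sum>a\<in>UNIV. \<Sum>b\<in>UNIV. \<Sum>c\<in>UNIV. (R a b c d + R b c a d + R c a b d) *\<^sub>R E a b c)"
      using 1 2 by (simp add: scaleR_left_distrib sum.distrib)
    also have "\<dots> = 0" by (simp add: bianchi)
    finally have "3 *\<^sub>R ?S = 0" using scaleR_left_distrib[of 1 2 ?S] scaleR_2[of ?S] by (simp add: add.assoc)
    then show ?thesis by simp
  qed
  \<comment> \<open>The octahedron argument: the Bianchi identity for the four cyclic shifts of the
    indices, together with both skew symmetries, gives pair symmetry by linear arithmetic. It is
    what makes \<open>Ric\<close> symmetric.\<close>
  have pair: "R a b c d = R c d a b" for a b c d
    using skew bianchi[of a b c d] bianchi[of b c d a] bianchi[of c d a b] bianchi[of d a b c]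
    by (smt (verit))
  define Ric where "Ric a d = (\<Sum>b\<in>UNIV. R a b b d)" for a d
  have Ric: "Ric d a = Ric a d" for a d
    unfolding Ric_def by (intro sum.cong refl) (metis pair skew(1) skew(2) minus_minus)
  have inner: "(\<Sum>a\<in>UNIV. \<Sum>b\<in>UNIV. \<Sum>c\<in>UNIV. R a b c d *\<^sub>R (\<gamma> a * \<gamma> b * \<gamma> c)) = - 2 *\<^sub>R (\<Sum>a\<in>UNIV. Ric a d *\<^sub>R \<gamma> a)" for d
  proof -
    have diag: "R a a c d = 0" for a c using skew(1)[of a a c d] by simp
    have "R a b c d *\<^sub>R (\<gamma> a * \<gamma> b * \<gamma> c) = R a b c d *\<^sub>R E a b c
        - (R a b c d * kd a b) *\<^sub>R \<gamma> c - (R a b c d * kd b c) *\<^sub>R \<gamma> a + (R a b c d * kd a c) *\<^sub>R \<gamma> b" for a b c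
      by (simp add: E_def scaleR_right_distrib scaleR_diff_right)
    then have "(\<Sum>a\<in>UNIV. \<Sum>b\<in>UNIV. \<Sum>c\<in>UNIV. R a b c d *\<^sub>R (\<gamma> a * \<gamma> b * \<gamma> c))
       = (\<Sum>a\<in>UNIV. \<Sum>b\<in>UNIV. \<Sum>c\<in>UNIV. R a b c d *\<^sub>R E a b c)
       - (\<Sum>a\<in>UNIV. \<Sum>b\<in>UNIV. \<Sum>c\<in>UNIV. (R a b c d * kd a b) *\<^sub>R \<gamma> c)
       - (\<Sum>a\<in>UNIV. \<Sum>b\<in>UNIV. \<Sum>c\<in>UNIV. (R a b c d * kd b c) *\<^sub>R \<gamma> a)
       + (\<Sum>a\<in>UNIV. \<Sum>b\<in>UNIV. \<Sum>c\<in>UNIV. (R a b c d * kd a c) *\<^sub>R \<gamma> b)"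
      by (simp only: sum.distrib sum_subtractf)
    also have "(\<Sum>a\<in>UNIV. \<Sum>b\<in>UNIV. \<Sum>c\<in>UNIV. (R a b c d * kd a b) *\<^sub>R \<gamma> c) = 0"
      by (intro sum.neutral ballI) (auto simp: kd_def diag)
    also have "(\<Sum>a\<in>UNIV. \<Sum>b\<in>UNIV. \<Sum>c\<in>UNIV. (R a b c d * kd b c) *\<^sub>R \<gamma> a) = (\<Sum>a\<in>UNIV. Ric a d *\<^sub>R \<gamma> a)"
      by (simp add: Ric_def scaleR_sum_left kd_def if_distrib if_distribR cong: if_cong)
    also have "(\<Sum>a\<in>UNIV. \<Sum>b\<in>UNIV. \<Sum>c\<in>UNIV. (R a b c d * kd a c) *\<^sub>R \<gamma> b) = (\<Sum>a\<in>UNIV. \<Sum>b\<in>UNIV. R a b a d *\<^sub>R \<gamma> b)"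
      by (simp add: kd_def if_distrib if_distribR cong: if_cong)
    also have "\<dots> = - (\<Sum>b\<in>UNIV. Ric b d *\<^sub>R \<gamma> b)"
      by (subst sum.swap, subst skew(1)) (simp add: Ric_def scaleR_sum_left sum_negf)
    finally show ?thesis by (simp add: E0 scaleR_2)
  qed
  have "(\<Sum>a\<in>UNIV. \<Sum>b\<in>UNIV. \<gamma> a * \<gamma> b * bivector (R a b))
     = (\<Sum>d\<in>UNIV. (\<Sum>a\<in>UNIV. \<Sum>b\<in>UNIV. \<Sum>c\<in>UNIV. R a b c d *\<^sub>R (\<gamma> a * \<gamma> b * \<gamma> c)) * \<gamma> d)"
    (is "?L = ?R")
  proof -
    have "?L = (\<Sum>a\<in>UNIV. \<Sum>b\<in>UNIV. \<Sum>c\<in>UNIV. \<Sum>d\<in>UNIV. R a b c d *\<^sub>R (\<gamma> a * \<gamma> b * \<gamma> c * \<gamma> d))"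
      by (simp add: bivector_def sum_distrib_left mult.assoc)
    also have "\<dots> = (\<Sum>d\<in>UNIV. \<Sum>a\<in>UNIV. \<Sum>b\<in>UNIV. \<Sum>c\<in>UNIV. R a b c d *\<^sub>R (\<gamma> a * \<gamma> b * \<gamma> c * \<gamma> d))"
      by (rule sum_rotate4)
    also have "\<dots> = ?R" by (simp add: sum_distrib_right)
    finally show ?thesis .
  qed
  also have "\<dots> = - 2 *\<^sub>R bivector Ric"
    unfolding inner bivector_def
    by (subst sum.swap) (simp add: sum_distrib_right scaleR_sum_right sum_negf)
  also have "\<dots> = of_real (2 * (\<Sum>a\<in>UNIV. \<Sum>b\<in>UNIV. R a b b a))"
    by (subst bivector_symmetric[OF Ric]) (simp add: Ric_def of_real_def)
  finally show ?thesis .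
qed

end

section \<open>The Clifford action of a 3-form\<close>

locale clifford_three_form = clifford_generators \<gamma> for \<gamma> :: "'n::finite \<Rightarrow> 'a::real_algebra_1" +
  fixes t :: "'n \<Rightarrow> 'n \<Rightarrow> 'n \<Rightarrow> real"
  assumes skew12: "t b a c = - t a b c" and skew23: "t a c b = - t a b c"
begin

definition \<theta> :: 'a where "\<theta> = (1 / 6) *\<^sub>R trivector t"
definition \<iota> :: "'n \<Rightarrow> 'a" where "\<iota> a = (1 / 2) *\<^sub>R bivector (t a)"
definition N :: real where "N = (1 / 6) * (\<Sum>a\<in>UNIV. \<Sum>b\<in>UNIV. \<Sum>c\<in>UNIV. (t a b c)\<^sup>2)"

lemma cyclic_form: "t b c a = t a b c"
  using skew12[of b a c] skew23[of b a c] by simp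

lemma contraction_swap: "(\<Sum>e\<in>UNIV. \<Sum>f\<in>UNIV. t d f e *\<^sub>R X e f) = - (\<Sum>e\<in>UNIV. \<Sum>f\<in>UNIV. t d e f *\<^sub>R (X e f :: 'b::real_vector))"
  by (subst skew23) (simp add: sum_negf)

lemma contraction_commutator: "\<iota> a * \<gamma> b - \<gamma> b * \<iota> a = 2 *\<^sub>R (\<Sum>c\<in>UNIV. t a b c *\<^sub>R \<gamma> c)"
proof -
  have "\<iota> a * \<gamma> b - \<gamma> b * \<iota> a = (1 / 2) *\<^sub>R (bivector (t a) * \<gamma> b - \<gamma> b * bivector (t a))"
    by (simp add: \<iota>_def scaleR_diff_right)
  then show ?thesis by (simp add: bivector_commutator[OF skew23])
qed

lemma sum_generator_contraction: "(\<Sum>a\<in>UNIV. \<gamma> a * \<iota> a) = 3 *\<^sub>R \<theta>"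
  by (simp add: \<iota>_def \<theta>_def bivector_def trivector_def sum_distrib_left scaleR_sum_right mult.assoc)

lemma sum_contraction_generator: "(\<Sum>a\<in>UNIV. \<iota> a * \<gamma> a) = 3 *\<^sub>R \<theta>"
proof -
  have "t a a c = 0" for a c using skew12[of a a c] by simp
  then have "\<iota> a * \<gamma> a = \<gamma> a * \<iota> a" for a
    using contraction_commutator[of a a] by simp
  then show ?thesis by (simp add: sum_generator_contraction)
qed

text \<open>Starting from \<open>3 *\<^sub>R \<theta>\<close> as the sum of
  \<open>\<gamma> b * \<iota> b\<close>, moving \<gamma> a through the summands gives -2 \<iota> a
  from the generators and -4 \<iota> a from the contractions; the total -6 is divided by 3.\<close>

lemma generator_anticommutator: "\<gamma> a * \<theta> + \<theta> * \<gamma> a = - 2 *\<^sub>R \<iota> a"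
proof -
  have "3 *\<^sub>R (\<gamma> a * \<theta> + \<theta> * \<gamma> a) = (\<Sum>b\<in>UNIV. \<gamma> a * (\<gamma> b * \<iota> b) + \<gamma> b * \<iota> b * \<gamma> a)"
    by (simp add: sum.distrib sum_generator_contraction scaleR_right_distrib
        flip: sum_distrib_left sum_distrib_right)
  also have "\<dots> = (\<Sum>b\<in>UNIV. (if a = b then - 2 else 0) * \<iota> b + \<gamma> b * (\<iota> b * \<gamma> a - \<gamma> a * \<iota> b))"
    unfolding clifford[symmetric] by (simp add: algebra_simps)
  also have "\<dots> = - 2 *\<^sub>R \<iota> a + (\<Sum>b\<in>UNIV. 2 *\<^sub>R (\<Sum>c\<in>UNIV. t b a c *\<^sub>R (\<gamma> b * \<gamma> c)))"
  proof -
    have "(\<Sum>b\<in>UNIV. (if a = b then - 2 else 0) * \<iota> b) = (\<Sum>b\<in>UNIV. if a = b then - 2 *\<^sub>R \<iota> b else 0)"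
      by (intro sum.cong refl) (simp add: scaleR_2 mult_2)
    then show ?thesis
      by (simp add: contraction_commutator sum.distrib sum_distrib_left)
  qed
  also have "(\<Sum>b\<in>UNIV. 2 *\<^sub>R (\<Sum>c\<in>UNIV. t b a c *\<^sub>R (\<gamma> b * \<gamma> c))) = - 4 *\<^sub>R \<iota> a"
    by (subst skew12) (simp add: \<iota>_def bivector_def scaleR_sum_right sum_negf)
  finally have "3 *\<^sub>R (\<gamma> a * \<theta> + \<theta> * \<gamma> a) = 3 *\<^sub>R (- 2 *\<^sub>R \<iota> a)"
    by (simp only: scaleR_left_distrib[symmetric] scaleR_scaleR) simp
  then show ?thesis by (simp only: scaleR_cancel_left) simp
qed

lemma generator_theta: "\<gamma> a * \<theta> = - 2 *\<^sub>R \<iota> a - \<theta> * \<gamma> a"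
  by (rule generator_anticommutator[folded eq_diff_eq])

lemma theta_generator: "\<theta> * \<gamma> a = - 2 *\<^sub>R \<iota> a - \<gamma> a * \<theta>"
  by (simp only: generator_theta) simp

lemma sum_squares: "(\<Sum>a\<in>UNIV. \<gamma> a * \<gamma> a) = - real CARD('n) *\<^sub>R 1"
  by (simp add: generator_square scaleR_conv_of_real sum_negf)

lemma sum_sandwich: "(\<Sum>a\<in>UNIV. \<gamma> a * \<theta> * \<gamma> a) = (real CARD('n) - 6) *\<^sub>R \<theta>"
proof -
  have "(\<Sum>a\<in>UNIV. \<gamma> a * \<theta> * \<gamma> a) = - 2 *\<^sub>R (\<Sum>a\<in>UNIV. \<iota> a * \<gamma> a) - \<theta> * (\<Sum>a\<in>UNIV. \<gamma> a * \<gamma> a)"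
    by (simp add: generator_theta left_diff_distrib sum_subtractf scaleR_sum_right sum_distrib_left mult.assoc sum_negf)
  then show ?thesis
    by (simp add: sum_contraction_generator sum_squares algebra_simps)
qed

text \<open>\<theta> passes the two generators of \<iota> d one at a time. The remainder is
  quadratic in \<open>t\<close>, and skewness of \<open>t d\<close> brings its two terms to the same
  indices.\<close>

lemma theta_contraction:
  "\<theta> * \<iota> d = \<iota> d * \<theta> - (\<Sum>e\<in>UNIV. \<Sum>f\<in>UNIV. t d e f *\<^sub>R (\<iota> e * \<gamma> f + \<gamma> f * \<iota> e))"
proof -
  have *: "\<theta> * (\<gamma> e * \<gamma> f) = \<gamma> e * \<gamma> f * \<theta> + 2 *\<^sub>R (\<gamma> e * \<iota> f) - 2 *\<^sub>R (\<iota> e * \<gamma> f)" for e f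
  proof -
    have "\<theta> * (\<gamma> e * \<gamma> f) = - 2 *\<^sub>R (\<iota> e * \<gamma> f) - \<gamma> e * (\<theta> * \<gamma> f)"
      by (simp add: theta_generator[of e] left_diff_distrib flip: mult.assoc)
    also have "\<dots> = - 2 *\<^sub>R (\<iota> e * \<gamma> f) - \<gamma> e * (- 2 *\<^sub>R \<iota> f - \<gamma> f * \<theta>)"
      by (simp only: theta_generator[of f])
    finally show ?thesis by (simp add: algebra_simps)
  qed
  have "\<theta> * \<iota> d = (1 / 2) *\<^sub>R (\<Sum>e\<in>UNIV. \<Sum>f\<in>UNIV. t d e f *\<^sub>R (\<theta> * (\<gamma> e * \<gamma> f)))"
    by (simp add: \<iota>_def bivector_def sum_distrib_left)
  also have "\<dots> = \<iota> d * \<theta> + (\<Sum>e\<in>UNIV. \<Sum>f\<in>UNIV. t d e f *\<^sub>R (\<gamma> e * \<iota> f))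
      - (\<Sum>e\<in>UNIV. \<Sum>f\<in>UNIV. t d e f *\<^sub>R (\<iota> e * \<gamma> f))"
    unfolding * \<iota>_def[of d] bivector_def
    by (simp add: scaleR_right_distrib scaleR_diff_right sum.distrib sum_subtractf scaleR_sum_right sum_distrib_right)
  also have "(\<Sum>e\<in>UNIV. \<Sum>f\<in>UNIV. t d e f *\<^sub>R (\<gamma> e * \<iota> f)) = (\<Sum>f\<in>UNIV. \<Sum>e\<in>UNIV. t d e f *\<^sub>R (\<gamma> e * \<iota> f))"
    by (rule sum.swap)
  also have "\<dots> = - (\<Sum>e\<in>UNIV. \<Sum>f\<in>UNIV. t d e f *\<^sub>R (\<gamma> f * \<iota> e))"
    by (rule contraction_swap)
  finally show ?thesis
    by (simp add: scaleR_right_distrib sum.distrib)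
qed

text \<open>The sum of \<open>\<gamma> d * (\<theta> * \<iota> d)\<close> is obtained twice: by
  moving \<theta> to the right through \<iota> d, and by exchanging \<theta> with \<gamma> d in
  \<theta> times the sum of \<open>\<gamma> d * \<iota> d\<close>. Both express it through \<theta>
  \<theta>, \<open>J\<close> and \<open>N\<close>, and they combine to 6 \<theta> \<theta> = -6 J -
  12 N.\<close>

lemma theta_square: "\<theta> * \<theta> = - (\<Sum>a\<in>UNIV. \<iota> a * \<iota> a) - of_real (2 * N)"
proof -
  define J where "J = (\<Sum>a\<in>UNIV. \<iota> a * \<iota> a)"
  define B where "B d g = (\<Sum>e\<in>UNIV. \<Sum>f\<in>UNIV. t d e f * t g e f)" for d g
  have J1: "(\<Sum>d\<in>UNIV. \<Sum>e\<in>UNIV. \<Sum>f\<in>UNIV. t d e f *\<^sub>R (\<gamma> d * \<gamma> f * \<iota> e)) = - 2 *\<^sub>R J"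
  proof -
    have "(\<Sum>d\<in>UNIV. \<Sum>e\<in>UNIV. \<Sum>f\<in>UNIV. t d e f *\<^sub>R (\<gamma> d * \<gamma> f * \<iota> e))
      = (\<Sum>e\<in>UNIV. \<Sum>d\<in>UNIV. \<Sum>f\<in>UNIV. t d e f *\<^sub>R (\<gamma> d * \<gamma> f * \<iota> e))"
      by (rule sum.swap)
    also have "\<dots> = - 2 *\<^sub>R J"
    proof -
      have "bivector (t e) * \<iota> e = 2 *\<^sub>R (\<iota> e * \<iota> e)" for e
        by (simp add: \<iota>_def)
      then show ?thesis
        unfolding J_def by (subst skew12) (simp add: sum_negf scaleR_sum_right flip: bivector_mult)
    qed
    finally show ?thesis .
  qed
  have J2: "(\<Sum>d\<in>UNIV. \<Sum>e\<in>UNIV. \<Sum>f\<in>UNIV. t d e f *\<^sub>R (\<gamma> d * \<iota> e * \<gamma> f)) = - 2 *\<^sub>R J - of_real (12 * N)"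
  proof -
    have "\<gamma> d * \<iota> e * \<gamma> f = \<gamma> d * \<gamma> f * \<iota> e + 2 *\<^sub>R (\<Sum>g\<in>UNIV. t e f g *\<^sub>R (\<gamma> d * \<gamma> g))" for d e f
    proof -
      have "\<gamma> d * (\<iota> e * \<gamma> f) = \<gamma> d * (\<gamma> f * \<iota> e + 2 *\<^sub>R (\<Sum>g\<in>UNIV. t e f g *\<^sub>R \<gamma> g))"
        by (simp flip: contraction_commutator)
      then show ?thesis by (simp add: distrib_left sum_distrib_left mult.assoc)
    qed
    then have "(\<Sum>d\<in>UNIV. \<Sum>e\<in>UNIV. \<Sum>f\<in>UNIV. t d e f *\<^sub>R (\<gamma> d * \<iota> e * \<gamma> f))
      = - 2 *\<^sub>R J + 2 *\<^sub>R (\<Sum>d\<in>UNIV. \<Sum>e\<in>UNIV. \<Sum>f\<in>UNIV. \<Sum>g\<in>UNIV. (t d e f * t e f g) *\<^sub>R (\<gamma> d * \<gamma> g))"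
      by (simp add: scaleR_right_distrib sum.distrib J1 scaleR_sum_right mult.commute mult.left_commute)
    also have "(\<Sum>d\<in>UNIV. \<Sum>e\<in>UNIV. \<Sum>f\<in>UNIV. \<Sum>g\<in>UNIV. (t d e f * t e f g) *\<^sub>R (\<gamma> d * \<gamma> g)) = bivector B"
      unfolding bivector_def B_def
      by (rule sum.cong[OF refl], subst sum_rotate3) (simp add: scaleR_sum_left cyclic_form)
    \<comment> \<open>\<open>B\<close> is symmetric, so only its trace counts. The trace is the sum
      of the squares of \<open>t\<close> over all triples, in which every unordered triple occurs
      six times.\<close>
    also have "bivector B = - of_real (6 * N)"
      by (subst bivector_symmetric) (simp_all add: B_def N_def mult.commute power2_eq_square)
    finally show ?thesis by (simp add: of_real_def)
  qed
  have "(\<Sum>d\<in>UNIV. \<gamma> d * (\<theta> * \<iota> d)) = (\<Sum>d\<in>UNIV. \<gamma> d * \<iota> d * \<theta>)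
     - (\<Sum>d\<in>UNIV. \<Sum>e\<in>UNIV. \<Sum>f\<in>UNIV. t d e f *\<^sub>R (\<gamma> d * \<iota> e * \<gamma> f))
     - (\<Sum>d\<in>UNIV. \<Sum>e\<in>UNIV. \<Sum>f\<in>UNIV. t d e f *\<^sub>R (\<gamma> d * \<gamma> f * \<iota> e))"
    by (simp add: theta_contraction right_diff_distrib sum_subtractf sum_distrib_left distrib_left
        scaleR_right_distrib sum.distrib mult.assoc)
  also have "\<dots> = 3 *\<^sub>R (\<theta> * \<theta>) + 4 *\<^sub>R J + of_real (12 * N)"
    by (simp add: J1 J2 sum_generator_contraction flip: sum_distrib_right scaleR_left_distrib)
  finally have 1: "(\<Sum>d\<in>UNIV. \<gamma> d * (\<theta> * \<iota> d)) = 3 *\<^sub>R (\<theta> * \<theta>) + 4 *\<^sub>R J + of_real (12 * N)" .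
  have "3 *\<^sub>R (\<theta> * \<theta>) = \<theta> * (\<Sum>d\<in>UNIV. \<gamma> d * \<iota> d)"
    by (simp add: sum_generator_contraction)
  also have "\<dots> = (\<Sum>d\<in>UNIV. - 2 *\<^sub>R (\<iota> d * \<iota> d) - \<gamma> d * (\<theta> * \<iota> d))"
    unfolding sum_distrib_left
    by (intro sum.cong refl) (simp only: mult.assoc[symmetric] theta_generator left_diff_distrib scaleR_left_commute mult_scaleR_left)
  also have "\<dots> = - 2 *\<^sub>R J - (3 *\<^sub>R (\<theta> * \<theta>) + 4 *\<^sub>R J + of_real (12 * N))"
    by (simp add: sum_subtractf 1 J_def scaleR_sum_right sum_negf)
  finally have 2: "3 *\<^sub>R (\<theta> * \<theta>) = - 2 *\<^sub>R J - (3 *\<^sub>R (\<theta> * \<theta>) + 4 *\<^sub>R J + of_real (12 * N))" .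
  have "6 *\<^sub>R (\<theta> * \<theta>) = 3 *\<^sub>R (\<theta> * \<theta>) + 3 *\<^sub>R (\<theta> * \<theta>)"
    by (simp flip: scaleR_left_distrib)
  also have "\<dots> = - (2 *\<^sub>R J + 4 *\<^sub>R J) - of_real (12 * N)"
    by (subst 2) (simp add: algebra_simps)
  also have "\<dots> = 6 *\<^sub>R (- J - of_real (2 * N))"
    by (simp add: of_real_def scaleR_diff_right flip: scaleR_left_distrib)
  finally have "6 *\<^sub>R (\<theta> * \<theta>) = 6 *\<^sub>R (- J - of_real (2 * N))" .
  then show ?thesis by (simp only: scaleR_cancel_left J_def) simp
qed

text \<open>In (\<gamma> \<theta>)(\<theta> \<gamma>) the anticommutator is used on both factors, so
  that the two generators meet in the middle. The contraction squares give -4 \<theta> \<theta> - 8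
  N by \<open>theta_square\<close>, the two mixed terms 6 \<theta> \<theta> each, and the middle
  square -n \<theta> \<theta>.\<close>

lemma sum_sandwich_square:
  "(\<Sum>a\<in>UNIV. \<gamma> a * (\<theta> * \<theta>) * \<gamma> a) = (8 - real CARD('n)) *\<^sub>R (\<theta> * \<theta>) - of_real (8 * N)"
proof -
  have "\<gamma> a * (\<theta> * \<theta>) * \<gamma> a = 4 *\<^sub>R (\<iota> a * \<iota> a) + 2 *\<^sub>R (\<iota> a * \<gamma> a) * \<theta>
      + \<theta> * (2 *\<^sub>R (\<gamma> a * \<iota> a)) + \<theta> * (\<gamma> a * \<gamma> a) * \<theta>" for a
  proof -
    have "\<gamma> a * (\<theta> * \<theta>) * \<gamma> a = (\<gamma> a * \<theta>) * (\<theta> * \<gamma> a)" by (simp add: mult.assoc)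
    also have "\<dots> = (- 2 *\<^sub>R \<iota> a - \<theta> * \<gamma> a) * (- 2 *\<^sub>R \<iota> a - \<gamma> a * \<theta>)"
      by (simp only: theta_generator[of a]) (simp add: generator_anticommutator[of a, symmetric])
    finally show ?thesis by (simp add: algebra_simps)
  qed
  then have "(\<Sum>a\<in>UNIV. \<gamma> a * (\<theta> * \<theta>) * \<gamma> a) = 4 *\<^sub>R (\<Sum>a\<in>UNIV. \<iota> a * \<iota> a)
      + 2 *\<^sub>R (\<Sum>a\<in>UNIV. \<iota> a * \<gamma> a) * \<theta> + \<theta> * (2 *\<^sub>R (\<Sum>a\<in>UNIV. \<gamma> a * \<iota> a)) + \<theta> * (\<Sum>a\<in>UNIV. \<gamma> a * \<gamma> a) * \<theta>"
    by (simp add: sum.distrib scaleR_sum_right sum_distrib_left sum_distrib_right mult.assoc)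
  also have "(\<Sum>a\<in>UNIV. \<iota> a * \<iota> a) = - (\<theta> * \<theta>) - of_real (2 * N)"
    by (simp add: theta_square)
  also have "\<theta> * (\<Sum>a\<in>UNIV. \<gamma> a * \<gamma> a) * \<theta> = - real CARD('n) *\<^sub>R (\<theta> * \<theta>)"
    by (simp add: sum_squares)
  finally show ?thesis
  proof -
    assume *: "(\<Sum>a\<in>UNIV. \<gamma> a * (\<theta> * \<theta>) * \<gamma> a) = 4 *\<^sub>R (- (\<theta> * \<theta>) - of_real (2 * N))
      + 2 *\<^sub>R (\<Sum>a\<in>UNIV. \<iota> a * \<gamma> a) * \<theta> + \<theta> * (2 *\<^sub>R (\<Sum>a\<in>UNIV. \<gamma> a * \<iota> a)) + - real CARD('n) *\<^sub>R (\<theta> * \<theta>)"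
    have "8 - real CARD('n) = 6 + 6 - 4 - real CARD('n)" by simp
    then show ?thesis
      unfolding *
      by (simp only: scaleR_left_diff_distrib scaleR_left_distrib)
        (simp add: sum_contraction_generator sum_generator_contraction of_real_def algebra_simps)
  qed
qed

text \<open>The spin lift of \<Omega> rotates each of the three generators. Shifting the rotation
  onto the coefficients transposes \<Omega>, whence the minus sign. For the connection form of
  \<nabla>^c this is the negative of the derivative of the frame components of the torsion.\<close>

lemma bivector_theta_commutator:
  assumes "\<And>a b. \<Omega> b a = - \<Omega> a b"
  shows "(1 / 4) *\<^sub>R (bivector \<Omega> * \<theta> - \<theta> * bivector \<Omega>)
    = - (1 / 6) *\<^sub>R trivector (\<lambda>a b c. \<Sum>d\<in>UNIV. \<Omega> a d * t d b c + \<Omega> b d * t a d c + \<Omega> c d * t a b d)"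
proof -
  define S where "S = (1 / 4) *\<^sub>R bivector \<Omega>"
  have S: "S * \<gamma> a = \<gamma> a * S + (\<Sum>d\<in>UNIV. \<Omega> a d *\<^sub>R \<gamma> d)" for a
  proof -
    have "S * \<gamma> a - \<gamma> a * S = (1 / 4) *\<^sub>R (bivector \<Omega> * \<gamma> a - \<gamma> a * bivector \<Omega>)"
      by (simp add: S_def scaleR_diff_right)
    then show ?thesis by (simp add: bivector_commutator[OF assms] algebra_simps)
  qed
  have *: "S * (\<gamma> a * \<gamma> b * \<gamma> c) - \<gamma> a * \<gamma> b * \<gamma> c * S =
     (\<Sum>d\<in>UNIV. \<Omega> a d *\<^sub>R (\<gamma> d * \<gamma> b * \<gamma> c)) + (\<Sum>d\<in>UNIV. \<Omega> b d *\<^sub>R (\<gamma> a * \<gamma> d * \<gamma> c))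
     + (\<Sum>d\<in>UNIV. \<Omega> c d *\<^sub>R (\<gamma> a * \<gamma> b * \<gamma> d))" for a b c
  proof -
    have "S * (\<gamma> a * \<gamma> b * \<gamma> c) = S * \<gamma> a * \<gamma> b * \<gamma> c" by (simp add: mult.assoc)
    also have "\<dots> = \<gamma> a * (S * \<gamma> b) * \<gamma> c + (\<Sum>d\<in>UNIV. \<Omega> a d *\<^sub>R \<gamma> d) * \<gamma> b * \<gamma> c"
      by (simp only: S[of a]) (simp add: algebra_simps)
    also have "\<gamma> a * (S * \<gamma> b) * \<gamma> c = \<gamma> a * \<gamma> b * (S * \<gamma> c) + \<gamma> a * (\<Sum>d\<in>UNIV. \<Omega> b d *\<^sub>R \<gamma> d) * \<gamma> c"
      by (simp only: S[of b]) (simp add: algebra_simps)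
    also have "\<gamma> a * \<gamma> b * (S * \<gamma> c) = \<gamma> a * \<gamma> b * \<gamma> c * S + \<gamma> a * \<gamma> b * (\<Sum>d\<in>UNIV. \<Omega> c d *\<^sub>R \<gamma> d)"
      by (simp only: S[of c]) (simp add: algebra_simps)
    finally show ?thesis
      by (simp add: sum_distrib_left sum_distrib_right mult.assoc)
  qed
  have r1: "(\<Sum>a\<in>UNIV. \<Sum>b\<in>UNIV. \<Sum>c\<in>UNIV. \<Sum>d\<in>UNIV. (t a b c * \<Omega> a d) *\<^sub>R (\<gamma> d * \<gamma> b * \<gamma> c))
     = - (\<Sum>a\<in>UNIV. \<Sum>b\<in>UNIV. \<Sum>c\<in>UNIV. \<Sum>d\<in>UNIV. (\<Omega> a d * t d b c) *\<^sub>R (\<gamma> a * \<gamma> b * \<gamma> c))" (is "?l = - ?r")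
  proof -
    have "?l = (\<Sum>d\<in>UNIV. \<Sum>a\<in>UNIV. \<Sum>b\<in>UNIV. \<Sum>c\<in>UNIV. (t a b c * \<Omega> a d) *\<^sub>R (\<gamma> d * \<gamma> b * \<gamma> c))"
      by (rule sum_rotate4)
    also have "\<dots> = - (\<Sum>d\<in>UNIV. \<Sum>a\<in>UNIV. \<Sum>b\<in>UNIV. \<Sum>c\<in>UNIV. (\<Omega> d a * t a b c) *\<^sub>R (\<gamma> d * \<gamma> b * \<gamma> c))"
      by (subst assms) (simp add: sum_negf mult_ac)
    also have "(\<Sum>d\<in>UNIV. \<Sum>a\<in>UNIV. \<Sum>b\<in>UNIV. \<Sum>c\<in>UNIV. (\<Omega> d a * t a b c) *\<^sub>R (\<gamma> d * \<gamma> b * \<gamma> c)) = ?r"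
      by (intro sum.cong refl sum_rotate3[symmetric])
    finally show ?thesis .
  qed
  have r2: "(\<Sum>a\<in>UNIV. \<Sum>b\<in>UNIV. \<Sum>c\<in>UNIV. \<Sum>d\<in>UNIV. (t a b c * \<Omega> b d) *\<^sub>R (\<gamma> a * \<gamma> d * \<gamma> c))
     = - (\<Sum>a\<in>UNIV. \<Sum>b\<in>UNIV. \<Sum>c\<in>UNIV. \<Sum>d\<in>UNIV. (\<Omega> b d * t a d c) *\<^sub>R (\<gamma> a * \<gamma> b * \<gamma> c))" (is "?l = - ?r")
  proof -
    have "?l = (\<Sum>a\<in>UNIV. \<Sum>d\<in>UNIV. \<Sum>b\<in>UNIV. \<Sum>c\<in>UNIV. (t a b c * \<Omega> b d) *\<^sub>R (\<gamma> a * \<gamma> d * \<gamma> c))"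
      by (intro sum.cong refl sum_rotate3)
    also have "\<dots> = - (\<Sum>a\<in>UNIV. \<Sum>d\<in>UNIV. \<Sum>b\<in>UNIV. \<Sum>c\<in>UNIV. (\<Omega> d b * t a b c) *\<^sub>R (\<gamma> a * \<gamma> d * \<gamma> c))"
      by (subst assms) (simp add: sum_negf mult_ac)
    also have "(\<Sum>a\<in>UNIV. \<Sum>d\<in>UNIV. \<Sum>b\<in>UNIV. \<Sum>c\<in>UNIV. (\<Omega> d b * t a b c) *\<^sub>R (\<gamma> a * \<gamma> d * \<gamma> c)) = ?r"
      by (rule sum.cong[OF refl], rule sum.cong[OF refl], rule sum.swap)
    finally show ?thesis .
  qed
  have r3: "(\<Sum>a\<in>UNIV. \<Sum>b\<in>UNIV. \<Sum>c\<in>UNIV. \<Sum>d\<in>UNIV. (t a b c * \<Omega> c d) *\<^sub>R (\<gamma> a * \<gamma> b * \<gamma> d))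
     = - (\<Sum>a\<in>UNIV. \<Sum>b\<in>UNIV. \<Sum>c\<in>UNIV. \<Sum>d\<in>UNIV. (\<Omega> c d * t a b d) *\<^sub>R (\<gamma> a * \<gamma> b * \<gamma> c))" (is "?l = - ?r")
  proof -
    have "?l = (\<Sum>a\<in>UNIV. \<Sum>b\<in>UNIV. \<Sum>d\<in>UNIV. \<Sum>c\<in>UNIV. (t a b c * \<Omega> c d) *\<^sub>R (\<gamma> a * \<gamma> b * \<gamma> d))"
      by (intro sum.cong refl sum.swap)
    also have "\<dots> = - ?r"
      by (subst assms) (simp add: sum_negf mult_ac)
    finally show ?thesis .
  qed
  have "(1 / 4) *\<^sub>R (bivector \<Omega> * \<theta> - \<theta> * bivector \<Omega>) = S * \<theta> - \<theta> * S"
    by (simp add: S_def scaleR_diff_right)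
  also have "\<dots> = (1 / 6) *\<^sub>R (\<Sum>a\<in>UNIV. \<Sum>b\<in>UNIV. \<Sum>c\<in>UNIV. t a b c *\<^sub>R (S * (\<gamma> a * \<gamma> b * \<gamma> c) - \<gamma> a * \<gamma> b * \<gamma> c * S))"
    by (simp add: \<theta>_def trivector_def sum_distrib_left sum_distrib_right scaleR_diff_right sum_subtractf)
  also have "\<dots> = - (1 / 6) *\<^sub>R trivector (\<lambda>a b c. \<Sum>d\<in>UNIV. \<Omega> a d * t d b c + \<Omega> b d * t a d c + \<Omega> c d * t a b d)"
    unfolding * trivector_def
    by (simp add: scaleR_right_distrib sum.distrib scaleR_sum_right r1 r2 r3 scaleR_sum_left scaleR_left_distrib flip: sum_negf)
  finally show ?thesis .
qed

text \<open>\<open>P0\<close> to \<open>P3\<close> have \<gamma> k in the four positions of the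
  triple product. Moving it inward by one place from either end changes the sign and costs -4
  \<iota> k; these costs cancel in P0 - P1 + P2 - P3 = 2 (P0 - P3), and \<open>P0\<close>,
  \<open>P3\<close> are 6 \<gamma> k \<theta> and 6 \<theta> \<gamma> k.\<close>

lemma wedge_quadrivector:
  "(\<Sum>a\<in>UNIV. \<Sum>b\<in>UNIV. \<Sum>c\<in>UNIV. \<Sum>d\<in>UNIV.
      ((if k = a then 1 else 0) * t b c d - (if k = b then 1 else 0) * t a c d
        + (if k = c then 1 else 0) * t a b d - (if k = d then 1 else 0) * t a b c) *\<^sub>R
      (\<gamma> a * \<gamma> b * \<gamma> c * \<gamma> d)) = 12 *\<^sub>R (\<gamma> k * \<theta> - \<theta> * \<gamma> k)"
proof -
  define kd where "kd a = (if k = a then 1 else 0::real)" for a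
  have kd: "(\<Sum>a\<in>UNIV. kd a *\<^sub>R X a) = X k" for X :: "'n \<Rightarrow> 'a"
  proof -
    have "kd a *\<^sub>R X a = (if a = k then X k else 0)" for a by (simp add: kd_def)
    then show ?thesis by simp
  qed
  define P0 where "P0 = (\<Sum>a\<in>UNIV. \<Sum>b\<in>UNIV. \<Sum>c\<in>UNIV. t a b c *\<^sub>R (\<gamma> k * \<gamma> a * \<gamma> b * \<gamma> c))"
  define P1 where "P1 = (\<Sum>a\<in>UNIV. \<Sum>b\<in>UNIV. \<Sum>c\<in>UNIV. t a b c *\<^sub>R (\<gamma> a * \<gamma> k * \<gamma> b * \<gamma> c))"
  define P2 where "P2 = (\<Sum>a\<in>UNIV. \<Sum>b\<in>UNIV. \<Sum>c\<in>UNIV. t a b c *\<^sub>R (\<gamma> a * \<gamma> b * \<gamma> k * \<gamma> c))"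
  define P3 where "P3 = (\<Sum>a\<in>UNIV. \<Sum>b\<in>UNIV. \<Sum>c\<in>UNIV. t a b c *\<^sub>R (\<gamma> a * \<gamma> b * \<gamma> c * \<gamma> k))"
  have P0: "P0 = 6 *\<^sub>R (\<gamma> k * \<theta>)"
    by (simp add: P0_def \<theta>_def trivector_def sum_distrib_left mult.assoc)
  have P3: "P3 = 6 *\<^sub>R (\<theta> * \<gamma> k)"
    by (simp add: P3_def \<theta>_def trivector_def sum_distrib_right)
  have anti: "\<gamma> k * \<gamma> a + \<gamma> a * \<gamma> k = (- 2 * kd a) *\<^sub>R 1" for a
    unfolding clifford kd_def by (simp add: scaleR_2)
  have "P0 + P1 = (\<Sum>a\<in>UNIV. \<Sum>b\<in>UNIV. \<Sum>c\<in>UNIV. t a b c *\<^sub>R ((\<gamma> k * \<gamma> a + \<gamma> a * \<gamma> k) * (\<gamma> b * \<gamma> c)))"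
    by (simp add: P0_def P1_def sum.distrib scaleR_right_distrib distrib_right mult.assoc)
  also have "\<dots> = (\<Sum>a\<in>UNIV. kd a *\<^sub>R (- 4 *\<^sub>R \<iota> a))"
    unfolding anti \<iota>_def bivector_def
    by (simp add: scaleR_sum_right sum_negf mult.commute mult.left_commute)
  also have "\<dots> = - 4 *\<^sub>R \<iota> k" by (rule kd)
  finally have P1: "P1 = - 4 *\<^sub>R \<iota> k - P0" by (simp add: algebra_simps)
  have "P2 + P3 = (\<Sum>a\<in>UNIV. \<Sum>b\<in>UNIV. \<Sum>c\<in>UNIV. t a b c *\<^sub>R (\<gamma> a * \<gamma> b * (\<gamma> k * \<gamma> c + \<gamma> c * \<gamma> k)))"
    by (simp add: P2_def P3_def sum.distrib scaleR_right_distrib distrib_left mult.assoc)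
  also have "\<dots> = (\<Sum>c\<in>UNIV. \<Sum>a\<in>UNIV. \<Sum>b\<in>UNIV. t a b c *\<^sub>R (\<gamma> a * \<gamma> b * (\<gamma> k * \<gamma> c + \<gamma> c * \<gamma> k)))"
    by (rule sum_rotate3)
  also have "\<dots> = (\<Sum>c\<in>UNIV. \<Sum>a\<in>UNIV. \<Sum>b\<in>UNIV. t c a b *\<^sub>R (\<gamma> a * \<gamma> b * (\<gamma> k * \<gamma> c + \<gamma> c * \<gamma> k)))"
    by (intro sum.cong refl) (simp only: cyclic_form[where a=c and b=a and c=b for a b c])
  also have "\<dots> = (\<Sum>c\<in>UNIV. kd c *\<^sub>R (- 4 *\<^sub>R \<iota> c))"
    unfolding anti \<iota>_def bivector_def
    by (simp add: scaleR_sum_right sum_negf mult.commute mult.left_commute)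
  also have "\<dots> = - 4 *\<^sub>R \<iota> k" by (rule kd)
  finally have P2: "P2 = - 4 *\<^sub>R \<iota> k - P3" by (simp add: algebra_simps)
  have "(\<Sum>a\<in>UNIV. \<Sum>b\<in>UNIV. \<Sum>c\<in>UNIV. \<Sum>d\<in>UNIV.
      (kd a * t b c d - kd b * t a c d + kd c * t a b d - kd d * t a b c) *\<^sub>R (\<gamma> a * \<gamma> b * \<gamma> c * \<gamma> d))
    = (\<Sum>a\<in>UNIV. kd a *\<^sub>R (\<Sum>b\<in>UNIV. \<Sum>c\<in>UNIV. \<Sum>d\<in>UNIV. t b c d *\<^sub>R (\<gamma> a * \<gamma> b * \<gamma> c * \<gamma> d)))
    - (\<Sum>a\<in>UNIV. \<Sum>b\<in>UNIV. kd b *\<^sub>R (\<Sum>c\<in>UNIV. \<Sum>d\<in>UNIV. t a c d *\<^sub>R (\<gamma> a * \<gamma> b * \<gamma> c * \<gamma> d)))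
    + (\<Sum>a\<in>UNIV. \<Sum>b\<in>UNIV. \<Sum>c\<in>UNIV. kd c *\<^sub>R (\<Sum>d\<in>UNIV. t a b d *\<^sub>R (\<gamma> a * \<gamma> b * \<gamma> c * \<gamma> d)))
    - (\<Sum>a\<in>UNIV. \<Sum>b\<in>UNIV. \<Sum>c\<in>UNIV. \<Sum>d\<in>UNIV. kd d *\<^sub>R (t a b c *\<^sub>R (\<gamma> a * \<gamma> b * \<gamma> c * \<gamma> d)))"
    by (simp only: scaleR_sum_right scaleR_scaleR scaleR_left_distrib scaleR_left_diff_distrib sum.distrib sum_subtractf)
  also have "\<dots> = P0 - P1 + P2 - P3"
    unfolding kd P0_def P1_def P2_def P3_def ..
  also have "\<dots> = (P0 + P0) - (P3 + P3)"
    by (simp add: P1 P2)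
  also have "\<dots> = 12 *\<^sub>R (\<gamma> k * \<theta> - \<theta> * \<gamma> k)"
    by (simp add: P0 P3 scaleR_diff_right flip: scaleR_left_distrib)
  finally show ?thesis by (simp add: kd_def)
qed

end

section \<open>Calculus of smooth functions\<close>

lemma dd_eqI: "(f has_derivative D) (at x) \<Longrightarrow> dd f x u = D u"
  using frechet_derivative_at by metis

lemma dd_has_derivative: "f differentiable (at x) \<Longrightarrow> (f has_derivative dd f x) (at x)"
  using frechet_derivative_works by blast

lemma linear_dd: "f differentiable (at x) \<Longrightarrow> linear (dd f x)"
  using dd_has_derivative has_derivative_linear by blast

lemma has_derivative_cong_open:
  assumes "open S" "x \<in> S" "\<And>y. y \<in> S \<Longrightarrow> f y = g y"
  shows "(f has_derivative D) (at x) \<longleftrightarrow> (g has_derivative D) (at x)"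
  using has_derivative_transform_within_open[OF _ assms(1,2), of f D UNIV g]
    has_derivative_transform_within_open[OF _ assms(1,2), of g D UNIV f] assms(3) by metis

lemma dd_cong_open:
  assumes "open S" "x \<in> S" "\<And>y. y \<in> S \<Longrightarrow> f y = g y"
  shows "dd f x u = dd g x u"
  unfolding frechet_derivative_def using has_derivative_cong_open[OF assms] by simp

lemma differentiable_cong_open:
  assumes "open S" "x \<in> S" "\<And>y. y \<in> S \<Longrightarrow> f y = g y"
  shows "f differentiable (at x) \<longleftrightarrow> g differentiable (at x)"
  unfolding differentiable_def using has_derivative_cong_open[OF assms] by simp

lemma k_smooth_on_cong:
  assumes "open S" "\<And>y. y \<in> S \<Longrightarrow> f y = g y"
  shows "k_smooth_on k S f \<longleftrightarrow> k_smooth_on k S g"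
  using assms(2)
proof (induction k arbitrary: f g)
  case 0
  then show ?case by (simp cong: continuous_on_cong)
next
  case (Suc k)
  have *: "dd f y u = dd g y u" "f differentiable (at y) \<longleftrightarrow> g differentiable (at y)" if "y \<in> S" for y u
    using dd_cong_open[OF assms(1) that Suc.prems] differentiable_cong_open[OF assms(1) that Suc.prems] by auto
  have "k_smooth_on k S (\<lambda>x. dd f x u) \<longleftrightarrow> k_smooth_on k S (\<lambda>x. dd g x u)" for u
    by (rule Suc.IH) (rule *(1))
  with *(2) show ?case by simp
qed

lemma k_smooth_on_subset: "k_smooth_on k S f \<Longrightarrow> S' \<subseteq> S \<Longrightarrow> k_smooth_on k S' f"
  by (induction k arbitrary: f) (auto intro: continuous_on_subset)

lemma k_smooth_on_SucD: "k_smooth_on (Suc k) S f \<Longrightarrow> k_smooth_on k S f"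
proof (induction k arbitrary: f)
  case 0
  then show ?case
    by (auto intro!: continuous_at_imp_continuous_on differentiable_imp_continuous_within)
qed simp

lemma k_smooth_on_SucI:
  assumes "open S" "\<And>x. x \<in> S \<Longrightarrow> (f has_derivative D x) (at x)" "\<And>u. k_smooth_on k S (\<lambda>x. D x u)"
  shows "k_smooth_on (Suc k) S f"
proof -
  have "dd f x u = D x u" if "x \<in> S" for x u using assms(2)[OF that] by (rule dd_eqI)
  then show ?thesis
    using assms k_smooth_on_cong[OF assms(1), of "\<lambda>x. dd f x u" "\<lambda>x. D x u" k for u]
    by (auto simp: differentiable_def)
qed

lemma k_smooth_on_has_derivative: "k_smooth_on (Suc k) S f \<Longrightarrow> x \<in> S \<Longrightarrow> (f has_derivative dd f x) (at x)"
  by (simp add: dd_has_derivative)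

lemma k_smooth_on_const: "k_smooth_on k S (\<lambda>x. c)"
  by (induction k arbitrary: c) auto

text \<open>Needed for the extended vector field, which is given by different expressions near
  different points.\<close>

lemma k_smooth_on_local:
  assumes "\<And>x. x \<in> S \<Longrightarrow> \<exists>V. open V \<and> x \<in> V \<and> k_smooth_on k (V \<inter> S) f"
  shows "k_smooth_on k S f"
  using assms
proof (induction k arbitrary: f)
  case 0
  have "continuous (at x within S) f" if "x \<in> S" for x
  proof -
    obtain V where V: "open V" "x \<in> V" "continuous_on (V \<inter> S) f" using 0 \<open>x \<in> S\<close> by auto
    have "at x within (V \<inter> S) = at x within S"
      by (rule at_within_nhd[OF V(2,1)]) auto
    then show ?thesis
      using V that by (metis IntI continuous_on_eq_continuous_within)
  qed
  then show ?case by (simp add: continuous_on_eq_continuous_within)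
next
  case (Suc k)
  then show ?case by simp (metis IntI)
qed

lemma k_smooth_on_add:
  assumes S: "open S" and "k_smooth_on k S f" "k_smooth_on k S g"
  shows "k_smooth_on k S (\<lambda>x. f x + g x)"
  using assms(2,3)
proof (induction k arbitrary: f g)
  case 0
  then show ?case by (simp add: continuous_on_add)
next
  case (Suc k)
  show ?case
    by (rule k_smooth_on_SucI[OF S])
      (use Suc in \<open>auto intro!: has_derivative_add k_smooth_on_has_derivative[OF Suc.prems(1)] k_smooth_on_has_derivative[OF Suc.prems(2)]\<close>)
qed

lemma k_smooth_on_bilinear:
  assumes B: "bounded_bilinear B" and S: "open S" and "k_smooth_on k S f" "k_smooth_on k S g"
  shows "k_smooth_on k S (\<lambda>x. B (f x) (g x))"
  using assms(3,4)
proof (induction k arbitrary: f g)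
  case 0
  then show ?case using bounded_bilinear.continuous_on[OF B] by simp
next
  case (Suc k)
  show ?case
  proof (rule k_smooth_on_SucI[OF S])
    fix x assume "x \<in> S"
    then show "((\<lambda>x. B (f x) (g x)) has_derivative (\<lambda>u. B (f x) (dd g x u) + B (dd f x u) (g x))) (at x)"
      by (intro bounded_bilinear.FDERIV[OF B] k_smooth_on_has_derivative[OF Suc.prems(1)] k_smooth_on_has_derivative[OF Suc.prems(2)])
  next
    fix u
    show "k_smooth_on k S (\<lambda>x. B (f x) (dd g x u) + B (dd f x u) (g x))"
      using Suc.prems Suc.prems[THEN k_smooth_on_SucD] by (intro k_smooth_on_add S Suc.IH) auto
  qed
qed

lemma k_smooth_on_linear:
  assumes L: "bounded_linear L" and S: "open S" and "k_smooth_on k S f"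
  shows "k_smooth_on k S (\<lambda>x. L (f x))"
  using assms(3)
proof (induction k arbitrary: f)
  case 0
  then show ?case using bounded_linear.continuous_on[OF L] by simp
next
  case (Suc k)
  show ?case
    by (rule k_smooth_on_SucI[OF S])
      (use Suc in \<open>auto intro!: bounded_linear.has_derivative[OF L] k_smooth_on_has_derivative[OF Suc.prems(1)]\<close>)
qed

lemma k_smooth_on_sum:
  assumes S: "open S" and "\<And>i. i \<in> I \<Longrightarrow> k_smooth_on k S (f i)"
  shows "k_smooth_on k S (\<lambda>x. \<Sum>i\<in>I. f i x)"
  using assms(2) by (induction I rule: infinite_finite_induct) (auto intro: k_smooth_on_add[OF S] k_smooth_on_const)

text \<open>The chain rule differentiates \<open>f\<close> in a direction that varies with the
  point, whereas \<open>k_smooth_on\<close> controls fixed directions. Expanding the varying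
  direction in \<open>Basis\<close> restores fixed ones, which is why the middle space is
  Euclidean.\<close>

lemma k_smooth_on_compose:
  fixes g :: "'a::real_normed_vector \<Rightarrow> 'b::euclidean_space"
  assumes S: "open S" and W: "open W" "g ` S \<subseteq> W" and "k_smooth_on k W f" "k_smooth_on k S g"
  shows "k_smooth_on k S (\<lambda>x. f (g x))"
  using assms(4,5)
proof (induction k arbitrary: f)
  case 0
  then show ?case using continuous_on_compose2 W by fastforce
next
  case (Suc k)
  show ?case
  proof (rule k_smooth_on_SucI[OF S])
    fix x assume x: "x \<in> S"
    have f: "(f has_derivative dd f (g x)) (at (g x))"
      using k_smooth_on_has_derivative[OF Suc.prems(1)] W x by auto
    have "((\<lambda>x. f (g x)) has_derivative (\<lambda>u. dd f (g x) (dd g x u))) (at x)"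
      using has_derivative_compose[OF k_smooth_on_has_derivative[OF Suc.prems(2) x] f] .
    moreover have "dd f (g x) (dd g x u) = (\<Sum>b\<in>Basis. (dd g x u \<bullet> b) *\<^sub>R dd f (g x) b)" for u
      by (subst euclidean_representation[of "dd g x u", symmetric])
        (simp add: linear_sum[OF has_derivative_linear[OF f]] linear_cmul[OF has_derivative_linear[OF f]])
    ultimately show "((\<lambda>x. f (g x)) has_derivative (\<lambda>u. \<Sum>b\<in>Basis. (dd g x u \<bullet> b) *\<^sub>R dd f (g x) b)) (at x)"
      by simp
  next
    fix u
    show "k_smooth_on k S (\<lambda>x. \<Sum>b\<in>Basis. (dd g x u \<bullet> b) *\<^sub>R dd f (g x) b)"
    proof (intro k_smooth_on_sum[OF S] k_smooth_on_bilinear[OF bounded_bilinear_scaleR S])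
      fix b :: 'b
      show "k_smooth_on k S (\<lambda>x. dd g x u \<bullet> b)"
        using Suc.prems(2) by (intro k_smooth_on_linear[OF bounded_linear_inner_left S]) auto
      show "k_smooth_on k S (\<lambda>x. dd f (g x) b)"
        using Suc.prems(1) k_smooth_on_SucD[OF Suc.prems(2)] by (intro Suc.IH) auto
    qed
  qed
qed

lemma smooth_on_cong:
  "open S \<Longrightarrow> (\<And>y. y \<in> S \<Longrightarrow> f y = g y) \<Longrightarrow> smooth_on S f \<longleftrightarrow> smooth_on S g"
  unfolding smooth_on_def using k_smooth_on_cong by blast

lemma smooth_on_const: "smooth_on S (\<lambda>x. c)"
  by (simp add: smooth_on_def k_smooth_on_const)

lemma smooth_on_subset: "smooth_on S f \<Longrightarrow> S' \<subseteq> S \<Longrightarrow> smooth_on S' f"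
  unfolding smooth_on_def by (meson k_smooth_on_subset)

lemma smooth_on_add: "open S \<Longrightarrow> smooth_on S f \<Longrightarrow> smooth_on S g \<Longrightarrow> smooth_on S (\<lambda>x. f x + g x)"
  by (simp add: smooth_on_def k_smooth_on_add)

lemma smooth_on_linear: "bounded_linear L \<Longrightarrow> open S \<Longrightarrow> smooth_on S f \<Longrightarrow> smooth_on S (\<lambda>x. L (f x))"
  by (simp add: smooth_on_def k_smooth_on_linear)

lemma smooth_on_diff: "open S \<Longrightarrow> smooth_on S f \<Longrightarrow> smooth_on S g \<Longrightarrow> smooth_on S (\<lambda>x. f x - g x)"
  using smooth_on_add[of S f "\<lambda>x. - g x"] smooth_on_linear[of uminus S g]
  by (simp add: bounded_linear_minus bounded_linear_ident)

lemma smooth_on_sum: "open S \<Longrightarrow> (\<And>i. i \<in> I \<Longrightarrow> smooth_on S (f i)) \<Longrightarrow> smooth_on S (\<lambda>x. \<Sum>i\<in>I. f i x)"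
  by (simp add: smooth_on_def k_smooth_on_sum)

lemma smooth_on_scaleR: "open S \<Longrightarrow> smooth_on S f \<Longrightarrow> smooth_on S g \<Longrightarrow> smooth_on S (\<lambda>x. f x *\<^sub>R g x)"
  by (simp add: smooth_on_def k_smooth_on_bilinear[OF bounded_bilinear_scaleR])

lemma smooth_on_inner: "open S \<Longrightarrow> smooth_on S f \<Longrightarrow> smooth_on S (\<lambda>x. f x \<bullet> b)"
  by (rule smooth_on_linear[OF bounded_linear_inner_left])

lemma smooth_on_scaleR_const: "open S \<Longrightarrow> smooth_on S f \<Longrightarrow> smooth_on S (\<lambda>x. c *\<^sub>R f x)"
  by (rule smooth_on_linear[OF bounded_linear_scaleR_right])

lemma smooth_on_compose:
  fixes g :: "'a::real_normed_vector \<Rightarrow> 'b::euclidean_space"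
  shows "open S \<Longrightarrow> open W \<Longrightarrow> g ` S \<subseteq> W \<Longrightarrow> smooth_on W f \<Longrightarrow> smooth_on S g \<Longrightarrow> smooth_on S (\<lambda>x. f (g x))"
  unfolding smooth_on_def using k_smooth_on_compose by blast

lemma smooth_on_local:
  assumes "\<And>x. x \<in> S \<Longrightarrow> \<exists>V. open V \<and> x \<in> V \<and> smooth_on (V \<inter> S) f"
  shows "smooth_on S f"
  unfolding smooth_on_def using assms by (auto simp: smooth_on_def intro!: k_smooth_on_local)

lemma smooth_on_differentiable: "smooth_on S f \<Longrightarrow> x \<in> S \<Longrightarrow> f differentiable (at x)"
  unfolding smooth_on_def by (metis k_smooth_on.simps(2))

lemma smooth_on_dd: "smooth_on S f \<Longrightarrow> smooth_on S (\<lambda>x. dd f x u)"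
  unfolding smooth_on_def by (metis k_smooth_on.simps(2))

lemma smooth_on_continuous: "smooth_on S f \<Longrightarrow> continuous_on S f"
  unfolding smooth_on_def by (metis k_smooth_on.simps(1))

subsection \<open>Rules for derivatives\<close>

lemma dd_const: "dd (\<lambda>y. c) x u = 0"
  by (rule dd_eqI[OF has_derivative_const])

lemma dd_add: "f differentiable (at x) \<Longrightarrow> g differentiable (at x) \<Longrightarrow> dd (\<lambda>y. f y + g y) x u = dd f x u + dd g x u"
  by (rule dd_eqI) (intro has_derivative_add dd_has_derivative)

lemma dd_linear: "bounded_linear L \<Longrightarrow> f differentiable (at x) \<Longrightarrow> dd (\<lambda>y. L (f y)) x u = L (dd f x u)"
  by (rule dd_eqI) (rule bounded_linear.has_derivative[OF _ dd_has_derivative])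

lemma dd_sum:
  "(\<And>i. i \<in> I \<Longrightarrow> f i differentiable (at x)) \<Longrightarrow> dd (\<lambda>y. \<Sum>i\<in>I. f i y) x u = (\<Sum>i\<in>I. dd (f i) x u)"
  by (rule dd_eqI) (intro has_derivative_sum dd_has_derivative)

lemma dd_scaleR:
  "f differentiable (at x) \<Longrightarrow> g differentiable (at x) \<Longrightarrow>
    dd (\<lambda>y. f y *\<^sub>R g y) x u = f x *\<^sub>R dd g x u + dd f x u *\<^sub>R g x"
  by (rule dd_eqI) (intro has_derivative_scaleR dd_has_derivative)

context
  fixes S :: "'a::real_normed_vector set" and B :: "'a \<Rightarrow> 'b::euclidean_space \<Rightarrow> 'c::real_normed_vector" and X :: "'a \<Rightarrow> 'b"
  assumes S: "open S" and lin: "\<And>y. y \<in> S \<Longrightarrow> linear (B y)"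
begin

lemma linear_family_expand: "y \<in> S \<Longrightarrow> B y v = (\<Sum>b\<in>Basis. (v \<bullet> b) *\<^sub>R B y b)"
  using lin[of y] by (subst euclidean_representation[of v, symmetric]) (simp only: linear_sum linear_cmul)

text \<open>After expanding \<open>X y\<close> in \<open>Basis\<close>, only maps
  \<open>B y b\<close> with fixed argument are differentiated. Linearity of \<open>B y\<close> is
  known on \<open>S\<close> alone, so the expansion is carried over by
  \<open>has_derivative_cong_open\<close>. Metric, Christoffel symbols, torsion and covariant
  derivatives are all such families.\<close>

lemma dd_linear_family:
  assumes x: "x \<in> S" and B: "\<And>v. (\<lambda>y. B y v) differentiable (at x)" and X: "X differentiable (at x)"
  shows "(\<lambda>y. B y (X y)) differentiable (at x)"
    and "dd (\<lambda>y. B y (X y)) x u = dd (\<lambda>y. B y (X x)) x u + B x (dd X x u)"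
proof -
  have X': "((\<lambda>y. X y \<bullet> b) has_derivative (\<lambda>u. dd X x u \<bullet> b)) (at x)" for b
    by (intro has_derivative_inner_left dd_has_derivative X)
  have "((\<lambda>y. \<Sum>b\<in>Basis. (X y \<bullet> b) *\<^sub>R B y b) has_derivative
      (\<lambda>u. \<Sum>b\<in>Basis. (X x \<bullet> b) *\<^sub>R dd (\<lambda>y. B y b) x u + (dd X x u \<bullet> b) *\<^sub>R B x b)) (at x)"
    by (intro has_derivative_sum has_derivative_scaleR X' dd_has_derivative B)
  then have *: "((\<lambda>y. B y (X y)) has_derivative
      (\<lambda>u. \<Sum>b\<in>Basis. (X x \<bullet> b) *\<^sub>R dd (\<lambda>y. B y b) x u + (dd X x u \<bullet> b) *\<^sub>R B x b)) (at x)"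
    by (subst has_derivative_cong_open[OF S x]) (auto simp: linear_family_expand)
  then show "(\<lambda>y. B y (X y)) differentiable (at x)"
    by (auto simp: differentiable_def)
  have "((\<lambda>y. \<Sum>b\<in>Basis. (X x \<bullet> b) *\<^sub>R B y b) has_derivative
      (\<lambda>u. \<Sum>b\<in>Basis. (X x \<bullet> b) *\<^sub>R dd (\<lambda>y. B y b) x u)) (at x)"
    by (intro has_derivative_sum has_derivative_scaleR_right dd_has_derivative B)
  then have "((\<lambda>y. B y (X x)) has_derivative
      (\<lambda>u. \<Sum>b\<in>Basis. (X x \<bullet> b) *\<^sub>R dd (\<lambda>y. B y b) x u)) (at x)"
    by (subst has_derivative_cong_open[OF S x]) (auto simp: linear_family_expand)
  then have "dd (\<lambda>y. B y (X x)) x u = (\<Sum>b\<in>Basis. (X x \<bullet> b) *\<^sub>R dd (\<lambda>y. B y b) x u)"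
    by (rule dd_eqI)
  then show "dd (\<lambda>y. B y (X y)) x u = dd (\<lambda>y. B y (X x)) x u + B x (dd X x u)"
    using dd_eqI[OF *, of u] linear_family_expand[OF x, of "dd X x u"] by (simp add: sum.distrib)
qed

lemma linear_dd_family:
  assumes x: "x \<in> S" and B: "\<And>v. (\<lambda>y. B y v) differentiable (at x)"
  shows "linear (\<lambda>v. dd (\<lambda>y. B y v) x u)"
proof (rule linearI)
  show "dd (\<lambda>y. B y (v + w)) x u = dd (\<lambda>y. B y v) x u + dd (\<lambda>y. B y w) x u" for v w
    by (subst dd_cong_open[OF S x, where g = "\<lambda>y. B y v + B y w"])
      (auto simp: dd_add B linear_add lin)
  show "dd (\<lambda>y. B y (c *\<^sub>R v)) x u = c *\<^sub>R dd (\<lambda>y. B y v) x u" for c v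
    by (subst dd_cong_open[OF S x, where g = "\<lambda>y. c *\<^sub>R B y v"])
      (auto simp: dd_linear[OF bounded_linear_scaleR_right] B linear_cmul lin)
qed

lemma smooth_linear_family:
  assumes "\<And>v. smooth_on S (\<lambda>y. B y v)" and "smooth_on S X"
  shows "smooth_on S (\<lambda>y. B y (X y))"
proof -
  have "smooth_on S (\<lambda>y. \<Sum>b\<in>Basis. (X y \<bullet> b) *\<^sub>R B y b)"
    using assms by (intro smooth_on_sum smooth_on_scaleR smooth_on_inner S)
  then show ?thesis
    by (subst smooth_on_cong[OF S linear_family_expand]) auto
qed

end

subsection \<open>Symmetry of second derivatives\<close>

text \<open>The mean value theorem is applied twice: along \<open>u\<close> to the difference of
  \<open>f\<close> across the step in direction \<open>v\<close>, then along \<open>v\<close> to the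
  derivative of \<open>f\<close> in direction \<open>u\<close>.\<close>

lemma second_difference:
  fixes f :: "'a::real_normed_vector \<Rightarrow> real"
  assumes f: "smooth_on S f" and t: "0 < t"
    and sub: "\<And>a b. 0 \<le> a \<Longrightarrow> a \<le> t \<Longrightarrow> 0 \<le> b \<Longrightarrow> b \<le> t \<Longrightarrow> x + a *\<^sub>R u + b *\<^sub>R v \<in> S"
  shows "\<exists>a b. 0 < a \<and> a < t \<and> 0 < b \<and> b < t \<and>
    f (x + t *\<^sub>R u + t *\<^sub>R v) - f (x + t *\<^sub>R u) - f (x + t *\<^sub>R v) + f x
      = t * t * dd (\<lambda>y. dd f y u) (x + a *\<^sub>R u + b *\<^sub>R v) v"
proof -
  have line: "((\<lambda>a. h (z + a *\<^sub>R w)) has_real_derivative dd h (z + a *\<^sub>R w) w) (at a)"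
    if "h differentiable (at (z + a *\<^sub>R w))" for h :: "'a \<Rightarrow> real" and z w a
  proof -
    have "((\<lambda>a. h (z + a *\<^sub>R w)) has_derivative (\<lambda>r. dd h (z + a *\<^sub>R w) (r *\<^sub>R w))) (at a)"
      by (rule has_derivative_compose[of "\<lambda>a. z + a *\<^sub>R w" "\<lambda>r. r *\<^sub>R w", OF _ dd_has_derivative[OF that]])
        (auto intro!: derivative_eq_intros)
    then show ?thesis
      unfolding has_field_derivative_def
      by (rule has_derivative_eq_rhs) (simp add: fun_eq_iff linear_cmul[OF linear_dd[OF that]])
  qed
  define \<phi> where "\<phi> a = f (x + t *\<^sub>R v + a *\<^sub>R u) - f (x + a *\<^sub>R u)" for a
  have "(\<phi> has_real_derivative dd f (x + t *\<^sub>R v + a *\<^sub>R u) u - dd f (x + a *\<^sub>R u) u) (at a)"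
    if "0 \<le> a" "a \<le> t" for a
    unfolding \<phi>_def using that t sub[of a t] sub[of a 0]
    by (intro DERIV_diff line smooth_on_differentiable[OF f]) (auto simp: algebra_simps)
  then obtain a where a: "0 < a" "a < t" "\<phi> t - \<phi> 0 = t * (dd f (x + t *\<^sub>R v + a *\<^sub>R u) u - dd f (x + a *\<^sub>R u) u)"
    using MVT2[of 0 t \<phi> "\<lambda>a. dd f (x + t *\<^sub>R v + a *\<^sub>R u) u - dd f (x + a *\<^sub>R u) u"] t by auto
  have "((\<lambda>b. dd f (x + a *\<^sub>R u + b *\<^sub>R v) u) has_real_derivative dd (\<lambda>y. dd f y u) (x + a *\<^sub>R u + b *\<^sub>R v) v) (at b)"
    if "0 \<le> b" "b \<le> t" for b
    using that a sub[of a b] by (intro line smooth_on_differentiable[OF smooth_on_dd[OF f]]) auto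
  then obtain b where b: "0 < b" "b < t"
    "dd f (x + a *\<^sub>R u + t *\<^sub>R v) u - dd f (x + a *\<^sub>R u) u = t * dd (\<lambda>y. dd f y u) (x + a *\<^sub>R u + b *\<^sub>R v) v"
    using MVT2[of 0 t "\<lambda>b. dd f (x + a *\<^sub>R u + b *\<^sub>R v) u" "\<lambda>b. dd (\<lambda>y. dd f y u) (x + a *\<^sub>R u + b *\<^sub>R v) v"] t by auto
  have "\<phi> t - \<phi> 0 = t * (t * dd (\<lambda>y. dd f y u) (x + a *\<^sub>R u + b *\<^sub>R v) v)"
    unfolding a(3) b(3)[symmetric] by (simp add: algebra_simps)
  then show ?thesis using a b by (intro exI[of _ a] exI[of _ b]) (simp add: \<phi>_def algebra_simps)
qed

text \<open>The second difference is symmetric in \<open>u\<close> and \<open>v\<close>, so the two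
  mixed derivatives agree when taken at suitable points near \<open>x\<close>; a gap at
  \<open>x\<close> would contradict their continuity.\<close>

lemma second_derivative_symmetric_real:
  fixes f :: "'a::real_normed_vector \<Rightarrow> real"
  assumes f: "smooth_on S f" and S: "open S" and x: "x \<in> S"
  shows "dd (\<lambda>y. dd f y u) x v = dd (\<lambda>y. dd f y v) x u"
proof (rule ccontr)
  define A where "A y = dd (\<lambda>y. dd f y u) y v" for y
  define B where "B y = dd (\<lambda>y. dd f y v) y u" for y
  assume "\<not> ?thesis"
  then have ne: "0 < \<bar>A x - B x\<bar> / 2" by (simp add: A_def B_def)
  have "continuous_on S A" "continuous_on S B"
    unfolding A_def B_def by (intro smooth_on_continuous smooth_on_dd f)+
  then have "isCont A x" "isCont B x" using S x continuous_on_eq_continuous_at by blast+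
  then have "\<forall>\<^sub>F y in nhds x. dist (A y) (A x) < \<bar>A x - B x\<bar> / 2 \<and> dist (B y) (B x) < \<bar>A x - B x\<bar> / 2 \<and> y \<in> S"
    using tendstoD[OF _ ne, of A "A x"] tendstoD[OF _ ne, of B "B x"] eventually_nhds_in_open[OF S x]
    by (intro eventually_conj) (simp_all only: isCont_def tendsto_at_iff_tendsto_nhds)
  then obtain d where d: "d > 0" "\<And>y. dist y x < d \<Longrightarrow>
      dist (A y) (A x) < \<bar>A x - B x\<bar> / 2 \<and> dist (B y) (B x) < \<bar>A x - B x\<bar> / 2 \<and> y \<in> S"
    unfolding eventually_nhds_metric by auto
  \<comment> \<open>This keeps the parallelogram with sides \<open>t u\<close> and
    \<open>t v\<close> within distance \<open>d / 2\<close> of \<open>x\<close>; the summand 1 makes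
    the denominator positive even if both vectors are zero.\<close>
  define t where "t = d / (2 * (norm u + norm v + 1))"
  have t: "t > 0" unfolding t_def using d by (simp add: add_nonneg_pos)
  have close: "dist (x + a *\<^sub>R u + b *\<^sub>R v) x < d" if "0 \<le> a" "a \<le> t" "0 \<le> b" "b \<le> t" for a b
  proof -
    have "norm (a *\<^sub>R u + b *\<^sub>R v) \<le> a * norm u + b * norm v"
      using norm_triangle_ineq[of "a *\<^sub>R u" "b *\<^sub>R v"] that by simp
    also have "\<dots> \<le> t * norm u + t * norm v"
      using that by (intro add_mono mult_right_mono) auto
    also have "\<dots> \<le> t * (norm u + norm v + 1)" using t by (simp add: algebra_simps)
    also have "\<dots> = d / 2" unfolding t_def
      using add_nonneg_pos[of "norm u + norm v" 1] by (simp add: field_simps)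
    also have "\<dots> < d" using d by simp
    finally show ?thesis by (simp add: dist_norm)
  qed
  obtain a b where ab: "0 < a" "a < t" "0 < b" "b < t"
    "f (x + t *\<^sub>R u + t *\<^sub>R v) - f (x + t *\<^sub>R u) - f (x + t *\<^sub>R v) + f x = t * t * A (x + a *\<^sub>R u + b *\<^sub>R v)"
    using second_difference[OF f t, of x u v] close d unfolding A_def by blast
  have close': "dist (x + a *\<^sub>R v + b *\<^sub>R u) x < d" if "0 \<le> a" "a \<le> t" "0 \<le> b" "b \<le> t" for a b
    using close[of b a] that by (simp add: add_ac)
  obtain a' b' where ab': "0 < a'" "a' < t" "0 < b'" "b' < t"
    "f (x + t *\<^sub>R v + t *\<^sub>R u) - f (x + t *\<^sub>R v) - f (x + t *\<^sub>R u) + f x = t * t * B (x + a' *\<^sub>R v + b' *\<^sub>R u)"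
    using second_difference[OF f t, of x v u] close' d unfolding B_def by blast
  have "t * t * A (x + a *\<^sub>R u + b *\<^sub>R v) = t * t * B (x + a' *\<^sub>R v + b' *\<^sub>R u)"
    using ab(5) ab'(5) by (simp add: algebra_simps)
  then have "A (x + a *\<^sub>R u + b *\<^sub>R v) = B (x + a' *\<^sub>R v + b' *\<^sub>R u)" using t by simp
  moreover have "dist (A (x + a *\<^sub>R u + b *\<^sub>R v)) (A x) < \<bar>A x - B x\<bar> / 2"
    "dist (B (x + a' *\<^sub>R v + b' *\<^sub>R u)) (B x) < \<bar>A x - B x\<bar> / 2"
    using d(2) close close' ab ab' by auto
  ultimately show False unfolding dist_real_def by (smt (verit) field_sum_of_halves)
qed

lemma second_derivative_symmetric:
  fixes f :: "'a::real_normed_vector \<Rightarrow> 'b::euclidean_space"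
  assumes f: "smooth_on S f" and S: "open S" and x: "x \<in> S"
  shows "dd (\<lambda>y. dd f y u) x v = dd (\<lambda>y. dd f y v) x u"
proof (rule euclidean_eqI)
  fix b :: 'b
  have 1: "dd (\<lambda>y. f y \<bullet> b) y w = dd f y w \<bullet> b" if "y \<in> S" for y w
    using smooth_on_differentiable[OF f that] by (rule dd_linear[OF bounded_linear_inner_left])
  have 2: "dd (\<lambda>y. dd (\<lambda>y. f y \<bullet> b) y w) x z = dd (\<lambda>y. dd f y w) x z \<bullet> b" for w z
  proof -
    have "dd (\<lambda>y. dd (\<lambda>y. f y \<bullet> b) y w) x z = dd (\<lambda>y. dd f y w \<bullet> b) x z"
      by (rule dd_cong_open[OF S x 1])
    then show ?thesis
      using smooth_on_differentiable[OF smooth_on_dd[OF f] x] by (simp only: dd_linear[OF bounded_linear_inner_left])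
  qed
  show "dd (\<lambda>y. dd f y u) x v \<bullet> b = dd (\<lambda>y. dd f y v) x u \<bullet> b"
    using second_derivative_symmetric_real[OF smooth_on_inner[OF S f] S x, of b u v] by (simp add: 2)
qed

subsection \<open>Bump functions\<close>

text \<open>The powers of 1/t in front of exp(-1/t) make the family closed under differentiation up
  to linear combinations, so that smoothness is one induction for all \<open>m\<close> at once. The
  bump function uses \<open>m = 0\<close>.\<close>

definition flat_power :: "nat \<Rightarrow> real \<Rightarrow> real" where
  "flat_power m t = (if t > 0 then (inverse t) ^ m * exp (- inverse t) else 0)"

lemma flat_power_tendsto: "(flat_power m \<longlongrightarrow> 0) (at 0)"
proof -
  have "((\<lambda>s. s ^ m / exp s) \<longlongrightarrow> 0) (at_top :: real filter)"
    by (rule tendsto_power_div_exp_0)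
  then have "((\<lambda>t. (inverse t) ^ m / exp (inverse t)) \<longlongrightarrow> 0) (at_right (0::real))"
    by (rule filterlim_compose[OF _ filterlim_inverse_at_top_right])
  then have "(flat_power m \<longlongrightarrow> 0) (at_right 0)"
    by (rule Lim_transform_eventually)
      (auto simp: flat_power_def exp_minus divide_inverse intro!: eventually_at_rightI[of 0 1])
  moreover have "(flat_power m \<longlongrightarrow> 0) (at_left 0)"
    by (rule Lim_transform_eventually[OF tendsto_const])
      (auto simp: flat_power_def intro!: eventually_at_leftI[of "-1" 0])
  ultimately show ?thesis by (simp add: filterlim_split_at)
qed

lemma flat_power_derivative:
  "(flat_power m has_real_derivative flat_power (m + 2) t - real m * flat_power (m + 1) t) (at t)"
proof -
  consider "t > 0" | "t < 0" | "t = 0" by linarith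
  then show ?thesis
  proof cases
    case 1
    have "((\<lambda>t. (inverse t) ^ m * exp (- inverse t)) has_real_derivative
      (inverse t) ^ (m + 2) * exp (- inverse t) - real m * ((inverse t) ^ (m + 1) * exp (- inverse t))) (at t)"
    proof -
      have inv: "(inverse has_real_derivative - (inverse t * inverse t)) (at t)"
        using DERIV_inverse[of t] 1 by (simp add: power2_eq_square)
      have "((\<lambda>t. (inverse t) ^ m) has_real_derivative - (real m * inverse t ^ (m + 1))) (at t)"
        using DERIV_power[OF inv, of m] by (cases m) (simp_all add: mult_ac)
      moreover have "((\<lambda>t. exp (- inverse t)) has_real_derivative exp (- inverse t) * (- (- (inverse t * inverse t)))) (at t)"
        by (intro DERIV_fun_exp DERIV_minus inv)
      ultimately show ?thesis
        by (rule DERIV_cong[OF DERIV_mult]) (simp add: algebra_simps)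
    qed
    then have "(flat_power m has_real_derivative
      (inverse t) ^ (m + 2) * exp (- inverse t) - real m * ((inverse t) ^ (m + 1) * exp (- inverse t))) (at t)"
      by (rule has_field_derivative_transform_within_open[of _ _ _ "{0<..}"]) (use 1 in \<open>auto simp: flat_power_def\<close>)
    then show ?thesis using 1 by (simp add: flat_power_def)
  next
    case 2
    have "(flat_power m has_real_derivative 0) (at t)"
      by (rule has_field_derivative_transform_within_open[OF DERIV_const, of "{..<0}"]) (use 2 in \<open>auto simp: flat_power_def\<close>)
    then show ?thesis using 2 by (simp add: flat_power_def)
  next
    case 3
    have "((\<lambda>h. flat_power (m + 1) h) \<longlongrightarrow> 0) (at 0)" by (rule flat_power_tendsto)
    \<comment> \<open>At 0 the difference quotient of \<open>flat_power m\<close> is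
      \<open>flat_power (m + 1)\<close> itself.\<close>
    then have "((\<lambda>h. (flat_power m (0 + h) - flat_power m 0) / h) \<longlongrightarrow> 0) (at 0)"
      by (rule Lim_transform_eventually)
        (auto simp: flat_power_def divide_inverse mult_ac intro!: always_eventually)
    then show ?thesis using 3 by (simp add: DERIV_def flat_power_def)
  qed
qed

lemma smooth_on_flat_power: "smooth_on UNIV (flat_power m)"
proof -
  have "k_smooth_on k UNIV (flat_power m)" for k m
  proof (induction k arbitrary: m)
    case 0
    show ?case
      using DERIV_isCont[OF flat_power_derivative] by (auto intro!: continuous_at_imp_continuous_on)
  next
    case (Suc k)
    have "(flat_power m has_derivative (\<lambda>u. u *\<^sub>R (flat_power (m + 2) t + (- real m) *\<^sub>R flat_power (m + 1) t))) (at t)" for t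
      using flat_power_derivative[of m t] unfolding has_field_derivative_def
      by (rule has_derivative_eq_rhs) (simp add: fun_eq_iff)
    then show ?case
      by (rule k_smooth_on_SucI[OF open_UNIV])
        (intro k_smooth_on_linear[OF bounded_linear_scaleR_right open_UNIV] k_smooth_on_add open_UNIV Suc.IH)
  qed
  then show ?thesis by (simp add: smooth_on_def)
qed

lemma bump_function_exists:
  fixes x :: "'a::euclidean_space"
  assumes r: "r > 0"
  obtains \<rho> :: "'a \<Rightarrow> real" where "smooth_on UNIV \<rho>" "\<rho> x = 1" "\<And>y. y \<notin> ball x r \<Longrightarrow> \<rho> y = 0"
proof -
  \<comment> \<open>The squared distance is spelled out in coordinates, the form to which the
    smoothness rules apply. \<open>q\<close> is positive exactly inside the ball.\<close>
  define q where "q y = r\<^sup>2 - (\<Sum>b\<in>Basis. ((y - x) \<bullet> b) *\<^sub>R ((y - x) \<bullet> b))" for y :: 'a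
  have q: "q y = r\<^sup>2 - (norm (y - x))\<^sup>2" for y
    unfolding q_def power2_norm_eq_inner by (subst (3) euclidean_inner) simp
  have id: "smooth_on UNIV (\<lambda>y::'a. y)"
  proof -
    have "k_smooth_on k UNIV (\<lambda>y::'a. y)" for k
      by (cases k) (auto intro!: k_smooth_on_SucI[where D = "\<lambda>y u. u"] has_derivative_ident k_smooth_on_const continuous_on_id simp del: k_smooth_on.simps(2))
    then show ?thesis by (simp add: smooth_on_def)
  qed
  have "smooth_on UNIV q"
    unfolding q_def
    by (intro smooth_on_diff smooth_on_const smooth_on_sum smooth_on_scaleR smooth_on_inner id open_UNIV)
  then have "smooth_on UNIV (\<lambda>y. flat_power 0 (q y))"
    by (intro smooth_on_compose[OF open_UNIV open_UNIV _ smooth_on_flat_power]) auto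
  then have "smooth_on UNIV (\<lambda>y. (1 / flat_power 0 (r\<^sup>2)) *\<^sub>R flat_power 0 (q y))"
    by (intro smooth_on_scaleR_const open_UNIV)
  then show ?thesis
  proof (rule that)
    show "(1 / flat_power 0 (r\<^sup>2)) *\<^sub>R flat_power 0 (q x) = 1"
      using r by (simp add: q flat_power_def)
    show "(1 / flat_power 0 (r\<^sup>2)) *\<^sub>R flat_power 0 (q y) = 0" if "y \<notin> ball x r" for y
    proof -
      have "r \<le> norm (y - x)" using that by (simp add: dist_norm norm_minus_commute)
      then have "q y \<le> 0" using r by (simp add: q power_mono)
      then show ?thesis by (simp add: flat_power_def)
    qed
  qed
qed

section \<open>The algebra of linear endomorphisms\<close>

text \<open>Composition of linear maps becomes the product of a \<open>real_algebra_1\<close>, so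
  that the Clifford locales, which compute in an abstract algebra, apply to operators on
  spinors.\<close>

typedef (overloaded) ('v::real_vector) endo = "{f :: 'v \<Rightarrow> 'v. linear f}"
  morphisms act Endo
  using linear_zero by blast

setup_lifting type_definition_endo

instantiation endo :: (euclidean_space) real_algebra_1
begin

lift_definition zero_endo :: "'a endo" is "\<lambda>v. 0" by (rule linear_zero)
lift_definition one_endo :: "'a endo" is "\<lambda>v. v" by (simp add: linear_iff)
lift_definition plus_endo :: "'a endo \<Rightarrow> 'a endo \<Rightarrow> 'a endo" is "\<lambda>f g v. f v + g v" by (rule linear_compose_add)
lift_definition minus_endo :: "'a endo \<Rightarrow> 'a endo \<Rightarrow> 'a endo" is "\<lambda>f g v. f v - g v" by (rule linear_compose_sub)
lift_definition uminus_endo :: "'a endo \<Rightarrow> 'a endo" is "\<lambda>f v. - f v" by (rule linear_compose_neg)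
lift_definition times_endo :: "'a endo \<Rightarrow> 'a endo \<Rightarrow> 'a endo" is "\<lambda>f g v. f (g v)"
  using linear_compose by (fastforce simp: o_def)
lift_definition scaleR_endo :: "real \<Rightarrow> 'a endo \<Rightarrow> 'a endo" is "\<lambda>r f v. r *\<^sub>R f v" by (rule linear_compose_scale_right)

instance
proof
  obtain b :: 'a where b: "b \<in> Basis" using nonempty_Basis by blast
  show "(0::'a endo) \<noteq> 1"
    by transfer (metis b nonzero_Basis)
qed (transfer; simp add: fun_eq_iff algebra_simps linear_add linear_cmul linear_scale)+

end

lemma act_simps:
  "act (A + B) v = act A v + act B v" "act (A - B) v = act A v - act B v" "act (- A) v = - act A v"
  "act (A * B) v = act A (act B v)" "act (r *\<^sub>R A) v = r *\<^sub>R act A v" "act 0 v = 0" "act 1 v = v"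
  for A B :: "'v::euclidean_space endo"
  by (simp_all add: plus_endo.rep_eq minus_endo.rep_eq uminus_endo.rep_eq times_endo.rep_eq
      scaleR_endo.rep_eq zero_endo.rep_eq one_endo.rep_eq)

lemma act_of_real: "act (of_real r) v = r *\<^sub>R v" for v :: "'v::euclidean_space"
  by (simp add: of_real_def act_simps)

lemma act_sum: "act (\<Sum>i\<in>I. A i) v = (\<Sum>i\<in>I. act (A i) v)" for v :: "'v::euclidean_space"
  by (induction I rule: infinite_finite_induct) (auto simp: act_simps)

lemma linear_act: "linear (act A)"
  using act by auto

lemma bounded_linear_act: "bounded_linear (act A)" for A :: "'v::euclidean_space endo"
  using linear_act linear_conv_bounded_linear by blast

lemmas act_vec = linear_add[OF linear_act] linear_diff[OF linear_act] linear_neg[OF linear_act]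
  linear_cmul[OF linear_act] linear_sum[OF linear_act] linear_0[OF linear_act]

text \<open>The Leibniz rule is stated through the action on vectors, which avoids a topology on the endomorphism algebra.\<close>

definition operator_derivative ::
    "('a::real_normed_vector \<Rightarrow> 'v::euclidean_space endo) \<Rightarrow> 'a \<Rightarrow> ('a \<Rightarrow> 'v endo) \<Rightarrow> bool" where
  "operator_derivative \<Theta> x D \<longleftrightarrow> (\<forall>f. f differentiable (at x) \<longrightarrow>
     ((\<lambda>y. act (\<Theta> y) (f y)) has_derivative (\<lambda>u. act (\<Theta> x) (dd f x u) + act (D u) (f x))) (at x))"

lemma operator_derivative_const: "operator_derivative (\<lambda>y. A) x (\<lambda>u. 0)"
  unfolding operator_derivative_def
  by (auto simp: act_simps intro!: bounded_linear.has_derivative[OF bounded_linear_act] dd_has_derivative)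

lemma operator_derivative_scaleR:
  assumes k: "k differentiable (at x)"
  shows "operator_derivative (\<lambda>y. k y *\<^sub>R A) x (\<lambda>u. dd k x u *\<^sub>R A)"
  unfolding operator_derivative_def act_simps
  using has_derivative_scaleR[OF dd_has_derivative[OF k] bounded_linear.has_derivative[OF bounded_linear_act dd_has_derivative]]
  by blast

lemma operator_derivative_scaleR_const:
  assumes "operator_derivative \<Theta> x D"
  shows "operator_derivative (\<lambda>y. r *\<^sub>R \<Theta> y) x (\<lambda>u. r *\<^sub>R D u)"
  using assms unfolding operator_derivative_def
  by (auto simp: act_simps simp flip: scaleR_right_distrib intro!: has_derivative_scaleR_right)

lemma operator_derivative_sum:
  assumes "\<And>i. i \<in> I \<Longrightarrow> operator_derivative (\<Theta> i) x (D i)"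
  shows "operator_derivative (\<lambda>y. \<Sum>i\<in>I. \<Theta> i y) x (\<lambda>u. \<Sum>i\<in>I. D i u)"
  using assms unfolding operator_derivative_def act_sum sum.distrib[symmetric]
  by (auto intro!: has_derivative_sum)

lemma dd_operator:
  "operator_derivative \<Theta> x D \<Longrightarrow> f differentiable (at x) \<Longrightarrow>
    dd (\<lambda>y. act (\<Theta> y) (f y)) x u = act (\<Theta> x) (dd f x u) + act (D u) (f x)"
  by (rule dd_eqI) (simp add: operator_derivative_def)

section \<open>Geometry of a chart\<close>

lemma axis_expand: "(\<Sum>k\<in>UNIV. v $ k *\<^sub>R axis k 1) = v" for v :: "real ^ 'k::finite"
  using basis_expansion[of v] by (simp add: scalar_mult_eq_scaleR)

lemma linear_axis_expand:
  fixes v :: "real ^ 'k::finite"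
  assumes "linear L"
  shows "L v = (\<Sum>k\<in>UNIV. v $ k *\<^sub>R L (axis k 1))"
  by (subst (1) axis_expand[of v, symmetric]) (simp add: linear_sum[OF assms] linear_cmul[OF assms])

locale spin_chart =
  fixes M :: "('p, 'i, 'n::{finite,linorder}, 'm::finite) spin_data" and i :: 'i
  assumes spin: "oriented_riemannian_spin_manifold M" and chart: "i \<in> charts M"
begin

abbreviation "U \<equiv> cimg M i"
abbreviation "g \<equiv> metric M i"
abbreviation "e \<equiv> frame M i"
abbreviation "\<Gamma> \<equiv> christoffel M i"

lemma open_U: "open U"
  using spin chart by (simp add: oriented_riemannian_spin_manifold_def oriented_manifold_def)

lemma smooth_g: "smooth_on U (\<lambda>x. g x u v)"
  using spin chart by (simp add: oriented_riemannian_spin_manifold_def riemannian_metric_def)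

lemma bilinear_g: "x \<in> U \<Longrightarrow> bilinear (g x)"
  using spin chart by (simp add: oriented_riemannian_spin_manifold_def riemannian_metric_def)

lemma g_sym: "x \<in> U \<Longrightarrow> g x u v = g x v u"
  using spin chart by (simp add: oriented_riemannian_spin_manifold_def riemannian_metric_def)

lemma smooth_e: "smooth_on U (\<lambda>x. e x a)"
  using spin chart by (simp add: oriented_riemannian_spin_manifold_def oriented_orthonormal_frames_def)

lemma orthonormal: "x \<in> U \<Longrightarrow> g x (e x a) (e x b) = (if a = b then 1 else 0)"
  using spin chart by (simp add: oriented_riemannian_spin_manifold_def oriented_orthonormal_frames_def)

lemma linear_g_right: "x \<in> U \<Longrightarrow> linear (g x u)"
  using bilinear_g bilinear_def by blast

lemma linear_g_left: "x \<in> U \<Longrightarrow> linear (\<lambda>u. g x u v)"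
  using bilinear_g bilinear_def by blast

lemma g_simps:
  assumes "x \<in> U"
  shows "g x (u + v) w = g x u w + g x v w" "g x (u - v) w = g x u w - g x v w" "g x (r *\<^sub>R u) w = r * g x u w"
    "g x w (u + v) = g x w u + g x w v" "g x w (u - v) = g x w u - g x w v" "g x w (r *\<^sub>R u) = r * g x w u"
    "g x (sum X I) w = (\<Sum>i\<in>I. g x (X i) w)" "g x w (sum X I) = (\<Sum>i\<in>I. g x w (X i))"
  using linear_add[OF linear_g_right[OF assms]] linear_diff[OF linear_g_right[OF assms]]
    linear_cmul[OF linear_g_right[OF assms]] linear_sum[OF linear_g_right[OF assms]]
    linear_add[OF linear_g_left[OF assms]] linear_diff[OF linear_g_left[OF assms]]
    linear_cmul[OF linear_g_left[OF assms]] linear_sum[OF linear_g_left[OF assms]] by simp_all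

text \<open>With the frame vectors as rows of \<open>E\<close>, orthonormality says that
  \<open>E ** P\<close> is the identity. A one-sided inverse of a square matrix is two-sided, which
  gives completeness of the frame and \<open>transpose E ** E\<close> as the inverse of the Gram
  matrix.\<close>

lemma gram_inverse:
  assumes x: "x \<in> U"
  shows "(\<Sum>a\<in>UNIV. g x (axis k 1) (e x a) * e x a $ l) = (if k = l then 1 else 0)"
    and "inv_gram M i x $ k $ l = (\<Sum>a\<in>UNIV. e x a $ k * e x a $ l)"
proof -
  define E :: "('n rvec, 'n) vec" where "E = (\<chi> a. e x a)"
  define G :: "('n rvec, 'n) vec" where "G = (\<chi> k l. g x (axis k 1) (axis l 1))"
  define P where "P = G ** transpose E"
  have P: "P $ k $ a = g x (axis k 1) (e x a)" for k a
    using linear_axis_expand[OF linear_g_right[OF x], of "axis k 1" "e x a"]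
    by (simp add: P_def matrix_matrix_mult_def transpose_def G_def E_def mult.commute)
  have "(E ** P) $ a $ b = (if a = b then 1 else 0)" for a b
    using linear_axis_expand[OF linear_g_left[OF x], of "e x a" "e x b"]
    by (simp add: matrix_matrix_mult_def P E_def orthonormal[OF x])
  then have "E ** P = mat 1" by (simp add: vec_eq_iff mat_def)
  then have PE: "P ** E = mat 1" using matrix_left_right_inverse by blast
  then have "(P ** E) $ k $ l = (if k = l then 1 else 0)" by (simp add: mat_def)
  then show "(\<Sum>a\<in>UNIV. g x (axis k 1) (e x a) * e x a $ l) = (if k = l then 1 else 0)"
    by (simp only: matrix_matrix_mult_def P vec_lambda_beta E_def)
  have GQ: "G ** (transpose E ** E) = mat 1" using PE by (simp add: P_def matrix_mul_assoc)
  then have QG: "(transpose E ** E) ** G = mat 1" using matrix_left_right_inverse by blast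
  have "invertible G" using GQ QG unfolding invertible_def by blast
  then have "G ** matrix_inv G = mat 1"
    unfolding invertible_def matrix_inv_def by (rule someI2_ex) simp
  then have "matrix_inv G = transpose E ** E"
    by (metis QG matrix_mul_assoc matrix_mul_lid matrix_mul_rid)
  then show "inv_gram M i x $ k $ l = (\<Sum>a\<in>UNIV. e x a $ k * e x a $ l)"
    by (simp add: inv_gram_def G_def[symmetric] matrix_matrix_mult_def transpose_def) (simp add: E_def)
qed

lemma frame_expand:
  assumes x: "x \<in> U"
  shows "(\<Sum>a\<in>UNIV. g x v (e x a) *\<^sub>R e x a) = v"
proof (rule vec_eq_iff[THEN iffD2], rule allI)
  fix l
  have "(\<Sum>a\<in>UNIV. g x v (e x a) *\<^sub>R e x a) $ l = (\<Sum>a\<in>UNIV. \<Sum>k\<in>UNIV. v $ k * (g x (axis k 1) (e x a) * e x a $ l))"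
    by (subst linear_axis_expand[OF linear_g_left[OF x], of v]) (simp add: sum_distrib_right mult.assoc)
  also have "\<dots> = (\<Sum>k\<in>UNIV. v $ k * (\<Sum>a\<in>UNIV. g x (axis k 1) (e x a) * e x a $ l))"
    by (subst sum.swap) (simp add: sum_distrib_left)
  also have "\<dots> = v $ l" by (simp add: gram_inverse(1)[OF x] if_distrib cong: if_cong)
  finally show "(\<Sum>a\<in>UNIV. g x v (e x a) *\<^sub>R e x a) $ l = v $ l" .
qed

lemma linear_frame_expand:
  assumes x: "x \<in> U" and L: "linear L"
  shows "L v = (\<Sum>a\<in>UNIV. g x v (e x a) *\<^sub>R L (e x a))"
  by (subst (1) frame_expand[OF x, of v, symmetric]) (simp add: linear_sum[OF L] linear_cmul[OF L])

lemma frame_eqI: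
  assumes x: "x \<in> U" and "\<And>a. g x v (e x a) = g x w (e x a)"
  shows "v = w"
  by (metis (no_types, lifting) assms(2) frame_expand[OF x] sum.cong)

lemma sharp_eq:
  assumes x: "x \<in> U" and L: "linear \<alpha>"
  shows "sharp M i x \<alpha> = (\<Sum>a\<in>UNIV. \<alpha> (e x a) *\<^sub>R e x a)"
proof (rule vec_eq_iff[THEN iffD2], rule allI)
  fix k
  have "sharp M i x \<alpha> $ k = (\<Sum>l\<in>UNIV. \<Sum>a\<in>UNIV. e x a $ k * (e x a $ l * \<alpha> (axis l 1)))"
    by (simp add: sharp_def matrix_vector_mult_def gram_inverse(2)[OF x] sum_distrib_right mult.assoc)
  also have "\<dots> = (\<Sum>a\<in>UNIV. e x a $ k * (\<Sum>l\<in>UNIV. e x a $ l * \<alpha> (axis l 1)))"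
    by (subst sum.swap) (simp add: sum_distrib_left)
  also have "\<dots> = (\<Sum>a\<in>UNIV. e x a $ k * \<alpha> (e x a))"
    by (simp add: linear_axis_expand[OF L, of "e x a" for a])
  finally show "sharp M i x \<alpha> $ k = (\<Sum>a\<in>UNIV. \<alpha> (e x a) *\<^sub>R e x a) $ k"
    by (simp add: mult.commute)
qed

lemma g_sharp:
  assumes x: "x \<in> U" and L: "linear \<alpha>"
  shows "g x (sharp M i x \<alpha>) w = \<alpha> w"
  by (simp add: sharp_eq[OF assms] g_simps[OF x] linear_frame_expand[OF x L, of w] g_sym[OF x, of w] mult.commute)

subsection \<open>The Levi-Civita connection\<close>

text \<open>Christoffel symbols of the first kind: the Koszul formula for coordinate-constant
  fields, whose brackets vanish.\<close>

definition koszul :: "'n rvec \<Rightarrow> 'n rvec \<Rightarrow> 'n rvec \<Rightarrow> 'n rvec \<Rightarrow> real" where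
  "koszul x u v w = (dd (\<lambda>y. g y v w) x u + dd (\<lambda>y. g y u w) x v - dd (\<lambda>y. g y u v) x w) / 2"

lemma differentiable_g: "x \<in> U \<Longrightarrow> (\<lambda>y. g y u v) differentiable (at x)"
  by (rule smooth_on_differentiable[OF smooth_g])

lemma linear_dd_g_right: "x \<in> U \<Longrightarrow> linear (\<lambda>w. dd (\<lambda>y. g y v w) x u)"
  by (rule linear_dd_family[OF open_U linear_g_right _ differentiable_g])

lemma linear_dd_g_left: "x \<in> U \<Longrightarrow> linear (\<lambda>v. dd (\<lambda>y. g y v w) x u)"
  by (rule linear_dd_family[OF open_U linear_g_left _ differentiable_g])

lemma dd_g_sym: "x \<in> U \<Longrightarrow> dd (\<lambda>y. g y v w) x u = dd (\<lambda>y. g y w v) x u"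
  by (rule dd_cong_open[OF open_U]) (auto intro: g_sym)

lemma linear_koszul_right: "x \<in> U \<Longrightarrow> linear (koszul x u v)"
  unfolding koszul_def divide_inverse
  by (intro linear_compose_sub linear_compose_add linear_dd_g_right linear_dd[OF differentiable_g]
      linear_compose[OF _ bounded_linear.linear[OF bounded_linear_mult_left], unfolded o_def]) auto

lemma linear_koszul_mid: "x \<in> U \<Longrightarrow> linear (\<lambda>v. koszul x u v w)"
  unfolding koszul_def divide_inverse
  by (intro linear_compose_sub linear_compose_add linear_dd_g_right linear_dd_g_left linear_dd[OF differentiable_g]
      linear_compose[OF _ bounded_linear.linear[OF bounded_linear_mult_left], unfolded o_def]) auto

lemma christoffel_eq: "x \<in> U \<Longrightarrow> \<Gamma> x u v = (\<Sum>a\<in>UNIV. koszul x u v (e x a) *\<^sub>R e x a)"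
  unfolding christoffel_def koszul_def[symmetric] by (rule sharp_eq[OF _ linear_koszul_right])

lemma g_christoffel: "x \<in> U \<Longrightarrow> g x (\<Gamma> x u v) w = koszul x u v w"
  unfolding christoffel_def koszul_def[symmetric] by (rule g_sharp[OF _ linear_koszul_right])

lemma christoffel_sym: "x \<in> U \<Longrightarrow> \<Gamma> x u v = \<Gamma> x v u"
  using dd_g_sym[of x u v] by (simp add: christoffel_eq koszul_def add.commute)

lemma linear_christoffel_right: "x \<in> U \<Longrightarrow> linear (\<Gamma> x u)"
  by (rule linearI; rule frame_eqI)
    (auto simp: g_christoffel g_simps linear_add[OF linear_koszul_mid] linear_cmul[OF linear_koszul_mid])

lemma linear_christoffel_left: "x \<in> U \<Longrightarrow> linear (\<lambda>u. \<Gamma> x u v)"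
  using linear_christoffel_right[of x v] by (subst christoffel_sym)

lemma smooth_christoffel: "smooth_on U (\<lambda>y. \<Gamma> y u v)"
proof -
  have "smooth_on U (\<lambda>y. koszul y u v w)" for w
    unfolding koszul_def divide_inverse
    by (intro smooth_on_linear[OF bounded_linear_mult_left open_U] smooth_on_diff smooth_on_add smooth_on_dd smooth_g open_U)
  then have "smooth_on U (\<lambda>y. koszul y u v (e y a))" for a
    by (intro smooth_linear_family[where B = "\<lambda>y w. koszul y u v w", OF open_U linear_koszul_right _ smooth_e])
  then have "smooth_on U (\<lambda>y. \<Sum>a\<in>UNIV. koszul y u v (e y a) *\<^sub>R e y a)"
    by (intro smooth_on_sum smooth_on_scaleR smooth_e open_U)
  then show ?thesis
    by (subst smooth_on_cong[OF open_U christoffel_eq]) auto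
qed

lemma metric_compatible:
  assumes "x \<in> U"
  shows "dd (\<lambda>y. g y v w) x u = g x (\<Gamma> x u v) w + g x v (\<Gamma> x u w)"
  using dd_g_sym[OF assms, of v w u] dd_g_sym[OF assms, of u v w] dd_g_sym[OF assms, of u w v]
  by (simp add: g_christoffel[OF assms] g_sym[OF assms, of v "\<Gamma> x u w"] koszul_def field_simps)

definition cov_frame :: "'n rvec \<Rightarrow> 'n rvec \<Rightarrow> 'n \<Rightarrow> 'n rvec" where
  "cov_frame x u c = dd (\<lambda>y. e y c) x u + \<Gamma> x u (e x c)"

text \<open>The connection 1-forms of the frame; the differentiated frame vector is the first
  index.\<close>

definition \<omega> :: "'n rvec \<Rightarrow> 'n rvec \<Rightarrow> 'n \<Rightarrow> 'n \<Rightarrow> real" where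
  "\<omega> x u c d = g x (cov_frame x u c) (e x d)"

lemma differentiable_e: "x \<in> U \<Longrightarrow> (\<lambda>y. e y c) differentiable (at x)"
  by (rule smooth_on_differentiable[OF smooth_e])

lemma cov_frame_expand: "x \<in> U \<Longrightarrow> cov_frame x u c = (\<Sum>d\<in>UNIV. \<omega> x u c d *\<^sub>R e x d)"
  by (simp add: \<omega>_def frame_expand)

lemma linear_cov_frame: "x \<in> U \<Longrightarrow> linear (\<lambda>u. cov_frame x u c)"
  unfolding cov_frame_def by (intro linear_compose_add linear_dd differentiable_e linear_christoffel_left)

lemma linear_\<omega>: "x \<in> U \<Longrightarrow> linear (\<lambda>u. \<omega> x u c d)"
  unfolding \<omega>_def using linear_compose[OF linear_cov_frame linear_g_left] by (simp add: o_def)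

lemma dd_g_fields:
  assumes x: "x \<in> U" and X: "X differentiable (at x)" and Y: "Y differentiable (at x)"
  shows "(\<lambda>y. g y (X y) (Y y)) differentiable (at x)"
    and "dd (\<lambda>y. g y (X y) (Y y)) x u = g x (dd X x u + \<Gamma> x u (X x)) (Y x) + g x (X x) (dd Y x u + \<Gamma> x u (Y x))"
proof -
  note 1 = dd_linear_family[OF open_U linear_g_left x differentiable_g[OF x] X]
  note 2 = dd_linear_family[OF open_U linear_g_right x 1(1) Y]
  show "(\<lambda>y. g y (X y) (Y y)) differentiable (at x)" by (rule 2(1))
  show "dd (\<lambda>y. g y (X y) (Y y)) x u = g x (dd X x u + \<Gamma> x u (X x)) (Y x) + g x (X x) (dd Y x u + \<Gamma> x u (Y x))"
    by (simp add: 2(2) 1(2) metric_compatible[OF x] g_simps[OF x])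
qed

lemma \<omega>_skew:
  assumes x: "x \<in> U"
  shows "\<omega> x u d c = - \<omega> x u c d"
proof -
  have "dd (\<lambda>y. g y (e y c) (e y d)) x u = dd (\<lambda>y. if c = d then 1 else 0::real) x u"
    by (rule dd_cong_open[OF open_U x]) (simp add: orthonormal)
  then have "g x (cov_frame x u c) (e x d) + g x (e x c) (cov_frame x u d) = 0"
    by (simp add: dd_const dd_g_fields(2)[OF x differentiable_e[OF x] differentiable_e[OF x]] cov_frame_def)
  then show ?thesis by (simp add: \<omega>_def g_sym[OF x, of "e x c"])
qed

lemma smooth_cov_frame: "smooth_on U (\<lambda>y. cov_frame y u c)"
  unfolding cov_frame_def
  by (intro smooth_on_add smooth_on_dd smooth_e open_U smooth_linear_family[OF open_U linear_christoffel_right smooth_christoffel])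

lemma smooth_\<omega>: "smooth_on U (\<lambda>y. \<omega> y u c d)"
proof -
  have "smooth_on U (\<lambda>y. g y (cov_frame y u c) w)" for w
    by (rule smooth_linear_family[OF open_U linear_g_left smooth_g smooth_cov_frame])
  then show ?thesis
    unfolding \<omega>_def
    by (intro smooth_linear_family[where B = "\<lambda>y w. g y (cov_frame y u c) w", OF open_U linear_g_right _ smooth_e])
qed

lemma differentiable_\<omega>: "x \<in> U \<Longrightarrow> (\<lambda>y. \<omega> y u c d) differentiable (at x)"
  by (rule smooth_on_differentiable[OF smooth_\<omega>])

lemma differentiable_christoffel: "x \<in> U \<Longrightarrow> (\<lambda>y. \<Gamma> y u v) differentiable (at x)"
  by (rule smooth_on_differentiable[OF smooth_christoffel])

subsection \<open>Curvature\<close>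

text \<open>The second structure equation in components. \<open>u\<close> and \<open>v\<close> are
  constant in the chart, hence no bracket term in the exterior derivative.\<close>

definition curv_form :: "'n rvec \<Rightarrow> 'n rvec \<Rightarrow> 'n rvec \<Rightarrow> 'n \<Rightarrow> 'n \<Rightarrow> real" where
  "curv_form x u v c d = dd (\<lambda>y. \<omega> y v c d) x u - dd (\<lambda>y. \<omega> y u c d) x v
     + (\<Sum>f\<in>UNIV. \<omega> x v c f * \<omega> x u f d - \<omega> x u c f * \<omega> x v f d)"

text \<open>\<open>S u v\<close> is the iterated covariant derivative of a frame vector along
  coordinate-constant fields, so its skew part in \<open>u\<close>, \<open>v\<close> is the
  curvature. In coordinates the second derivatives of the frame cancel and \<open>riemann\<close>
  remains; in the frame the same difference is the structure equation.\<close>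

lemma riemann_frame:
  assumes x: "x \<in> U"
  shows "g x (riemann M i x u v (e x c)) (e x d) = curv_form x u v c d"
proof -
  define S where "S u v = dd (\<lambda>y. cov_frame y v c) x u + \<Gamma> x u (cov_frame x v c)" for u v
  have S_second_derivatives: "S u v = dd (\<lambda>y. dd (\<lambda>z. e z c) y v) x u + dd (\<lambda>y. \<Gamma> y v (e x c)) x u + \<Gamma> x v (dd (\<lambda>z. e z c) x u)
      + \<Gamma> x u (dd (\<lambda>z. e z c) x v) + \<Gamma> x u (\<Gamma> x v (e x c))" for u v
  proof -
    note 1 = dd_linear_family[OF open_U linear_christoffel_right x differentiable_christoffel[OF x] differentiable_e[OF x], of v c]
    have "dd (\<lambda>y. cov_frame y v c) x u = dd (\<lambda>y. dd (\<lambda>z. e z c) y v) x u + dd (\<lambda>y. \<Gamma> y v (e y c)) x u"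
      unfolding cov_frame_def
      by (rule dd_add[OF smooth_on_differentiable[OF smooth_on_dd[OF smooth_e] x] 1(1)])
    then show ?thesis
      by (simp add: S_def 1(2) cov_frame_def linear_add[OF linear_christoffel_right[OF x]] add.assoc)
  qed
  have "dd (\<lambda>y. dd (\<lambda>z. e z c) y v) x u = dd (\<lambda>y. dd (\<lambda>z. e z c) y u) x v"
    by (rule second_derivative_symmetric[OF smooth_e open_U x])
  then have R: "riemann M i x u v (e x c) = S u v - S v u"
    by (simp add: S_second_derivatives riemann_def)
  have S_frame: "S u v = (\<Sum>d\<in>UNIV. dd (\<lambda>y. \<omega> y v c d) x u *\<^sub>R e x d + \<omega> x v c d *\<^sub>R cov_frame x u d)" for u v
  proof -
    have "dd (\<lambda>y. cov_frame y v c) x u = dd (\<lambda>y. \<Sum>d\<in>UNIV. \<omega> y v c d *\<^sub>R e y d) x u"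
      by (rule dd_cong_open[OF open_U x cov_frame_expand])
    also have "\<dots> = (\<Sum>d\<in>UNIV. dd (\<lambda>y. \<omega> y v c d *\<^sub>R e y d) x u)"
      by (rule dd_sum) (intro differentiable_scaleR differentiable_\<omega> differentiable_e x)
    also have "\<dots> = (\<Sum>d\<in>UNIV. \<omega> x v c d *\<^sub>R dd (\<lambda>y. e y d) x u + dd (\<lambda>y. \<omega> y v c d) x u *\<^sub>R e x d)"
      by (simp add: dd_scaleR differentiable_\<omega> differentiable_e x)
    finally show ?thesis
    proof -
      assume 1: "dd (\<lambda>y. cov_frame y v c) x u = (\<Sum>d\<in>UNIV. \<omega> x v c d *\<^sub>R dd (\<lambda>y. e y d) x u + dd (\<lambda>y. \<omega> y v c d) x u *\<^sub>R e x d)"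
      have 2: "\<Gamma> x u (cov_frame x v c) = (\<Sum>d\<in>UNIV. \<omega> x v c d *\<^sub>R \<Gamma> x u (e x d))"
        by (subst cov_frame_expand[OF x])
          (simp add: linear_sum[OF linear_christoffel_right[OF x]] linear_cmul[OF linear_christoffel_right[OF x]])
      show ?thesis
        unfolding S_def 1 2 by (simp add: cov_frame_def sum.distrib scaleR_right_distrib)
    qed
  qed
  have "g x (S u v) (e x d) = dd (\<lambda>y. \<omega> y v c d) x u + (\<Sum>f\<in>UNIV. \<omega> x v c f * \<omega> x u f d)" for u v
    by (simp add: S_frame g_simps[OF x] orthonormal[OF x] sum.distrib \<omega>_def[symmetric] if_distrib cong: if_cong)
  then show ?thesis
    by (simp add: R g_simps[OF x] curv_form_def sum_subtractf)
qed

lemma curv_form_skew: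
  assumes x: "x \<in> U"
  shows "curv_form x v u c d = - curv_form x u v c d" "curv_form x u v d c = - curv_form x u v c d"
proof -
  show "curv_form x v u c d = - curv_form x u v c d"
    by (simp add: curv_form_def sum_subtractf)
  have "dd (\<lambda>y. \<omega> y v d c) x u = - dd (\<lambda>y. \<omega> y v c d) x u" for u v
  proof -
    have "dd (\<lambda>y. \<omega> y v d c) x u = dd (\<lambda>y. - \<omega> y v c d) x u"
      by (rule dd_cong_open[OF open_U x]) (rule \<omega>_skew)
    then show ?thesis
      using dd_linear[OF bounded_linear_minus[OF bounded_linear_ident] differentiable_\<omega>[OF x]] by simp
  qed
  moreover have "\<omega> x v d f * \<omega> x u f c = \<omega> x u c f * \<omega> x v f d" for u v f
    using \<omega>_skew[OF x, of v d f] \<omega>_skew[OF x, of u c f] by simp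
  ultimately show "curv_form x u v d c = - curv_form x u v c d"
    by (simp add: curv_form_def sum_subtractf)
qed

lemma riemann_bianchi:
  assumes x: "x \<in> U"
  shows "riemann M i x u v w + riemann M i x v w u + riemann M i x w u v = 0"
proof -
  have "dd (\<lambda>y. \<Gamma> y a b) x c = dd (\<lambda>y. \<Gamma> y b a) x c" for a b c
    by (rule dd_cong_open[OF open_U x christoffel_sym])
  then show ?thesis
    using christoffel_sym[OF x, of u v] christoffel_sym[OF x, of v w] christoffel_sym[OF x, of u w]
    by (simp add: riemann_def)
qed

lemma curv_form_bianchi:
  assumes x: "x \<in> U"
  shows "curv_form x (e x a) (e x b) c d + curv_form x (e x b) (e x c) a d + curv_form x (e x c) (e x a) b d = 0"
  unfolding riemann_frame[OF x, symmetric] g_simps[OF x, symmetric] riemann_bianchi[OF x]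
  using linear_0[OF linear_g_left[OF x]] .

lemma linear_riemann:
  assumes x: "x \<in> U"
  shows "linear (\<lambda>u. riemann M i x u v w)" "linear (\<lambda>v. riemann M i x u v w)" "linear (\<lambda>w. riemann M i x u v w)"
proof -
  have 1: "linear (\<lambda>u. dd (\<lambda>y. \<Gamma> y v w) x u)" for v w
    by (rule linear_dd[OF differentiable_christoffel[OF x]])
  have 2: "linear (\<lambda>v. dd (\<lambda>y. \<Gamma> y v w) x u)" for u w
    by (rule linear_dd_family[where B = "\<lambda>y v. \<Gamma> y v w", OF open_U linear_christoffel_left x differentiable_christoffel[OF x]])
  have 3: "linear (\<lambda>w. dd (\<lambda>y. \<Gamma> y v w) x u)" for u v
    by (rule linear_dd_family[where B = "\<lambda>y w. \<Gamma> y v w", OF open_U linear_christoffel_right x differentiable_christoffel[OF x]])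
  have 4: "linear (\<lambda>w. \<Gamma> x u (\<Gamma> x v w))" "linear (\<lambda>v. \<Gamma> x u (\<Gamma> x v w))" for u v w
    using linear_compose[OF linear_christoffel_right[OF x] linear_christoffel_right[OF x]]
      linear_compose[OF linear_christoffel_left[OF x] linear_christoffel_right[OF x]] by (simp_all add: o_def)
  show "linear (\<lambda>u. riemann M i x u v w)"
    unfolding riemann_def by (intro linear_compose_sub linear_compose_add 1 2 4 linear_christoffel_left x)
  show "linear (\<lambda>v. riemann M i x u v w)"
    unfolding riemann_def by (intro linear_compose_sub linear_compose_add 1 2 4 linear_christoffel_left x)
  show "linear (\<lambda>w. riemann M i x u v w)"
    unfolding riemann_def by (intro linear_compose_sub linear_compose_add 3 4)
qed

text \<open>Both contractions, the trace in \<open>ricci\<close> and the one with the inverse Gram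
  matrix, are changed from the coordinate basis to the frame.\<close>

lemma scal_frame:
  assumes x: "x \<in> U"
  shows "scal M i x = (\<Sum>a\<in>UNIV. \<Sum>b\<in>UNIV. curv_form x (e x a) (e x b) b a)"
proof -
  have ricci: "ricci M i x v w = (\<Sum>a\<in>UNIV. g x (riemann M i x (e x a) v w) (e x a))" for v w
  proof -
    have "ricci M i x v w = (\<Sum>k\<in>UNIV. \<Sum>a\<in>UNIV. riemann M i x (e x a) v w $ k * g x (axis k 1) (e x a))"
      unfolding ricci_def
      by (subst linear_frame_expand[OF x linear_riemann(1)[OF x]]) (simp add: mult.commute)
    also have "\<dots> = (\<Sum>a\<in>UNIV. g x (\<Sum>k\<in>UNIV. riemann M i x (e x a) v w $ k *\<^sub>R axis k 1) (e x a))"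
      by (subst sum.swap) (simp add: g_simps[OF x])
    finally show ?thesis by (simp add: axis_expand)
  qed
  have lin: "linear (\<lambda>v. ricci M i x v w)" "linear (ricci M i x v)" for v w
    unfolding ricci_def
    by (intro linear_compose_sum ballI linear_compose[OF linear_riemann(2)[OF x] bounded_linear.linear[OF bounded_linear_vec_nth], unfolded o_def]
      linear_compose[OF linear_riemann(3)[OF x] bounded_linear.linear[OF bounded_linear_vec_nth], unfolded o_def])+
  have "scal M i x = (\<Sum>k\<in>UNIV. \<Sum>l\<in>UNIV. \<Sum>b\<in>UNIV. e x b $ k * (e x b $ l * ricci M i x (axis k 1) (axis l 1)))"
    by (simp add: scal_def gram_inverse(2)[OF x] sum_distrib_right mult.assoc)
  also have "\<dots> = (\<Sum>b\<in>UNIV. \<Sum>k\<in>UNIV. \<Sum>l\<in>UNIV. e x b $ k * (e x b $ l * ricci M i x (axis k 1) (axis l 1)))"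
    by (rule sum_rotate3)
  also have "\<dots> = (\<Sum>b\<in>UNIV. ricci M i x (e x b) (e x b))"
  proof (rule sum.cong[OF refl])
    fix b
    have "ricci M i x (e x b) (e x b) = ricci M i x (\<Sum>k\<in>UNIV. e x b $ k *\<^sub>R axis k 1) (\<Sum>k\<in>UNIV. e x b $ k *\<^sub>R axis k 1)"
      by (simp add: axis_expand)
    also have "\<dots> = (\<Sum>k\<in>UNIV. \<Sum>l\<in>UNIV. e x b $ k * (e x b $ l * ricci M i x (axis k 1) (axis l 1)))"
      by (simp add: linear_sum[OF lin(1)] linear_sum[OF lin(2)] linear_cmul[OF lin(1)] linear_cmul[OF lin(2)] sum_distrib_left)
        (subst sum.swap, simp add: mult.left_commute)
    finally show "(\<Sum>k\<in>UNIV. \<Sum>l\<in>UNIV. e x b $ k * (e x b $ l * ricci M i x (axis k 1) (axis l 1))) = ricci M i x (e x b) (e x b)" ..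
  qed
  finally show ?thesis
    by (subst sum.swap) (simp add: ricci riemann_frame[OF x])
qed

subsection \<open>The spinor connection\<close>

definition \<gamma> :: "'n \<Rightarrow> 'm cvec endo" where
  "\<gamma> a = Endo (\<lambda>\<phi>. cliff M (axis a 1) *v \<phi>)"

lemma act_\<gamma>: "act (\<gamma> a) \<phi> = cliff M (axis a 1) *v \<phi>"
  unfolding \<gamma>_def by (subst Endo_inverse) (simp_all add: matrix_vector_mul_linear)

lemma cliff_square: "cliff M v ** cliff M v = - (v \<bullet> v) *\<^sub>R mat 1"
  and linear_cliff: "linear (cliff M)"
  using spin by (auto simp: oriented_riemannian_spin_manifold_def clifford_module_def)

lemma scaleR_matrix_vector: "(r *\<^sub>R A) *v \<phi> = r *\<^sub>R (A *v \<phi>)" for A :: "complex ^ 'k::finite ^ 'l::finite"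
  by (simp add: matrix_vector_mult_def vec_eq_iff scaleR_sum_right)

lemma clifford_\<gamma>: "\<gamma> a * \<gamma> b + \<gamma> b * \<gamma> a = (if a = b then - 2 else 0)"
proof -
  define v where "v = (axis a 1 :: 'n rvec)"
  define w where "w = (axis b 1 :: 'n rvec)"
  have sq: "cliff M z *v (cliff M z *v \<phi>) = - (z \<bullet> z) *\<^sub>R \<phi>" for z \<phi>
    by (simp only: matrix_vector_mul_assoc cliff_square scaleR_matrix_vector matrix_vector_mul_lid)
  have "cliff M v *v (cliff M w *v \<phi>) + cliff M w *v (cliff M v *v \<phi>) = - (2 * (v \<bullet> w)) *\<^sub>R \<phi>" for \<phi>
  proof -
    have "cliff M (v + w) *v (cliff M (v + w) *v \<phi>) = cliff M v *v (cliff M v *v \<phi>) + cliff M w *v (cliff M w *v \<phi>)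
       + (cliff M v *v (cliff M w *v \<phi>) + cliff M w *v (cliff M v *v \<phi>))"
      by (simp add: linear_add[OF linear_cliff] matrix_vector_mult_add_rdistrib matrix_vector_right_distrib)
    then show ?thesis
      unfolding sq by (simp add: inner_add_left inner_add_right inner_commute algebra_simps scaleR_2)
  qed
  moreover have "v \<bullet> w = (if a = b then 1 else 0)"
    by (simp add: v_def w_def inner_axis_axis)
  ultimately have "act (\<gamma> a * \<gamma> b + \<gamma> b * \<gamma> a) \<phi> = act (of_real (if a = b then - 2 else 0)) \<phi>" for \<phi>
    by (simp add: act_simps act_\<gamma> act_of_real v_def w_def)
  then have "\<gamma> a * \<gamma> b + \<gamma> b * \<gamma> a = of_real (if a = b then - 2 else 0)"
    by (simp add: act_inject[symmetric] fun_eq_iff)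
  then show ?thesis by (simp split: if_splits)
qed

sublocale clifford_generators \<gamma>
  by unfold_locales (rule clifford_\<gamma>)

text \<open>In the frame the operators \<gamma> a are constant; the dependence on the point sits in
  the real coefficients, and only these have to be differentiated.\<close>

definition clif :: "'n rvec \<Rightarrow> 'n rvec \<Rightarrow> 'm cvec endo" where
  "clif x u = (\<Sum>a\<in>UNIV. g x u (e x a) *\<^sub>R \<gamma> a)"

lemma cmul_eq: "cmul M i x u \<phi> = act (clif x u) \<phi>"
proof -
  have "frame_coords M i x u = (\<Sum>a\<in>UNIV. g x u (e x a) *\<^sub>R axis a 1)"
    using axis_expand[of "frame_coords M i x u"] by (simp add: frame_coords_def)
  then have "cliff M (frame_coords M i x u) = (\<Sum>a\<in>UNIV. g x u (e x a) *\<^sub>R cliff M (axis a 1))"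
    by (simp add: linear_sum[OF linear_cliff] linear_cmul[OF linear_cliff])
  moreover have "sum A I *v \<phi> = (\<Sum>i\<in>I. A i *v \<phi>)" for A :: "'n \<Rightarrow> ('m cvec, 'm) vec" and I
    by (induction I rule: infinite_finite_induct) (auto simp: matrix_vector_mult_add_rdistrib)
  ultimately show ?thesis
    by (simp add: cmul_def clif_def act_sum act_simps act_\<gamma> scaleR_matrix_vector)
qed

lemma clif_frame: "x \<in> U \<Longrightarrow> clif x (e x a) = \<gamma> a"
proof -
  assume x: "x \<in> U"
  have "g x (e x a) (e x b) *\<^sub>R \<gamma> b = (if b = a then \<gamma> a else 0)" for b
    by (simp add: orthonormal[OF x])
  then show ?thesis by (simp add: clif_def)
qed

lemma cmul_frame: "x \<in> U \<Longrightarrow> cmul M i x (e x a) \<phi> = act (\<gamma> a) \<phi>"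
  by (simp add: cmul_eq clif_frame)

lemma linear_clif: "x \<in> U \<Longrightarrow> linear (clif x)"
  unfolding clif_def by (rule linearI) (simp_all add: g_simps scaleR_left_distrib sum.distrib scaleR_sum_right)

text \<open>The factor is 1/4 where \<open>nabla_g\<close> has 1/2, since \<open>bivector\<close>
  counts each pair of indices twice.\<close>

definition spin_form :: "'n rvec \<Rightarrow> 'n rvec \<Rightarrow> 'm cvec endo" where
  "spin_form x u = (1 / 4) *\<^sub>R bivector (\<omega> x u)"

definition nab :: "('n rvec \<Rightarrow> 'm cvec) \<Rightarrow> 'n rvec \<Rightarrow> 'n rvec \<Rightarrow> 'm cvec" where
  "nab f x u = dd f x u + act (spin_form x u) (f x)"

lemma bivector_ordered:
  assumes skew: "\<And>a b. \<Omega> b a = - \<Omega> a b"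
  shows "(\<Sum>(a, b)\<in>{(a, b). a < b}. \<Omega> a b *\<^sub>R (\<gamma> a * \<gamma> b)) = (1 / 2) *\<^sub>R bivector \<Omega>"
proof -
  have diag: "\<Omega> a a = 0" for a using skew[of a a] by simp
  have "\<Omega> b a *\<^sub>R (\<gamma> b * \<gamma> a) = \<Omega> a b *\<^sub>R (\<gamma> a * \<gamma> b)" for a b
    using diag by (subst skew) (cases "a = b", auto simp: generator_swap[of a b])
  then have "bivector \<Omega> = 2 *\<^sub>R (\<Sum>(a, b)\<in>{(a, b). a < b}. \<Omega> a b *\<^sub>R (\<gamma> a * \<gamma> b))"
    unfolding bivector_def by (rule sum_pairs_ordered) (simp add: diag)
  then show ?thesis by simp
qed

lemma nabla_g_eq: "x \<in> U \<Longrightarrow> nabla_g M \<psi> i x u = nab (\<psi> i) x u"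
proof -
  assume x: "x \<in> U"
  have "(\<Sum>(a, b)\<in>{(a, b). a < b}. \<omega> x u a b *\<^sub>R act (\<gamma> a) (act (\<gamma> b) (\<psi> i x)))
      = act (\<Sum>(a, b)\<in>{(a, b). a < b}. \<omega> x u a b *\<^sub>R (\<gamma> a * \<gamma> b)) (\<psi> i x)"
    by (simp add: act_sum act_simps case_prod_unfold)
  also have "\<dots> = act ((1 / 2) *\<^sub>R bivector (\<omega> x u)) (\<psi> i x)"
    by (subst bivector_ordered[OF \<omega>_skew[OF x]]) simp
  finally show ?thesis
    by (simp add: nabla_g_def Let_def nab_def spin_form_def cmul_frame[OF x] \<omega>_def cov_frame_def act_simps)
qed

lemma spin_form_\<gamma>:
  assumes "x \<in> U"
  shows "spin_form x u * \<gamma> a - \<gamma> a * spin_form x u = (\<Sum>b\<in>UNIV. \<omega> x u a b *\<^sub>R \<gamma> b)"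
proof -
  have "spin_form x u * \<gamma> a - \<gamma> a * spin_form x u = (1 / 4) *\<^sub>R (bivector (\<omega> x u) * \<gamma> a - \<gamma> a * bivector (\<omega> x u))"
    by (simp add: spin_form_def scaleR_diff_right)
  then show ?thesis by (simp add: bivector_commutator[OF \<omega>_skew[OF assms]])
qed

lemma smooth_spin_form: "smooth_on U f \<Longrightarrow> smooth_on U (\<lambda>y. act (spin_form y u) (f y))"
  unfolding spin_form_def bivector_def act_simps act_sum
  by (intro smooth_on_scaleR_const smooth_on_sum smooth_on_scaleR smooth_\<omega> smooth_on_linear[OF bounded_linear_act] open_U)

lemma smooth_nab: "smooth_on U f \<Longrightarrow> smooth_on U (\<lambda>y. nab f y u)"
  unfolding nab_def by (intro smooth_on_add smooth_on_dd smooth_spin_form open_U)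

lemma linear_nab:
  assumes "x \<in> U" "f differentiable (at x)"
  shows "linear (nab f x)"
  by (rule linearI)
    (simp_all add: nab_def spin_form_def bivector_def act_simps act_sum linear_add[OF linear_dd[OF assms(2)]]
      linear_cmul[OF linear_dd[OF assms(2)]] linear_add[OF linear_\<omega>[OF assms(1)]] linear_cmul[OF linear_\<omega>[OF assms(1)]]
      scaleR_left_distrib scaleR_right_distrib sum.distrib scaleR_sum_right mult.left_commute)

text \<open>The Leibniz rule for an operator field. It is applied to \<gamma> a, \<open>clif\<close>
  and \<open>tor_op\<close>, where the last bracket is the covariant derivative of the
  operator.\<close>

lemma nab_operator:
  assumes "operator_derivative \<Theta> x D" "f differentiable (at x)"
  shows "nab (\<lambda>y. act (\<Theta> y) (f y)) x u
    = act (\<Theta> x) (nab f x u) + act (D u + (spin_form x u * \<Theta> x - \<Theta> x * spin_form x u)) (f x)"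
  by (simp add: nab_def dd_operator[OF assms] act_simps act_vec)

lemma nab_\<gamma>:
  assumes "x \<in> U" "f differentiable (at x)"
  shows "nab (\<lambda>y. act (\<gamma> a) (f y)) x u = act (\<gamma> a) (nab f x u) + (\<Sum>b\<in>UNIV. \<omega> x u a b *\<^sub>R act (\<gamma> b) (f x))"
  using nab_operator[OF operator_derivative_const assms(2), of "\<gamma> a" u]
  by (simp add: spin_form_\<gamma>[OF assms(1)] act_sum act_simps)

text \<open>Clifford multiplication is parallel: the commutator with \<open>spin_form\<close> undoes
  the rotation of the frame in which \<open>w\<close> is expanded, and what is left is \<Gamma> x u
  w, the covariant derivative of the coordinate-constant field \<open>w\<close>.\<close>

lemma nab_clif:
  assumes x: "x \<in> U" and f: "f differentiable (at x)"
  shows "nab (\<lambda>y. act (clif y w) (f y)) x u = act (clif x w) (nab f x u) + act (clif x (\<Gamma> x u w)) (f x)"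
proof -
  have D: "dd (\<lambda>y. g y w (e y a)) x u = g x (\<Gamma> x u w) (e x a) + (\<Sum>d\<in>UNIV. \<omega> x u a d * g x w (e x d))" for a u
  proof -
    have "dd (\<lambda>y. g y w (e y a)) x u = g x (\<Gamma> x u w) (e x a) + g x w (cov_frame x u a)"
      using dd_g_fields(2)[OF x differentiable_const differentiable_e[OF x], of w a u]
      by (simp add: dd_const cov_frame_def)
    then show ?thesis
      by (simp add: cov_frame_expand[OF x] g_simps[OF x])
  qed
  have diff: "(\<lambda>y. g y w (e y a)) differentiable (at x)" for a
    by (rule dd_g_fields(1)[OF x differentiable_const differentiable_e[OF x]])
  have od: "operator_derivative (\<lambda>y. clif y w) x (\<lambda>u. \<Sum>a\<in>UNIV. dd (\<lambda>y. g y w (e y a)) x u *\<^sub>R \<gamma> a)"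
    unfolding clif_def by (intro operator_derivative_sum operator_derivative_scaleR diff)
  have "spin_form x u * clif x w - clif x w * spin_form x u = (\<Sum>a\<in>UNIV. g x w (e x a) *\<^sub>R (\<Sum>b\<in>UNIV. \<omega> x u a b *\<^sub>R \<gamma> b))"
    unfolding spin_form_\<gamma>[OF x, symmetric]
    by (simp add: clif_def sum_distrib_left sum_distrib_right sum_subtractf scaleR_diff_right)
  also have "\<dots> = (\<Sum>b\<in>UNIV. \<Sum>a\<in>UNIV. (\<omega> x u a b * g x w (e x a)) *\<^sub>R \<gamma> b)"
    by (subst sum.swap) (simp add: scaleR_sum_right mult.commute)
  also have "\<dots> = - (\<Sum>b\<in>UNIV. (\<Sum>a\<in>UNIV. \<omega> x u b a * g x w (e x a)) *\<^sub>R \<gamma> b)"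
    by (subst \<omega>_skew[OF x]) (simp add: sum_negf scaleR_sum_left)
  finally have "(\<Sum>a\<in>UNIV. dd (\<lambda>y. g y w (e y a)) x u *\<^sub>R \<gamma> a) + (spin_form x u * clif x w - clif x w * spin_form x u)
      = clif x (\<Gamma> x u w)"
    by (simp add: D scaleR_left_distrib sum.distrib clif_def)
  then show ?thesis by (simp add: nab_operator[OF od f])
qed

subsection \<open>The Lichnerowicz formula\<close>

text \<open>The second covariant derivative. \<open>w\<close> is extended constantly in the chart,
  and the subtracted term compensates for this choice of extension.\<close>

definition hess :: "('n rvec \<Rightarrow> 'm cvec) \<Rightarrow> 'n rvec \<Rightarrow> 'n rvec \<Rightarrow> 'n rvec \<Rightarrow> 'm cvec" where
  "hess f x u w = nab (\<lambda>y. nab f y w) x u - nab f x (\<Gamma> x u w)"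

text \<open>Christoffel terms and second partial derivatives cancel by symmetry. The exterior
  derivative of \<open>spin_form\<close> plus the commutator of its values remains, and
  \<open>bivector_commutator_bivector\<close> identifies it with the structure equation.\<close>

lemma hess_commutator:
  assumes x: "x \<in> U" and f: "smooth_on U f"
  shows "hess f x u w - hess f x w u = act ((1 / 4) *\<^sub>R bivector (curv_form x u w)) (f x)"
proof -
  define dA where "dA u w = (1 / 4) *\<^sub>R bivector (\<lambda>c d. dd (\<lambda>y. \<omega> y w c d) x u)" for u w
  have fd: "f differentiable (at x)" by (rule smooth_on_differentiable[OF f x])
  have od: "operator_derivative (\<lambda>y. spin_form y w) x (\<lambda>u. dA u w)" for w
    unfolding spin_form_def dA_def bivector_def
    by (intro operator_derivative_scaleR_const operator_derivative_sum operator_derivative_scaleR differentiable_\<omega> x)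
  have ddn: "dd (\<lambda>y. nab f y w) x u = dd (\<lambda>y. dd f y w) x u + (act (spin_form x w) (dd f x u) + act (dA u w) (f x))" for u w
    unfolding nab_def
    by (subst dd_add)
      (auto intro: smooth_on_differentiable[OF smooth_on_dd[OF f] x] smooth_on_differentiable[OF smooth_spin_form[OF f] x]
        simp: dd_operator[OF od fd])
  have sym: "dd (\<lambda>y. dd f y w) x u = dd (\<lambda>y. dd f y u) x w"
    by (rule second_derivative_symmetric[OF f open_U x])
  have "hess f x u w - hess f x w u
      = act (dA u w - dA w u + (spin_form x u * spin_form x w - spin_form x w * spin_form x u)) (f x)"
  proof -
    have "nab (\<lambda>y. nab f y w) x u = dd (\<lambda>y. nab f y w) x u + act (spin_form x u) (nab f x w)" for u w
      by (rule nab_def)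
    then have n: "nab (\<lambda>y. nab f y w) x u = dd (\<lambda>y. dd f y w) x u + (act (spin_form x w) (dd f x u) + act (dA u w) (f x))
        + (act (spin_form x u) (dd f x w) + act (spin_form x u * spin_form x w) (f x))" for u w
      by (simp only: ddn) (simp add: nab_def act_vec act_simps)
    show ?thesis
      unfolding hess_def christoffel_sym[OF x, of u w] n sym by (simp add: act_simps algebra_simps)
  qed
  also have "spin_form x u * spin_form x w - spin_form x w * spin_form x u
      = (1 / 16) *\<^sub>R (bivector (\<omega> x u) * bivector (\<omega> x w) - bivector (\<omega> x w) * bivector (\<omega> x u))"
    by (simp add: spin_form_def scaleR_diff_right)
  also have "\<dots> = (1 / 4) *\<^sub>R bivector (\<lambda>a b. \<Sum>f\<in>UNIV. \<omega> x w a f * \<omega> x u f b - \<omega> x u a f * \<omega> x w f b)"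
    by (simp add: bivector_commutator_bivector[OF \<omega>_skew[OF x]])
  also have "dA u w - dA w u + \<dots> = (1 / 4) *\<^sub>R bivector (curv_form x u w)"
    by (simp add: dA_def bivector_def curv_form_def scaleR_left_distrib scaleR_left_diff_distrib
        sum.distrib sum_subtractf scaleR_diff_right scaleR_right_distrib)
  finally show ?thesis .
qed

definition Dir :: "('n rvec \<Rightarrow> 'm cvec) \<Rightarrow> 'n rvec \<Rightarrow> 'm cvec" where
  "Dir f x = (\<Sum>a\<in>UNIV. act (\<gamma> a) (nab f x (e x a)))"

lemma nab_sum:
  assumes "\<And>a. a \<in> I \<Longrightarrow> h a differentiable (at x)"
  shows "nab (\<lambda>y. \<Sum>a\<in>I. h a y) x u = (\<Sum>a\<in>I. nab (h a) x u)"
  by (simp add: nab_def dd_sum[OF assms] act_vec sum.distrib)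

lemma smooth_nab_frame:
  assumes f: "smooth_on U f"
  shows "smooth_on U (\<lambda>y. nab f y (e y a))"
  by (rule smooth_linear_family[where B = "\<lambda>y w. nab f y w", OF open_U linear_nab smooth_nab[OF f] smooth_e])
    (use f smooth_on_differentiable in blast)+

lemma smooth_Dir: "smooth_on U f \<Longrightarrow> smooth_on U (Dir f)"
  unfolding Dir_def by (intro smooth_on_sum smooth_on_linear[OF bounded_linear_act] open_U smooth_nab_frame)

text \<open>The motion of the frame enters twice, through \<gamma> a and through the direction
  \<open>e x a\<close>. The two contributions cancel because \<omega> is skew, so the frame behaves
  as if it were parallel at the point.\<close>

lemma nab_Dir:
  assumes x: "x \<in> U" and f: "smooth_on U f"
  shows "nab (Dir f) x u = (\<Sum>a\<in>UNIV. act (\<gamma> a) (hess f x u (e x a)))"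
proof -
  have fd: "y \<in> U \<Longrightarrow> f differentiable (at y)" for y by (rule smooth_on_differentiable[OF f])
  have hd: "(\<lambda>y. nab f y (e y a)) differentiable (at x)" for a
    by (rule smooth_on_differentiable[OF smooth_nab_frame[OF f] x])
  have "nab (\<lambda>y. nab f y (e y a)) x u = hess f x u (e x a) + (\<Sum>b\<in>UNIV. \<omega> x u a b *\<^sub>R nab f x (e x b))" for a
  proof -
    have "dd (\<lambda>y. nab f y (e y a)) x u = dd (\<lambda>y. nab f y (e x a)) x u + nab f x (dd (\<lambda>y. e y a) x u)"
      by (rule dd_linear_family(2)[where B = "\<lambda>y w. nab f y w", OF open_U linear_nab x smooth_on_differentiable[OF smooth_nab[OF f] x] differentiable_e[OF x]])
        (auto intro: fd)
    then have "nab (\<lambda>y. nab f y (e y a)) x u = hess f x u (e x a) + nab f x (cov_frame x u a)"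
      by (simp add: hess_def nab_def[of "\<lambda>y. nab f y _"] nab_def[of "\<lambda>y. nab f y (e y a)"] cov_frame_def
          linear_add[OF linear_nab[OF x fd[OF x]]])
    then show ?thesis
      by (simp add: cov_frame_expand[OF x] linear_sum[OF linear_nab[OF x fd[OF x]]] linear_cmul[OF linear_nab[OF x fd[OF x]]])
  qed
  then have "nab (Dir f) x u = (\<Sum>a\<in>UNIV. act (\<gamma> a) (hess f x u (e x a)))
      + ((\<Sum>a\<in>UNIV. \<Sum>b\<in>UNIV. \<omega> x u a b *\<^sub>R act (\<gamma> a) (nab f x (e x b)))
      + (\<Sum>a\<in>UNIV. \<Sum>b\<in>UNIV. \<omega> x u a b *\<^sub>R act (\<gamma> b) (nab f x (e x a))))"
    unfolding Dir_def
    by (subst nab_sum)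
      (auto simp: nab_\<gamma>[OF x hd] act_vec sum.distrib
        intro!: smooth_on_differentiable[OF _ x] smooth_on_linear[OF bounded_linear_act] open_U smooth_nab_frame f)
  also have "(\<Sum>a\<in>UNIV. \<Sum>b\<in>UNIV. \<omega> x u a b *\<^sub>R act (\<gamma> a) (nab f x (e x b)))
      = - (\<Sum>a\<in>UNIV. \<Sum>b\<in>UNIV. \<omega> x u a b *\<^sub>R act (\<gamma> b) (nab f x (e x a)))"
    by (subst sum.swap, subst \<omega>_skew[OF x]) (simp add: sum_negf)
  finally show ?thesis by simp
qed

text \<open>Twice the double sum is split into anticommutators of generators, which leave minus the
  trace of the Hessian, and products of generators with the skew part of the Hessian, which
  \<open>bivector_curvature\<close> evaluates to the scalar curvature.\<close>

theorem Lichnerowicz: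
  assumes x: "x \<in> U" and f: "smooth_on U f"
  shows "Dir (Dir f) x = - (\<Sum>a\<in>UNIV. hess f x (e x a) (e x a)) + (scal M i x / 4) *\<^sub>R f x"
proof -
  define h where "h a b = hess f x (e x a) (e x b)" for a b
  define L where "L = (\<Sum>a\<in>UNIV. h a a)"
  have 1: "Dir (Dir f) x = (\<Sum>a\<in>UNIV. \<Sum>b\<in>UNIV. act (\<gamma> a * \<gamma> b) (h a b))"
    by (simp add: Dir_def[of "Dir f"] nab_Dir[OF x f] act_vec act_simps h_def)
  have "2 *\<^sub>R Dir (Dir f) x = (\<Sum>a\<in>UNIV. \<Sum>b\<in>UNIV. act (\<gamma> a * \<gamma> b) (h a b)) + (\<Sum>a\<in>UNIV. \<Sum>b\<in>UNIV. act (\<gamma> b * \<gamma> a) (h b a))"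
    unfolding scaleR_2 1 by (subst (2) sum.swap) (rule refl)
  also have "\<dots> = (\<Sum>a\<in>UNIV. \<Sum>b\<in>UNIV. act (\<gamma> a * \<gamma> b + \<gamma> b * \<gamma> a) (h b a)) + (\<Sum>a\<in>UNIV. \<Sum>b\<in>UNIV. act (\<gamma> a * \<gamma> b) (h a b - h b a))"
    by (simp add: act_simps act_vec sum.distrib sum_subtractf)
  also have "(\<Sum>a\<in>UNIV. \<Sum>b\<in>UNIV. act (\<gamma> a * \<gamma> b + \<gamma> b * \<gamma> a) (h b a)) = - 2 *\<^sub>R L"
  proof -
    have "act (\<gamma> a * \<gamma> b + \<gamma> b * \<gamma> a) (h b a) = (if b = a then - 2 *\<^sub>R h a a else 0)" for a b
      using act_of_real[of "-2" "h a a"] unfolding clifford_\<gamma> by (simp add: act_simps)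
    then show ?thesis by (simp add: L_def scaleR_sum_right sum_negf)
  qed
  also have "(\<Sum>a\<in>UNIV. \<Sum>b\<in>UNIV. act (\<gamma> a * \<gamma> b) (h a b - h b a))
      = act ((1 / 4) *\<^sub>R (\<Sum>a\<in>UNIV. \<Sum>b\<in>UNIV. \<gamma> a * \<gamma> b * bivector (curv_form x (e x a) (e x b)))) (f x)"
    by (simp add: h_def hess_commutator[OF x f] act_simps act_sum act_vec scaleR_sum_right)
  also have "\<dots> = (scal M i x / 2) *\<^sub>R f x"
    by (subst bivector_curvature[OF curv_form_skew[OF x] curv_form_bianchi[OF x]])
      (simp only: act_simps act_of_real scal_frame[OF x], simp)
  finally have "2 *\<^sub>R Dir (Dir f) x = 2 *\<^sub>R (- L + (scal M i x / 4) *\<^sub>R f x)"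
    by (simp add: scaleR_diff_right)
  then show ?thesis by (simp only: scaleR_cancel_left L_def h_def) simp
qed

end

section \<open>Parallel torsion\<close>

locale spin_chart_torsion = spin_chart M i
  for M :: "('p, 'i, 'n::{finite,linorder}, 'm::finite) spin_data" and i :: 'i +
  fixes T :: "('i, 'n) form3"
  assumes three_form: "three_form M T" and parallel: "parallel_torsion M T"
begin

lemma smooth_T: "smooth_on U (\<lambda>x. T i x u v w)"
  using three_form chart by (simp add: three_form_def)

lemma linear_T1: "x \<in> U \<Longrightarrow> linear (\<lambda>u. T i x u v w)"
  using three_form chart unfolding three_form_def by blast

lemma T_skew:
  assumes "x \<in> U"
  shows "T i x v u w = - T i x u v w" and "T i x u w v = - T i x u v w"
  using three_form chart assms unfolding three_form_def by blast+

lemma linear_T2: "x \<in> U \<Longrightarrow> linear (\<lambda>v. T i x u v w)"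
  using linear_compose_neg[OF linear_T1, of x u w] by (subst T_skew(1)) simp_all

lemma linear_T3:
  assumes "x \<in> U"
  shows "linear (T i x u v)"
proof -
  have "T i x u v = (\<lambda>w. - T i x u w v)"
    by (intro ext T_skew(2) assms)
  then show ?thesis using linear_compose_neg[OF linear_T2[OF assms]] by simp
qed

definition tor :: "'n rvec \<Rightarrow> 'n \<Rightarrow> 'n \<Rightarrow> 'n \<Rightarrow> real" where
  "tor x a b c = T i x (e x a) (e x b) (e x c)"

definition tor_op :: "'n rvec \<Rightarrow> 'm cvec endo" where
  "tor_op x = (1 / 6) *\<^sub>R trivector (tor x)"

lemma clifford_three_form: "x \<in> U \<Longrightarrow> clifford_three_form \<gamma> (tor x)"
  unfolding tor_def[abs_def] by unfold_locales (rule T_skew(1), assumption, rule T_skew(2))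

lemma tor_op_eq: "x \<in> U \<Longrightarrow> clifford_three_form.\<theta> \<gamma> (tor x) = tor_op x"
  by (simp add: clifford_three_form.\<theta>_def[OF clifford_three_form] tor_op_def)

lemma contraction_eq:
  assumes x: "x \<in> U"
  shows "bivector (\<lambda>a b. T i x u (e x a) (e x b)) = - (clif x u * tor_op x + tor_op x * clif x u)"
proof -
  interpret C: clifford_three_form \<gamma> "tor x" by (rule clifford_three_form[OF x])
  have k: "bivector (tor x k) = - (\<gamma> k * tor_op x + tor_op x * \<gamma> k)" for k
    using C.generator_anticommutator[of k] by (simp add: C.\<iota>_def tor_op_eq[OF x])
  have "T i x u (e x a) (e x b) = (\<Sum>k\<in>UNIV. g x u (e x k) * tor x k a b)" for a b
    by (simp add: linear_frame_expand[OF x linear_T1[OF x], of u] tor_def)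
  then have "bivector (\<lambda>a b. T i x u (e x a) (e x b))
      = (\<Sum>a\<in>UNIV. \<Sum>b\<in>UNIV. \<Sum>k\<in>UNIV. (g x u (e x k) * tor x k a b) *\<^sub>R (\<gamma> a * \<gamma> b))"
    by (simp add: bivector_def scaleR_sum_left)
  also have "\<dots> = (\<Sum>k\<in>UNIV. \<Sum>a\<in>UNIV. \<Sum>b\<in>UNIV. (g x u (e x k) * tor x k a b) *\<^sub>R (\<gamma> a * \<gamma> b))"
    by (rule sum_rotate3)
  also have "\<dots> = (\<Sum>k\<in>UNIV. g x u (e x k) *\<^sub>R bivector (tor x k))"
    by (simp add: bivector_def scaleR_sum_right)
  also have "\<dots> = - (clif x u * tor_op x + tor_op x * clif x u)"
    unfolding k by (simp add: clif_def sum_distrib_left sum_distrib_right sum.distrib scaleR_right_distrib scaleR_diff_right sum_subtractf sum_negf)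
  finally show ?thesis .
qed

lemma cmul2_eq:
  assumes x: "x \<in> U"
  shows "cmul2 M i x (T i x u) \<phi> = - (1 / 2) *\<^sub>R act (clif x u * tor_op x + tor_op x * clif x u) \<phi>"
proof -
  have "cmul2 M i x (T i x u) \<phi> = act (\<Sum>(a, b)\<in>{(a, b). a < b}. T i x u (e x a) (e x b) *\<^sub>R (\<gamma> a * \<gamma> b)) \<phi>"
    by (simp add: cmul2_def Let_def cmul_frame[OF x] act_sum act_simps case_prod_unfold)
  also have "\<dots> = act ((1 / 2) *\<^sub>R bivector (\<lambda>a b. T i x u (e x a) (e x b))) \<phi>"
    by (subst bivector_ordered[where \<Omega> = "\<lambda>a b. T i x u (e x a) (e x b)", OF T_skew(2)[OF x]]) (rule refl)
  finally show ?thesis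
    by (simp add: contraction_eq[OF x] act_simps scaleR_right_distrib scaleR_diff_right)
qed

lemma tor_diag: "x \<in> U \<Longrightarrow> tor x a a c = 0" "x \<in> U \<Longrightarrow> tor x a b b = 0"
  using T_skew(1)[of x "e x a" "e x a" "e x c"] T_skew(2)[of x "e x a" "e x b" "e x b"] by (auto simp: tor_def)

lemma tor_skew: "x \<in> U \<Longrightarrow> tor x b a c = - tor x a b c" "x \<in> U \<Longrightarrow> tor x a c b = - tor x a b c"
  unfolding tor_def by (rule T_skew(1), assumption) (rule T_skew(2))

lemma cmul3_eq:
  assumes x: "x \<in> U"
  shows "cmul3 M i x (T i x) \<phi> = act (tor_op x) \<phi>"
proof -
  have f1: "tor x b a c *\<^sub>R (\<gamma> b * \<gamma> a * \<gamma> c) = tor x a b c *\<^sub>R (\<gamma> a * \<gamma> b * \<gamma> c)" for a b c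
    using tor_diag[OF x] by (subst tor_skew(1)[OF x]) (cases "a = b", auto simp: generator_swap[of a b])
  have f2: "tor x a c b *\<^sub>R (\<gamma> a * \<gamma> c * \<gamma> b) = tor x a b c *\<^sub>R (\<gamma> a * \<gamma> b * \<gamma> c)" for a b c
    using tor_diag[OF x] by (subst tor_skew(2)[OF x]) (cases "b = c", auto simp: generator_swap[of b c] mult.assoc)
  have "trivector (tor x) = 6 *\<^sub>R (\<Sum>(a, b, c)\<in>{(a, b, c). a < b \<and> b < c}. tor x a b c *\<^sub>R (\<gamma> a * \<gamma> b * \<gamma> c))"
    unfolding trivector_def by (rule sum_triples_ordered) (auto simp: f1 f2 tor_diag[OF x])
  then have "tor_op x = (\<Sum>(a, b, c)\<in>{(a, b, c). a < b \<and> b < c}. tor x a b c *\<^sub>R (\<gamma> a * \<gamma> b * \<gamma> c))"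
    by (simp add: tor_op_def)
  then show ?thesis
    by (simp add: cmul3_def Let_def cmul_frame[OF x] act_sum act_simps case_prod_unfold tor_def)
qed

lemma norm3_sq_eq:
  assumes x: "x \<in> U"
  shows "norm3_sq M T i x = clifford_three_form.N (tor x)"
proof -
  interpret C: clifford_three_form \<gamma> "tor x" by (rule clifford_three_form[OF x])
  have "(\<Sum>a\<in>UNIV. \<Sum>b\<in>UNIV. \<Sum>c\<in>UNIV. (tor x a b c)\<^sup>2) = 6 *\<^sub>R (\<Sum>(a, b, c)\<in>{(a, b, c). a < b \<and> b < c}. (tor x a b c)\<^sup>2)"
  proof (rule sum_triples_ordered)
    show "(tor x b a c)\<^sup>2 = (tor x a b c)\<^sup>2" "(tor x a c b)\<^sup>2 = (tor x a b c)\<^sup>2" for a b c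
      using tor_skew(1)[OF x, of b a c] tor_skew(2)[OF x, of a c b] by simp_all
  qed (simp add: tor_diag[OF x])
  then show ?thesis by (simp add: C.N_def norm3_sq_def Let_def tor_def)
qed

text \<open>The sorted sum is 1/24 of the full one, and the latter is 12 times a commutator for each
  frame vector, whence 1/2. The vector \<open>u\<close> enters linearly, so it can be expanded in
  the frame.\<close>

lemma cmul4_eq:
  assumes x: "x \<in> U"
  shows "cmul4 M i x (wedge3 M i x u (T i x)) \<phi> = (1 / 2) *\<^sub>R act (clif x u * tor_op x - tor_op x * clif x u) \<phi>"
proof -
  interpret C: clifford_three_form \<gamma> "tor x" by (rule clifford_three_form[OF x])
  define W where "W a b c d = wedge3 M i x u (T i x) (e x a) (e x b) (e x c) (e x d)" for a b c d
  have W: "W a b c d = g x u (e x a) * tor x b c d - g x u (e x b) * tor x a c d + g x u (e x c) * tor x a b d - g x u (e x d) * tor x a b c" for a b c d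
    by (simp add: W_def wedge3_def tor_def)
  have skew: "W b a c d = - W a b c d" "W a c b d = - W a b c d" "W a b d c = - W a b c d" for a b c d
    using tor_skew(1)[OF x, of b a c] tor_skew(1)[OF x, of b a d] tor_skew(1)[OF x, of c b d]
      tor_skew(2)[OF x, of a c b] tor_skew(2)[OF x, of a d c] tor_skew(2)[OF x, of b d c]
    by (simp_all add: W)
  have diag: "W a a c d = 0" "W a b b d = 0" "W a b c c = 0" for a b c d
    using skew(1)[of a a c d] skew(2)[of a b b d] skew(3)[of a b c c] by simp_all
  have f1: "W b a c d *\<^sub>R (\<gamma> b * \<gamma> a * \<gamma> c * \<gamma> d) = W a b c d *\<^sub>R (\<gamma> a * \<gamma> b * \<gamma> c * \<gamma> d)" for a b c d
    using diag by (subst skew(1)) (cases "a = b", auto simp: generator_swap[of a b])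
  have f2: "W a c b d *\<^sub>R (\<gamma> a * \<gamma> c * \<gamma> b * \<gamma> d) = W a b c d *\<^sub>R (\<gamma> a * \<gamma> b * \<gamma> c * \<gamma> d)" for a b c d
    using diag by (subst skew(2)) (cases "b = c", auto simp: generator_swap[of b c] mult.assoc[of "\<gamma> a"])
  have f3: "W a b d c *\<^sub>R (\<gamma> a * \<gamma> b * \<gamma> d * \<gamma> c) = W a b c d *\<^sub>R (\<gamma> a * \<gamma> b * \<gamma> c * \<gamma> d)" for a b c d
    using diag by (subst skew(3)) (cases "c = d", auto simp: generator_swap[of c d] mult.assoc)
  have "(\<Sum>a\<in>UNIV. \<Sum>b\<in>UNIV. \<Sum>c\<in>UNIV. \<Sum>d\<in>UNIV. W a b c d *\<^sub>R (\<gamma> a * \<gamma> b * \<gamma> c * \<gamma> d))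
     = 24 *\<^sub>R (\<Sum>(a, b, c, d)\<in>{(a, b, c, d). a < b \<and> b < c \<and> c < d}. W a b c d *\<^sub>R (\<gamma> a * \<gamma> b * \<gamma> c * \<gamma> d))"
    (is "?full = _")
    by (rule sum_quadruples_ordered) (auto simp: f1 f2 f3 diag)
  then have "cmul4 M i x (wedge3 M i x u (T i x)) \<phi> = act ((1 / 24) *\<^sub>R ?full) \<phi>"
    by (simp add: cmul4_def Let_def cmul_frame[OF x] act_sum act_simps case_prod_unfold W_def)
  also have "?full = (\<Sum>k\<in>UNIV. g x u (e x k) *\<^sub>R (12 *\<^sub>R (\<gamma> k * tor_op x - tor_op x * \<gamma> k)))"
  proof -
    define kd where "kd k a = (if k = a then 1 else 0::real)" for k a :: 'n
    have kd: "g x u (e x a) = (\<Sum>k\<in>UNIV. g x u (e x k) * kd k a)" for a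
      by (simp add: kd_def if_distrib cong: if_cong)
    have "W a b c d = (\<Sum>k\<in>UNIV. g x u (e x k) * (kd k a * tor x b c d - kd k b * tor x a c d + kd k c * tor x a b d - kd k d * tor x a b c))" for a b c d
      unfolding W by (subst kd[of a], subst kd[of b], subst kd[of c], subst kd[of d])
        (simp add: sum_distrib_right sum_subtractf sum.distrib right_diff_distrib distrib_left mult.assoc)
    then have "?full = (\<Sum>a\<in>UNIV. \<Sum>b\<in>UNIV. \<Sum>c\<in>UNIV. \<Sum>d\<in>UNIV. \<Sum>k\<in>UNIV. g x u (e x k) *\<^sub>R
        ((kd k a * tor x b c d - kd k b * tor x a c d + kd k c * tor x a b d - kd k d * tor x a b c) *\<^sub>R (\<gamma> a * \<gamma> b * \<gamma> c * \<gamma> d)))"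
      by (simp add: scaleR_sum_left)
    also have "\<dots> = (\<Sum>a\<in>UNIV. \<Sum>k\<in>UNIV. \<Sum>b\<in>UNIV. \<Sum>c\<in>UNIV. \<Sum>d\<in>UNIV. g x u (e x k) *\<^sub>R
        ((kd k a * tor x b c d - kd k b * tor x a c d + kd k c * tor x a b d - kd k d * tor x a b c) *\<^sub>R (\<gamma> a * \<gamma> b * \<gamma> c * \<gamma> d)))"
      by (rule sum.cong[OF refl], rule sum_rotate4)
    also have "\<dots> = (\<Sum>k\<in>UNIV. g x u (e x k) *\<^sub>R (\<Sum>a\<in>UNIV. \<Sum>b\<in>UNIV. \<Sum>c\<in>UNIV. \<Sum>d\<in>UNIV.
        (kd k a * tor x b c d - kd k b * tor x a c d + kd k c * tor x a b d - kd k d * tor x a b c) *\<^sub>R (\<gamma> a * \<gamma> b * \<gamma> c * \<gamma> d)))"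
      by (subst sum.swap) (simp only: scaleR_sum_right)
    finally show ?thesis
      unfolding kd_def C.wedge_quadrivector tor_op_eq[OF x] .
  qed
  also have "\<dots> = 12 *\<^sub>R (clif x u * tor_op x - tor_op x * clif x u)"
    by (simp add: clif_def sum_distrib_left sum_distrib_right scaleR_sum_right scaleR_diff_right sum_subtractf mult.commute)
  finally show ?thesis by (simp add: act_simps)
qed

lemma nabla_eq:
  "x \<in> U \<Longrightarrow> nabla M T s \<psi> i x u = nab (\<psi> i) x u - (s / 2) *\<^sub>R act (clif x u * tor_op x + tor_op x * clif x u) (\<psi> i x)"
  by (simp add: nabla_def nabla_g_eq cmul2_eq)

lemma dirac_g_eq: "x \<in> U \<Longrightarrow> dirac_g M \<psi> i x = Dir (\<psi> i) x"
  by (simp add: dirac_g_def Dir_def cmul_frame nabla_g_eq)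

lemma dirac_slash_eq: "x \<in> U \<Longrightarrow> dirac_slash M T \<psi> i x = Dir (\<psi> i) x + (1 / 4) *\<^sub>R act (tor_op x) (\<psi> i x)"
  by (simp add: dirac_slash_def dirac_g_eq cmul3_eq)

lemma dirac_eq:
  assumes x: "x \<in> U"
  shows "dirac M T s \<psi> i x = Dir (\<psi> i) x + (3 * s) *\<^sub>R act (tor_op x) (\<psi> i x)"
proof -
  interpret C: clifford_three_form \<gamma> "tor x" by (rule clifford_three_form[OF x])
  have "(\<Sum>a\<in>UNIV. \<gamma> a * (\<gamma> a * tor_op x + tor_op x * \<gamma> a)) = - 2 *\<^sub>R (\<Sum>a\<in>UNIV. \<gamma> a * C.\<iota> a)"
    unfolding tor_op_eq[OF x, symmetric] C.generator_anticommutator by (simp add: scaleR_sum_right)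
  also have "\<dots> = - 6 *\<^sub>R tor_op x"
    by (simp add: C.sum_generator_contraction tor_op_eq[OF x])
  finally have *: "(\<Sum>a\<in>UNIV. \<gamma> a * (\<gamma> a * tor_op x + tor_op x * \<gamma> a)) = - 6 *\<^sub>R tor_op x" .
  have "dirac M T s \<psi> i x = Dir (\<psi> i) x - (s / 2) *\<^sub>R act (\<Sum>a\<in>UNIV. \<gamma> a * (\<gamma> a * tor_op x + tor_op x * \<gamma> a)) (\<psi> i x)"
    by (simp add: dirac_def cmul_frame[OF x] nabla_eq[OF x] clif_frame[OF x] act_vec Dir_def act_sum
        act_simps sum_subtractf scaleR_sum_right)
  then show ?thesis unfolding * by (simp add: act_simps)
qed

text \<open>The common normal form of the two twistor equations, in terms of \<open>clif\<close> and
  \<open>tor_op\<close> and for any tangent vector. It is linear in \<open>u\<close>, so vanishing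
  on the frame suffices.\<close>

definition twistor :: "real \<Rightarrow> ('n rvec \<Rightarrow> 'm cvec) \<Rightarrow> 'n rvec \<Rightarrow> 'n rvec \<Rightarrow> 'm cvec" where
  "twistor s f x u = nab f x u - (s / 2) *\<^sub>R act (clif x u * tor_op x + tor_op x * clif x u) (f x)
     + (1 / real CARD('n)) *\<^sub>R act (clif x u) (Dir f x + (3 * s) *\<^sub>R act (tor_op x) (f x))"

lemma linear_twistor:
  assumes "x \<in> U" "f differentiable (at x)"
  shows "linear (twistor s f x)"
  by (rule linearI)
    (simp_all add: twistor_def linear_add[OF linear_nab[OF assms]] linear_cmul[OF linear_nab[OF assms]]
      linear_add[OF linear_clif[OF assms(1)]] linear_cmul[OF linear_clif[OF assms(1)]] algebra_simps act_simps)

lemma twistor_op_eq_0_iff: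
  assumes x: "x \<in> U" and f: "\<psi> i differentiable (at x)"
  shows "twistor_op M T s \<psi> i x = 0 \<longleftrightarrow> (\<forall>u. twistor s (\<psi> i) x u = 0)"
proof -
  have "twistor_op M T s \<psi> i x $ k = twistor s (\<psi> i) x (e x k)" for k
    by (simp add: twistor_op_def twistor_def nabla_eq[OF x] cmul_eq dirac_eq[OF x])
  then have "twistor_op M T s \<psi> i x = 0 \<longleftrightarrow> (\<forall>k. twistor s (\<psi> i) x (e x k) = 0)"
    by (simp add: vec_eq_iff[of "twistor_op M T s \<psi> i x"])
  also have "\<dots> \<longleftrightarrow> (\<forall>u. twistor s (\<psi> i) x u = 0)"
    using linear_frame_expand[OF x linear_twistor[OF x f]] by (metis (no_types, lifting) scaleR_zero_right sum.neutral)
  finally show ?thesis .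
qed

text \<open>Apart from the derivative terms both sides are combinations of \<open>ct\<close> and
  \<open>tc\<close>, so the claim amounts to the two scalar identities in \<open>1\<close>. The one
  for \<open>tc\<close> alone already determines \<open>s\<close>; the one for \<open>ct\<close>
  then holds as well.\<close>

lemma twistor_rewrite:
  fixes n s :: real
  assumes x: "x \<in> U" and n: "n = real CARD('n)" "n > 3" and s: "s = (n - 1) / (4 * (n - 3))"
  shows "nabla M T (1/4) \<psi> i x u + (1 / n) *\<^sub>R cmul M i x u (dirac_slash M T \<psi> i x)
      + (1 / (2 * (n - 3))) *\<^sub>R cmul4 M i x (wedge3 M i x u (T i x)) (\<psi> i x) = twistor s (\<psi> i) x u"
proof -
  define ct where "ct = act (clif x u * tor_op x) (\<psi> i x)"
  define tc where "tc = act (tor_op x * clif x u) (\<psi> i x)"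
  have 1: "- (1 / 8) - 1 / (4 * (n - 3)) = - (s / 2)" "- (1 / 8) + 1 / (4 * n) + 1 / (4 * (n - 3)) = - (s / 2) + 3 * s / n"
  proof -
    define m where "m = n - 3"
    then have m: "n = m + 3" "m > 0" using n(2) by simp_all
    have m': "m + 3 \<noteq> 0" "m \<noteq> 0" using m(2) by simp_all
    show "- (1 / 8) - 1 / (4 * (n - 3)) = - (s / 2)" "- (1 / 8) + 1 / (4 * n) + 1 / (4 * (n - 3)) = - (s / 2) + 3 * s / n"
      using m' unfolding s m(1) by (simp_all add: divide_simps) (simp_all add: algebra_simps)
  qed
  have "nabla M T (1/4) \<psi> i x u + (1 / n) *\<^sub>R cmul M i x u (dirac_slash M T \<psi> i x)
      + (1 / (2 * (n - 3))) *\<^sub>R cmul4 M i x (wedge3 M i x u (T i x)) (\<psi> i x)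
    = nab (\<psi> i) x u + (1 / n) *\<^sub>R act (clif x u) (Dir (\<psi> i) x)
      + (- (1 / 8) + 1 / (4 * n) + 1 / (4 * (n - 3))) *\<^sub>R ct + (- (1 / 8) - 1 / (4 * (n - 3))) *\<^sub>R tc"
    by (simp add: nabla_eq[OF x] cmul_eq dirac_slash_eq[OF x] cmul4_eq[OF x] ct_def tc_def act_simps act_vec
        scaleR_left_distrib scaleR_left_diff_distrib scaleR_right_distrib scaleR_diff_right)
  also have "\<dots> = twistor s (\<psi> i) x u"
    unfolding 1 twistor_def n(1)[symmetric]
    by (simp add: ct_def tc_def act_simps act_vec
        scaleR_left_distrib scaleR_left_diff_distrib scaleR_right_distrib scaleR_diff_right)
  finally show ?thesis .
qed

subsection \<open>Covariant derivative of the torsion action\<close>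

lemma differentiable_T: "x \<in> U \<Longrightarrow> (\<lambda>x. T i x u v w) differentiable (at x)"
  by (rule smooth_on_differentiable[OF smooth_T])

lemma conn_eq:
  "x \<in> U \<Longrightarrow> conn M T (1/4) i x u v = \<Gamma> x u v + (1 / 2) *\<^sub>R (\<Sum>a\<in>UNIV. T i x u v (e x a) *\<^sub>R e x a)"
  by (simp add: conn_def sharp_eq linear_T3)

lemma dd_torsion:
  assumes "x \<in> U"
  shows "dd (\<lambda>y. T i y v w z) x u = T i x (conn M T (1/4) i x u v) w z + T i x v (conn M T (1/4) i x u w) z
    + T i x v w (conn M T (1/4) i x u z)"
proof -
  have "nabla_T M T (1/4) i x u v w z = 0"
    using parallel chart assms unfolding parallel_torsion_def by blast
  then show ?thesis unfolding nabla_T_def by linarith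
qed

text \<open>The connection form of \<nabla>^c in the frame; the 1/2 is 2 s for s = 1/4.\<close>

definition conn_form :: "'n rvec \<Rightarrow> 'n rvec \<Rightarrow> 'n \<Rightarrow> 'n \<Rightarrow> real" where
  "conn_form x u a b = \<omega> x u a b + T i x u (e x a) (e x b) / 2"

lemma conn_form_skew: "x \<in> U \<Longrightarrow> conn_form x u b a = - conn_form x u a b"
  using \<omega>_skew[of x u b a] T_skew(2)[of x u "e x b" "e x a"] by (simp add: conn_form_def)

text \<open>The frame vectors in the three slots are made variable one after the other. For fixed
  arguments parallelism expresses the derivative of \<open>T\<close> by \<open>conn\<close>;
  together with the derivatives of the frame this puts \<nabla>^c of a frame vector into each
  slot.\<close>

lemma tor_derivative:
  assumes x: "x \<in> U"
  shows "(\<lambda>y. tor y a b c) differentiable (at x)"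
    and "dd (\<lambda>y. tor y a b c) x u
      = (\<Sum>d\<in>UNIV. conn_form x u a d * tor x d b c + conn_form x u b d * tor x a d c + conn_form x u c d * tor x a b d)"
proof -
  note d = differentiable_T[OF x] and de = differentiable_e[OF x]
  have 1: "(\<lambda>y. T i y (e y a) v w) differentiable (at x)"
    "dd (\<lambda>y. T i y (e y a) v w) x u = dd (\<lambda>y. T i y (e x a) v w) x u + T i x (dd (\<lambda>y. e y a) x u) v w" for a v w
    by (rule dd_linear_family[where B = "\<lambda>y u. T i y u v w", OF open_U linear_T1 x d de]; assumption)+
  have 2: "(\<lambda>y. T i y (e y a) (e y b) w) differentiable (at x)"
    "dd (\<lambda>y. T i y (e y a) (e y b) w) x u
      = dd (\<lambda>y. T i y (e y a) (e x b) w) x u + T i x (e x a) (dd (\<lambda>y. e y b) x u) w" for a b w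
    by (rule dd_linear_family[where B = "\<lambda>y v. T i y (e y a) v w", OF open_U linear_T2 x 1(1) de]; assumption)+
  have 3: "(\<lambda>y. T i y (e y a) (e y b) (e y c)) differentiable (at x)"
    "dd (\<lambda>y. T i y (e y a) (e y b) (e y c)) x u
      = dd (\<lambda>y. T i y (e y a) (e y b) (e x c)) x u + T i x (e x a) (e x b) (dd (\<lambda>y. e y c) x u)" for a b c
    by (rule dd_linear_family[where B = "\<lambda>y w. T i y (e y a) (e y b) w", OF open_U linear_T3 x 2(1) de]; assumption)+
  show "(\<lambda>y. tor y a b c) differentiable (at x)"
    unfolding tor_def by (rule 3(1))
  have conn: "dd (\<lambda>y. e y a) x u + conn M T (1/4) i x u (e x a) = (\<Sum>d\<in>UNIV. conn_form x u a d *\<^sub>R e x d)" for a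
  proof -
    have "dd (\<lambda>y. e y a) x u + conn M T (1/4) i x u (e x a)
       = cov_frame x u a + (1 / 2) *\<^sub>R (\<Sum>d\<in>UNIV. T i x u (e x a) (e x d) *\<^sub>R e x d)"
      by (simp add: conn_eq[OF x] cov_frame_def)
    then show ?thesis
      by (simp add: cov_frame_expand[OF x] conn_form_def scaleR_left_distrib sum.distrib scaleR_sum_right)
  qed
  have "dd (\<lambda>y. tor y a b c) x u = T i x (dd (\<lambda>y. e y a) x u + conn M T (1/4) i x u (e x a)) (e x b) (e x c)
      + T i x (e x a) (dd (\<lambda>y. e y b) x u + conn M T (1/4) i x u (e x b)) (e x c)
      + T i x (e x a) (e x b) (dd (\<lambda>y. e y c) x u + conn M T (1/4) i x u (e x c))"
    unfolding tor_def 3(2) 2(2) 1(2) dd_torsion[OF x]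
    by (simp add: linear_add[OF linear_T1[OF x]] linear_add[OF linear_T2[OF x]] linear_add[OF linear_T3[OF x]])
  then show "dd (\<lambda>y. tor y a b c) x u
      = (\<Sum>d\<in>UNIV. conn_form x u a d * tor x d b c + conn_form x u b d * tor x a d c + conn_form x u c d * tor x a b d)"
    unfolding conn
    by (simp add: linear_sum[OF linear_T1[OF x]] linear_sum[OF linear_T2[OF x]] linear_sum[OF linear_T3[OF x]]
        linear_cmul[OF linear_T1[OF x]] linear_cmul[OF linear_T2[OF x]] linear_cmul[OF linear_T3[OF x]] tor_def sum.distrib)
qed

text \<open>On spinors \<nabla>^c in direction u is \<nabla> minus (u \<theta> + \<theta> u)/8, and
  parallelism says that it commutes with \<theta>. So \<nabla> has the same commutator with \<theta>
  as (u \<theta> + \<theta> u)/8, in which \<theta> u \<theta> cancels.\<close>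

lemma nab_tor_op:
  assumes x: "x \<in> U" and f: "f differentiable (at x)"
  shows "nab (\<lambda>y. act (tor_op y) (f y)) x u = act (tor_op x) (nab f x u)
    + (1 / 8) *\<^sub>R act (clif x u * (tor_op x * tor_op x) - tor_op x * tor_op x * clif x u) (f x)"
proof -
  interpret C: clifford_three_form \<gamma> "tor x" by (rule clifford_three_form[OF x])
  define D where "D u = (1 / 6) *\<^sub>R trivector (\<lambda>a b c. dd (\<lambda>y. tor y a b c) x u)" for u
  have od: "operator_derivative tor_op x D"
    unfolding tor_op_def[abs_def] D_def[abs_def] trivector_def
    by (intro operator_derivative_scaleR_const operator_derivative_sum operator_derivative_scaleR tor_derivative x)
  have "bivector (conn_form x u) = bivector (\<omega> x u) + (1 / 2) *\<^sub>R bivector (\<lambda>a b. T i x u (e x a) (e x b))"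
    by (simp add: bivector_def conn_form_def scaleR_left_distrib sum.distrib scaleR_sum_right)
  then have B: "(1 / 4) *\<^sub>R bivector (conn_form x u) = spin_form x u - (1 / 8) *\<^sub>R (clif x u * tor_op x + tor_op x * clif x u)"
    by (simp add: spin_form_def contraction_eq[OF x] scaleR_right_distrib scaleR_diff_right)
  have "D u = - ((1 / 4) *\<^sub>R bivector (conn_form x u) * tor_op x - tor_op x * ((1 / 4) *\<^sub>R bivector (conn_form x u)))"
    using C.bivector_theta_commutator[of "conn_form x u", OF conn_form_skew[OF x]]
    by (simp add: D_def tor_derivative(2)[OF x] tor_op_eq[OF x] scaleR_diff_right)
  then have "D u + (spin_form x u * tor_op x - tor_op x * spin_form x u) = (1 / 8) *\<^sub>R (clif x u * (tor_op x * tor_op x) - tor_op x * tor_op x * clif x u)"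
    unfolding B by (simp add: algebra_simps)
  then show ?thesis by (simp add: nab_operator[OF od f] act_simps)
qed

lemma smooth_tor_op:
  assumes f: "smooth_on U f"
  shows "smooth_on U (\<lambda>y. act (tor_op y) (f y))"
proof -
  have "smooth_on U (\<lambda>y. tor y a b c)" for a b c
  proof -
    have 1: "smooth_on U (\<lambda>y. T i y (e y a) v w)" for v w
      by (rule smooth_linear_family[where B = "\<lambda>y u. T i y u v w", OF open_U linear_T1 smooth_T smooth_e])
    have 2: "smooth_on U (\<lambda>y. T i y (e y a) (e y b) w)" for w
      by (rule smooth_linear_family[where B = "\<lambda>y v. T i y (e y a) v w", OF open_U linear_T2 1 smooth_e])
    show ?thesis
      unfolding tor_def
      by (rule smooth_linear_family[where B = "\<lambda>y w. T i y (e y a) (e y b) w", OF open_U linear_T3 2 smooth_e])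
  qed
  then show ?thesis
    unfolding tor_op_def trivector_def act_simps act_sum
    by (intro smooth_on_scaleR_const smooth_on_sum smooth_on_scaleR smooth_on_linear[OF bounded_linear_act] f open_U)
qed

end

section \<open>Extension of tangent vectors to vector fields\<close>

context
  fixes M :: "('p, 'i, 'n::{finite,linorder}, 'm::finite) spin_data"
  assumes manifold: "oriented_manifold M"
begin

lemma chart_homeomorphic:
  assumes "j \<in> charts M"
  shows "homeomorphic_map (subtopology (points M) (cdom M j)) (top_of_set (cimg M j)) (crd M j)"
    and "openin (points M) (cdom M j)" and "open (cimg M j)"
  using manifold assms by (simp_all add: oriented_manifold_def)

lemma topspace_cdom: "j \<in> charts M \<Longrightarrow> topspace (subtopology (points M) (cdom M j)) = cdom M j"
  using openin_subset[OF chart_homeomorphic(2)] by (auto simp: topspace_subtopology)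

lemma inj_crd: "j \<in> charts M \<Longrightarrow> inj_on (crd M j) (cdom M j)"
  using homeomorphic_imp_injective_map[OF chart_homeomorphic(1)] topspace_cdom by metis

lemma transition_crd: "j \<in> charts M \<Longrightarrow> p \<in> cdom M j \<Longrightarrow> transition M j k (crd M j p) = crd M k p"
  by (simp add: transition_def the_inv_into_f_f inj_crd)

lemma open_crd_image:
  assumes j: "j \<in> charts M" and V: "openin (points M) V"
  shows "open (crd M j ` (cdom M j \<inter> V))"
proof -
  have "openin (subtopology (points M) (cdom M j)) (cdom M j \<inter> V)"
    using V by (metis Int_commute openin_subtopology_Int)
  then have "openin (top_of_set (cimg M j)) (crd M j ` (cdom M j \<inter> V))"
    using homeomorphic_imp_open_map[OF chart_homeomorphic(1)[OF j]] unfolding open_map_def by blast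
  then show ?thesis using chart_homeomorphic(3)[OF j] openin_open_trans by blast
qed

lemma open_overlap: "j \<in> charts M \<Longrightarrow> k \<in> charts M \<Longrightarrow> open (overlap M j k)"
  unfolding overlap_def using open_crd_image chart_homeomorphic(2) by blast

lemma smooth_transition: "j \<in> charts M \<Longrightarrow> k \<in> charts M \<Longrightarrow> smooth_on (overlap M j k) (transition M j k)"
  using manifold by (simp add: oriented_manifold_def)

lemma differentiable_transition:
  "j \<in> charts M \<Longrightarrow> k \<in> charts M \<Longrightarrow> y \<in> overlap M j k \<Longrightarrow> transition M j k differentiable (at y)"
  using smooth_transition smooth_on_differentiable by blast

lemma crd_overlap: "p \<in> cdom M j \<Longrightarrow> p \<in> cdom M k \<Longrightarrow> crd M j p \<in> overlap M j k"
  by (auto simp: overlap_def)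

lemma dtransition_cocycle:
  assumes i: "i \<in> charts M" and j: "j \<in> charts M" and k: "k \<in> charts M"
    and p: "p \<in> cdom M i" "p \<in> cdom M j" "p \<in> cdom M k"
  shows "dtransition M i k (crd M i p) v = dtransition M j k (crd M j p) (dtransition M i j (crd M i p) v)"
proof -
  let ?W = "crd M i ` (cdom M i \<inter> (cdom M j \<inter> cdom M k))"
  have W: "open ?W" using open_crd_image[OF i] chart_homeomorphic(2) j k by blast
  have z: "crd M i p \<in> ?W" using p by blast
  have "dtransition M i k (crd M i p) v = dd (\<lambda>z. transition M j k (transition M i j z)) (crd M i p) v"
    by (rule dd_cong_open[OF W z]) (auto simp: transition_crd i j)
  also have "\<dots> = dtransition M j k (transition M i j (crd M i p)) (dtransition M i j (crd M i p) v)"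
    by (rule dd_eqI[OF has_derivative_compose[OF dd_has_derivative dd_has_derivative]])
      (auto simp: transition_crd i p intro!: differentiable_transition i j k crd_overlap)
  finally show ?thesis by (simp add: transition_crd i p)
qed

lemma dtransition_self:
  assumes i: "i \<in> charts M" and p: "p \<in> cdom M i"
  shows "dtransition M i i (crd M i p) v = v"
proof -
  have "dtransition M i i (crd M i p) v = dd (\<lambda>z. z) (crd M i p) v"
    by (rule dd_cong_open[OF chart_homeomorphic(3)[OF i]]) (use p in \<open>auto simp: cimg_def transition_crd i\<close>)
  then show ?thesis by (simp add: dd_eqI[OF has_derivative_ident])
qed

text \<open>The delicate point is smoothness of the extension by zero at the edge of
  \<open>cdom M i\<close>, seen from other charts. The support lies in the compact set
  \<open>K\<close>, which is closed since the space is Hausdorff; so a point outside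
  \<open>cdom M i\<close> has a neighbourhood where the field vanishes.\<close>

lemma vector_field_extension:
  assumes i: "i \<in> charts M" and x: "x \<in> cimg M i"
  obtains X :: "('i, 'n) vfield" where "vector_field M X" "X i x = v"
proof -
  obtain r where r: "r > 0" "cball x r \<subseteq> cimg M i"
    using open_contains_cball chart_homeomorphic(3)[OF i] x by blast
  obtain \<rho> :: "'n rvec \<Rightarrow> real" where \<rho>: "smooth_on UNIV \<rho>" "\<rho> x = 1" "\<And>y. y \<notin> ball x r \<Longrightarrow> \<rho> y = 0"
    using bump_function_exists[OF r(1)] by metis
  define X :: "('i, 'n) vfield" where
    "X j y = (if y \<in> overlap M j i then \<rho> (transition M j i y) *\<^sub>R dtransition M i j (transition M j i y) v else 0)" for j y
  have X_in: "X j (crd M j p) = \<rho> (crd M i p) *\<^sub>R dtransition M i j (crd M i p) v"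
    if "j \<in> charts M" "p \<in> cdom M j" "p \<in> cdom M i" for j p
    using that by (simp add: X_def crd_overlap transition_crd)
  have overlapD: "p \<in> cdom M i" if asm: "j \<in> charts M" "p \<in> cdom M j" "crd M j p \<in> overlap M j i" for j p
  proof -
    obtain p' where "p' \<in> cdom M j" "p' \<in> cdom M i" "crd M j p = crd M j p'"
      using asm(3) by (auto simp: overlap_def)
    then show ?thesis using inj_onD[OF inj_crd[OF asm(1)]] asm(2) by metis
  qed
  have X_out: "X j (crd M j p) = 0" if "j \<in> charts M" "p \<in> cdom M j" "p \<notin> cdom M i" for j p
    using that overlapD by (auto simp: X_def)
  obtain q where q: "homeomorphic_maps (subtopology (points M) (cdom M i)) (top_of_set (cimg M i)) (crd M i) q"
    using chart_homeomorphic(1)[OF i] homeomorphic_map_maps by blast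
  define K where "K = q ` cball x r"
  have "compactin (top_of_set (cimg M i)) (cball x r)"
    using r by (simp add: compactin_subtopology)
  then have "compactin (subtopology (points M) (cdom M i)) K"
    using q image_compactin unfolding K_def homeomorphic_maps_def by blast
  then have "compactin (points M) K" by (simp add: compactin_subtopology)
  then have "closedin (points M) K"
    using manifold compactin_imp_closedin by (auto simp: oriented_manifold_def)
  then have openK: "openin (points M) (topspace (points M) - K)" by blast
  have K: "p \<in> K" if "p \<in> cdom M i" "crd M i p \<in> ball x r" for p
  proof -
    have "q (crd M i p) = p" using q that topspace_cdom[OF i] unfolding homeomorphic_maps_def by auto
    then show ?thesis using that unfolding K_def by (metis ball_subset_cball image_eqI subsetD)
  qed
  have K_cdom: "K \<subseteq> cdom M i"
    using \<open>compactin (subtopology (points M) (cdom M i)) K\<close> by (simp add: compactin_subtopology)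
  have smooth: "smooth_on (cimg M j) (X j)" if j: "j \<in> charts M" for j
  proof (rule smooth_on_local)
    fix y assume "y \<in> cimg M j"
    then obtain p where p: "p \<in> cdom M j" "y = crd M j p" by (auto simp: cimg_def)
    show "\<exists>V. open V \<and> y \<in> V \<and> smooth_on (V \<inter> cimg M j) (X j)"
    proof (cases "p \<in> cdom M i")
      case True
      have sub: "transition M j i ` overlap M j i \<subseteq> overlap M i j"
        using j by (auto simp: overlap_def transition_crd)
      have "smooth_on (overlap M i j) (\<lambda>z. \<rho> z *\<^sub>R dtransition M i j z v)"
        by (intro smooth_on_scaleR smooth_on_dd smooth_transition smooth_on_subset[OF \<rho>(1)] open_overlap i j) auto
      then have "smooth_on (overlap M j i) (\<lambda>y. \<rho> (transition M j i y) *\<^sub>R dtransition M i j (transition M j i y) v)"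
        by (rule smooth_on_compose[OF open_overlap[OF j i] open_overlap[OF i j] sub _ smooth_transition[OF j i]])
      then have "smooth_on (overlap M j i) (X j)"
        by (subst smooth_on_cong[OF open_overlap[OF j i]]) (auto simp: X_def)
      then have "smooth_on (overlap M j i \<inter> cimg M j) (X j)" by (rule smooth_on_subset) auto
      then show ?thesis using open_overlap[OF j i] crd_overlap[OF p(1) True] p(2) by blast
    next
      case False
      \<comment> \<open>This open set may still meet \<open>cdom M i\<close>, but only where \<rho>
        is zero.\<close>
      let ?V = "crd M j ` (cdom M j \<inter> (topspace (points M) - K))"
      have V: "open ?V" by (rule open_crd_image[OF j openK])
      have "X j z = 0" if z: "z \<in> ?V" for z
      proof -
        obtain p' where p': "p' \<in> cdom M j" "p' \<notin> K" "z = crd M j p'" using z by blast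
        show ?thesis
        proof (cases "p' \<in> cdom M i")
          case True
          then have "crd M i p' \<notin> ball x r" using K p' by blast
          then show ?thesis using X_in[OF j p'(1) True] \<rho>(3) p'(3) by simp
        qed (use X_out[OF j p'(1)] p'(3) in simp)
      qed
      then have "smooth_on ?V (X j)"
        by (subst smooth_on_cong[OF V, where g = "\<lambda>_. 0"]) (auto intro: smooth_on_const)
      then have "smooth_on (?V \<inter> cimg M j) (X j)" by (rule smooth_on_subset) auto
      moreover have "y \<in> ?V"
        using p False K_cdom openin_subset[OF chart_homeomorphic(2)[OF j]] by blast
      ultimately show ?thesis using V by blast
    qed
  qed
  have trans: "X k (transition M j k y) = dtransition M j k y (X j y)"
    if j: "j \<in> charts M" and k: "k \<in> charts M" and y: "y \<in> overlap M j k" for j k y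
  proof -
    obtain p where p: "p \<in> cdom M j" "p \<in> cdom M k" "y = crd M j p" using y by (auto simp: overlap_def)
    have lin: "linear (dtransition M j k y)" by (rule linear_dd[OF differentiable_transition[OF j k y]])
    show ?thesis
    proof (cases "p \<in> cdom M i")
      case True
      then show ?thesis
        using dtransition_cocycle[OF i j k True p(1,2)] lin
        by (simp add: p(3) transition_crd[OF j p(1)] X_in j k p(1,2) linear_cmul)
    next
      case False
      then show ?thesis
        using lin by (simp add: p(3) transition_crd[OF j p(1)] X_out j k p(1,2) linear_0)
    qed
  qed
  obtain p where p: "p \<in> cdom M i" "x = crd M i p" using x by (auto simp: cimg_def)
  have "vector_field M X" using smooth trans by (simp add: vector_field_def)
  moreover have "X i x = v"
    using X_in[OF i p(1) p(1)] \<rho>(2) dtransition_self[OF i p(1)] p(2) by simp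
  ultimately show ?thesis by (rule that)
qed

end

section \<open>Twistor spinors\<close>

text \<open>The elimination for one real component of the spinor equations. \<open>E\<close>,
  \<open>Y\<close>, \<open>P\<close>, \<open>Q\<close>, \<open>X\<close> stand for
  \<open>D\<^sup>2 \<psi>\<close>, D(\<theta> \<psi>), \<theta> D \<psi>,
  \<open>\<theta>\<^sup>2 \<psi>\<close>, \<psi>, and \<open>N\<close>, \<open>R\<close> for the
  squared norm of T and the scalar curvature.\<close>

lemma dirac_square_coefficients:
  fixes n s a E P Q Y X N R :: real
  assumes n: "n > 3" and s: "s = (n - 1) / (4 * (n - 3))" and a: "a = s / 2 - 3 * s / n"
    and E: "E = - (a * Y - 1 / n * E + s / 2 * P + s / 2 * (Q - N * X)) + R / 4 * X"
    and Y: "Y = (n - 6) * (a * Q - 1 / n * P) + s / 2 * ((8 - n) * Q - 8 * N * X) + N * X - Q"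
  shows "E + Y / 4 + P / 4 + Q / 16
    = (n / (4 * (n - 1)) * R + n * (n - 5) / (8 * (n - 3)\<^sup>2) * N) * X + n * (4 - n) / (4 * (n - 3)\<^sup>2) * Q"
proof -
  define m where "m = n - 3"
  \<comment> \<open>\<open>k\<close> inverts the coefficient 1 - 1/n of \<open>E\<close> after its
    terms are collected, and \<open>K\<close> is the value of k s / 2.\<close>
  define K where "K = n / (8 * (n - 3))"
  define k where "k = n / (n - 1)"
  have m: "n = m + 3" "m > 0" using n by (simp_all add: m_def)
  then have nz: "m + 3 \<noteq> 0" "m + 2 \<noteq> 0" "m \<noteq> 0" by simp_all
  \<comment> \<open>\<open>c1\<close> makes the total coefficient of \<open>Y\<close>, including the
    1/4 from the square, equal to \<open>K\<close>; \<open>cP\<close> is the cancellation of the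
    mixed term. \<open>cQ\<close> and \<open>cN\<close> are the two torsion coefficients of the
    result.\<close>
  have c1: "k * a = 1 / 4 - K" and c2: "k * (s / 2) = K"
    and cP: "K * (- (n - 6) / n - 1) + 1 / 4 = 0"
    and cQ: "K * ((n - 6) * a + s / 2 * (8 - n) - 2) + 1 / 16 = n * (4 - n) / (4 * (n - 3)\<^sup>2)"
    and cN: "K * (2 - 4 * s) = n * (n - 5) / (8 * (n - 3)\<^sup>2)"
    using nz unfolding K_def k_def a s m(1) power2_eq_square
    by (simp_all add: divide_simps) (simp_all add: algebra_simps)
  have "(n - 1) / n * E = - (a * Y + s / 2 * P + s / 2 * (Q - N * X)) + R / 4 * X"
    using E n by (simp add: diff_divide_distrib left_diff_distrib)
  then have "k * ((n - 1) / n * E) = k * (- (a * Y + s / 2 * P + s / 2 * (Q - N * X)) + R / 4 * X)"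
    by simp
  moreover have "k * ((n - 1) / n * E) = E" using n by (simp add: k_def)
  ultimately have "E = k * (- (a * Y + s / 2 * P + s / 2 * (Q - N * X)) + R / 4 * X)"
    by simp
  also have "\<dots> = - (k * a) * Y - (k * (s / 2)) * P - (k * (s / 2)) * (Q - N * X) + k / 4 * R * X"
    by (simp add: algebra_simps)
  finally have "E = - (1 / 4 - K) * Y - K * P - K * (Q - N * X) + n / (4 * (n - 1)) * R * X"
    unfolding c1 c2 by (simp add: k_def)
  then have "E + Y / 4 + P / 4 + Q / 16 = K * Y - K * P - K * Q + K * N * X + n / (4 * (n - 1)) * R * X + P / 4 + Q / 16"
    by (simp add: algebra_simps)
  also have "\<dots> = (K * (- (n - 6) / n - 1) + 1 / 4) * P + (K * ((n - 6) * a + s / 2 * (8 - n) - 2) + 1 / 16) * Q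
      + K * (2 - 4 * s) * (N * X) + n / (4 * (n - 1)) * R * X"
    by (subst Y) (simp add: algebra_simps diff_divide_distrib add_divide_distrib)
  also have "\<dots> = (n / (4 * (n - 1)) * R + n * (n - 5) / (8 * (n - 3)\<^sup>2) * N) * X + n * (4 - n) / (4 * (n - 3)\<^sup>2) * Q"
    unfolding cP cQ cN by (simp add: algebra_simps)
  finally show ?thesis .
qed

context spin_chart_torsion
begin

lemma nab_cong: "x \<in> U \<Longrightarrow> (\<And>y. y \<in> U \<Longrightarrow> f y = h y) \<Longrightarrow> nab f x u = nab h x u"
  using dd_cong_open[OF open_U, of x f h u] by (simp add: nab_def)

lemma Dir_cong: "x \<in> U \<Longrightarrow> (\<And>y. y \<in> U \<Longrightarrow> f y = h y) \<Longrightarrow> Dir f x = Dir h x"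
  using nab_cong[of x f h] by (simp add: Dir_def)

lemma nab_add: "f differentiable (at x) \<Longrightarrow> h differentiable (at x) \<Longrightarrow> nab (\<lambda>y. f y + h y) x u = nab f x u + nab h x u"
  by (simp add: nab_def dd_add act_vec)

lemma nab_scaleR: "f differentiable (at x) \<Longrightarrow> nab (\<lambda>y. r *\<^sub>R f y) x u = r *\<^sub>R nab f x u"
  by (simp add: nab_def dd_linear[OF bounded_linear_scaleR_right] act_vec scaleR_right_distrib)

lemma Dir_add: "f differentiable (at x) \<Longrightarrow> h differentiable (at x) \<Longrightarrow> Dir (\<lambda>y. f y + h y) x = Dir f x + Dir h x"
  by (simp add: Dir_def nab_add act_vec sum.distrib)

lemma Dir_scaleR: "f differentiable (at x) \<Longrightarrow> Dir (\<lambda>y. r *\<^sub>R f y) x = r *\<^sub>R Dir f x"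
  by (simp add: Dir_def nab_scaleR act_vec scaleR_sum_right)

lemma smooth_clif:
  assumes f: "smooth_on U f"
  shows "smooth_on U (\<lambda>y. act (clif y w) (f y))"
proof -
  have "smooth_on U (\<lambda>y. g y w (e y a))" for a
    by (rule smooth_linear_family[where B = "\<lambda>y v. g y w v", OF open_U linear_g_right smooth_g smooth_e])
  then show ?thesis
    unfolding clif_def act_simps act_sum
    by (intro smooth_on_sum smooth_on_scaleR smooth_on_linear[OF bounded_linear_act] f open_U)
qed

text \<open>The square expands to \<open>E\<close> + (\<open>Y\<close> + \<open>P\<close>)/4 +
  \<open>Q\<close>/16. Two linear relations determine \<open>E\<close> and \<open>Y\<close>: the
  trace of the Hessian in the Lichnerowicz formula, and the Dirac operator of \<theta> f evaluated
  by the twistor equation.\<close>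

lemma dirac_slash_square:
  fixes n s :: real
  assumes f: "smooth_on U f" and x: "x \<in> U" and n: "n = real CARD('n)" "n > 3" and s: "s = (n - 1) / (4 * (n - 3))"
    and twistor: "\<And>y u. y \<in> U \<Longrightarrow> twistor s f y u = 0"
  defines "\<phi> \<equiv> \<lambda>y. Dir f y + (1 / 4) *\<^sub>R act (tor_op y) (f y)"
  shows "Dir \<phi> x + (1 / 4) *\<^sub>R act (tor_op x) (\<phi> x)
    = (n / (4 * (n - 1)) * scal M i x + n * (n - 5) / (8 * (n - 3)\<^sup>2) * norm3_sq M T i x) *\<^sub>R f x
      + (n * (4 - n) / (4 * (n - 3)\<^sup>2)) *\<^sub>R act (tor_op x) (act (tor_op x) (f x))"
proof -
  interpret C: clifford_three_form \<gamma> "tor x" by (rule clifford_three_form[OF x])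
  define a where "a = s / 2 - 3 * s / n"
  \<comment> \<open>\<eta> collects the part of the twistor equation with Clifford multiplication by
    u on the left. The only other term is \<theta> u f, and in this form all traces over the frame
    become sandwich sums.\<close>
  define \<eta> where "\<eta> y = a *\<^sub>R act (tor_op y) (f y) + (- (1 / n)) *\<^sub>R Dir f y" for y
  define E where "E = Dir (Dir f) x"
  define Y where "Y = Dir (\<lambda>y. act (tor_op y) (f y)) x"
  define P where "P = act (tor_op x) (Dir f x)"
  define Q where "Q = act (tor_op x) (act (tor_op x) (f x))"
  define N where "N = norm3_sq M T i x"
  note smooth = f smooth_tor_op[OF f] smooth_Dir[OF f]
  note diff = smooth[THEN smooth_on_differentiable, OF x]
  have smooth_\<eta>: "smooth_on U \<eta>"
    unfolding \<eta>_def[abs_def] by (intro smooth_on_add smooth_on_scaleR_const smooth open_U)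
  have sq1: "(\<Sum>a\<in>UNIV. \<gamma> a * \<gamma> a) = - n *\<^sub>R 1"
    and sq2: "(\<Sum>a\<in>UNIV. \<gamma> a * tor_op x * \<gamma> a) = (n - 6) *\<^sub>R tor_op x"
    and sq3: "(\<Sum>a\<in>UNIV. \<gamma> a * (tor_op x * tor_op x) * \<gamma> a) = (8 - n) *\<^sub>R (tor_op x * tor_op x) - (8 * N) *\<^sub>R 1"
    using C.sum_squares C.sum_sandwich C.sum_sandwich_square
    by (simp_all add: tor_op_eq[OF x] n(1) N_def norm3_sq_eq[OF x] of_real_def)
  have nabf: "nab f y u = act (clif y u) (\<eta> y) + (s / 2) *\<^sub>R act (tor_op y) (act (clif y u) (f y))" if "y \<in> U" for y u
  proof -
    have "nab f y u = (s / 2) *\<^sub>R act (clif y u * tor_op y + tor_op y * clif y u) (f y)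
        - (1 / n) *\<^sub>R act (clif y u) (Dir f y + (3 * s) *\<^sub>R act (tor_op y) (f y))"
      using twistor[OF that, of u] unfolding twistor_def n(1)[symmetric] by (simp add: algebra_simps)
    then show ?thesis
      by (simp add: \<eta>_def a_def act_simps act_vec algebra_simps)
  qed
  \<comment> \<open>s/16 is s/2 times the 1/8 from \<open>nab_tor_op\<close>. The Christoffel terms
    from differentiating \<open>clif y w\<close> cancel against the one in
    \<open>hess\<close>.\<close>
  have hess: "hess f x u w = act (clif x w) (nab \<eta> x u) + (s / 2) *\<^sub>R act (tor_op x) (act (clif x w) (nab f x u))
      + (s / 16) *\<^sub>R act (clif x u * (tor_op x * tor_op x) - tor_op x * tor_op x * clif x u) (act (clif x w) (f x))" for u w
  proof -
    note dc = smooth_on_differentiable[OF smooth_clif x]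
    have "nab (\<lambda>y. nab f y w) x u
        = nab (\<lambda>y. act (clif y w) (\<eta> y) + (s / 2) *\<^sub>R act (tor_op y) (act (clif y w) (f y))) x u"
      by (rule nab_cong[OF x nabf])
    also have "\<dots> = nab (\<lambda>y. act (clif y w) (\<eta> y)) x u + (s / 2) *\<^sub>R nab (\<lambda>y. act (tor_op y) (act (clif y w) (f y))) x u"
      by (subst nab_add)
        (auto intro!: dc[OF smooth_\<eta>] smooth_on_differentiable[OF _ x] smooth_on_scaleR_const smooth_tor_op smooth_clif f open_U
          simp: nab_scaleR smooth_on_differentiable[OF smooth_tor_op[OF smooth_clif[OF f]] x])
    finally show ?thesis
      unfolding hess_def nabf[OF x, of "\<Gamma> x u w"]
      by (simp add: nab_clif[OF x smooth_on_differentiable[OF smooth_\<eta> x]] nab_tor_op[OF x dc[OF f]] nab_clif[OF x diff(1)]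
          act_vec scaleR_right_distrib)
  qed
  have Dir_\<eta>: "Dir \<eta> x = a *\<^sub>R Y - (1 / n) *\<^sub>R E"
  proof -
    have "Dir \<eta> x = a *\<^sub>R Y + (- (1 / n)) *\<^sub>R E"
      unfolding \<eta>_def[abs_def] Y_def E_def
      by (simp only: Dir_add Dir_scaleR diff differentiable_scaleR[OF differentiable_const])
    then show ?thesis by simp
  qed
  have "(\<Sum>a\<in>UNIV. hess f x (e x a) (e x a)) = Dir \<eta> x + (s / 2) *\<^sub>R P
      + (s / 16) *\<^sub>R act (\<Sum>a\<in>UNIV. \<gamma> a * (tor_op x * tor_op x) * \<gamma> a - tor_op x * tor_op x * (\<gamma> a * \<gamma> a)) (f x)"
    unfolding hess clif_frame[OF x]
    by (simp add: sum.distrib Dir_def P_def act_vec scaleR_sum_right act_sum act_simps)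
  also have "(\<Sum>a\<in>UNIV. \<gamma> a * (tor_op x * tor_op x) * \<gamma> a - tor_op x * tor_op x * (\<gamma> a * \<gamma> a)) = 8 *\<^sub>R (tor_op x * tor_op x) - (8 * N) *\<^sub>R 1"
    unfolding sum_subtractf sum_distrib_left[symmetric] sq1 sq3 by (simp add: algebra_simps)
  finally have sum_hess: "(\<Sum>a\<in>UNIV. hess f x (e x a) (e x a))
      = a *\<^sub>R Y - (1 / n) *\<^sub>R E + (s / 2) *\<^sub>R P + (s / 2) *\<^sub>R (Q - N *\<^sub>R f x)"
    by (simp add: Dir_\<eta> Q_def act_simps scaleR_diff_right)
  have E: "E = - (a *\<^sub>R Y - (1 / n) *\<^sub>R E + (s / 2) *\<^sub>R P + (s / 2) *\<^sub>R (Q - N *\<^sub>R f x)) + (scal M i x / 4) *\<^sub>R f x"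
    using Lichnerowicz[OF x f] unfolding sum_hess E_def[symmetric] .
  \<comment> \<open>Multiplication by \<gamma> a encloses \<theta> or its square between equal
    generators; the contribution of the derivative of \<theta> adds up to N f - \<theta> \<theta>
    f.\<close>
  have "Y = (\<Sum>a\<in>UNIV. act (\<gamma> a) (act (tor_op x) (act (\<gamma> a) (\<eta> x) + (s / 2) *\<^sub>R act (tor_op x) (act (\<gamma> a) (f x)))
      + (1 / 8) *\<^sub>R act (\<gamma> a * (tor_op x * tor_op x) - tor_op x * tor_op x * \<gamma> a) (f x)))"
    by (simp add: Y_def Dir_def nab_tor_op[OF x diff(1)] nabf[OF x] clif_frame[OF x])
  also have "\<dots> = act (\<Sum>a\<in>UNIV. \<gamma> a * tor_op x * \<gamma> a) (\<eta> x) + (s / 2) *\<^sub>R act (\<Sum>a\<in>UNIV. \<gamma> a * (tor_op x * tor_op x) * \<gamma> a) (f x)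
      + (1 / 8) *\<^sub>R act ((\<Sum>a\<in>UNIV. \<gamma> a * \<gamma> a) * (tor_op x * tor_op x) - (\<Sum>a\<in>UNIV. \<gamma> a * (tor_op x * tor_op x) * \<gamma> a)) (f x)"
    by (simp add: sum_distrib_right sum.distrib sum_subtractf act_vec act_sum act_simps scaleR_sum_right scaleR_diff_right)
  finally have Y: "Y = (n - 6) *\<^sub>R (a *\<^sub>R Q - (1 / n) *\<^sub>R P) + (s / 2) *\<^sub>R ((8 - n) *\<^sub>R Q - (8 * N) *\<^sub>R f x) + N *\<^sub>R f x - Q"
    unfolding sq1 sq2 sq3
    by (simp add: act_simps act_vec \<eta>_def P_def Q_def algebra_simps)
  have "Dir \<phi> x = E + (1 / 4) *\<^sub>R Y"
    unfolding \<phi>_def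
    by (subst Dir_add) (use diff in \<open>auto simp: Dir_scaleR Y_def E_def intro!: differentiable_scaleR differentiable_const\<close>)
  then have "Dir \<phi> x + (1 / 4) *\<^sub>R act (tor_op x) (\<phi> x) = E + (1 / 4) *\<^sub>R Y + (1 / 4) *\<^sub>R P + (1 / 16) *\<^sub>R Q"
    by (simp add: \<phi>_def P_def Q_def act_vec scaleR_right_distrib)
  also have "\<dots> = (n / (4 * (n - 1)) * scal M i x + n * (n - 5) / (8 * (n - 3)\<^sup>2) * N) *\<^sub>R f x
      + (n * (4 - n) / (4 * (n - 3)\<^sup>2)) *\<^sub>R Q"
  \<comment> \<open>The relations for \<open>E\<close> and \<open>Y\<close> are linear with real
    coefficients, so pairing with \<open>b\<close> reduces the claim to real arithmetic.\<close>
  proof (rule euclidean_eqI)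
    fix b :: "'m cvec"
    note inner = inner_add_left inner_diff_left inner_minus_left inner_scaleR_left
    have E': "E \<bullet> b = - (a * (Y \<bullet> b) - 1 / n * (E \<bullet> b) + s / 2 * (P \<bullet> b) + s / 2 * (Q \<bullet> b - N * (f x \<bullet> b))) + scal M i x / 4 * (f x \<bullet> b)"
      using arg_cong[OF E, of "\<lambda>v. v \<bullet> b"] by (simp only: inner)
    have Y': "Y \<bullet> b = (n - 6) * (a * (Q \<bullet> b) - 1 / n * (P \<bullet> b)) + s / 2 * ((8 - n) * (Q \<bullet> b) - 8 * N * (f x \<bullet> b)) + N * (f x \<bullet> b) - Q \<bullet> b"
      using arg_cong[OF Y, of "\<lambda>v. v \<bullet> b"] by (simp only: inner)
    show "(E + (1 / 4) *\<^sub>R Y + (1 / 4) *\<^sub>R P + (1 / 16) *\<^sub>R Q) \<bullet> b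
      = ((n / (4 * (n - 1)) * scal M i x + n * (n - 5) / (8 * (n - 3)\<^sup>2) * N) *\<^sub>R f x
        + (n * (4 - n) / (4 * (n - 3)\<^sup>2)) *\<^sub>R Q) \<bullet> b"
      using dirac_square_coefficients[OF n(2) s a_def E' Y'] by (simp add: inner)
  qed
  finally show ?thesis by (simp add: N_def Q_def)
qed

end

theorem lemma5p1:
  fixes M :: "('p, 'i, 'n::{finite,linorder}, 'm::finite) spin_data"
    and T :: "('i, 'n) form3" and \<psi> :: "('i, 'n, 'm) spinor"
    and n s :: real
  assumes "oriented_riemannian_spin_manifold M"
    and "n = real CARD('n)" and "CARD('n) \<ge> 4"
    and "three_form M T" and "parallel_torsion M T"
    and "s = (n - 1) / (4 * (n - 3))"
    and "spinor_field M \<psi>"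
  shows "(twistor_spinor M T s \<psi> \<longleftrightarrow>
           (\<forall>X. vector_field M X \<longrightarrow> (\<forall>i\<in>charts M. \<forall>x\<in>cimg M i.
              nabla M T (1/4) \<psi> i x (X i x)
              + (1 / n) *\<^sub>R cmul M i x (X i x) (dirac_slash M T \<psi> i x)
              + (1 / (2 * (n - 3))) *\<^sub>R cmul4 M i x (wedge3 M i x (X i x) (T i x)) (\<psi> i x) = 0))) \<and>
         (twistor_spinor M T s \<psi> \<longrightarrow>
           (\<forall>i\<in>charts M. \<forall>x\<in>cimg M i.
              dirac_slash M T (dirac_slash M T \<psi>) i x =
                (n / (4 * (n - 1)) * scal M i x
                 + n * (n - 5) / (8 * (n - 3)\<^sup>2) * norm3_sq M T i x) *\<^sub>R \<psi> i x
                + (n * (4 - n) / (4 * (n - 3)\<^sup>2)) *\<^sub>R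
                    cmul3 M i x (T i x) (cmul3 M i x (T i x) (\<psi> i x))))"
proof -
  have n: "n > 3" using assms(2,3) by simp
  have torsion: "spin_chart_torsion M i T" if "i \<in> charts M" for i
    using assms that by unfold_locales auto
  have smooth: "smooth_on (cimg M i) (\<psi> i)" if "i \<in> charts M" for i
    using assms(7) that by (simp add: spinor_field_def)
  \<comment> \<open>A name for the normal form outside the locale, so that all charts can be
    quantified over at once.\<close>
  define Z where "Z i x u = spin_chart_torsion.twistor M i T s (\<psi> i) x u" for i x u
  have Z: "twistor_op M T s \<psi> i x = 0 \<longleftrightarrow> (\<forall>u. Z i x u = 0)" if "i \<in> charts M" "x \<in> cimg M i" for i x
    unfolding Z_def
    by (rule spin_chart_torsion.twistor_op_eq_0_iff[OF torsion]) (use that smooth smooth_on_differentiable in blast)+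
  have eq: "nabla M T (1/4) \<psi> i x u + (1 / n) *\<^sub>R cmul M i x u (dirac_slash M T \<psi> i x)
      + (1 / (2 * (n - 3))) *\<^sub>R cmul4 M i x (wedge3 M i x u (T i x)) (\<psi> i x) = Z i x u"
    if "i \<in> charts M" "x \<in> cimg M i" for i x u
    unfolding Z_def by (rule spin_chart_torsion.twistor_rewrite[OF torsion[OF that(1)] that(2) assms(2) n assms(6)])
  have manifold: "oriented_manifold M"
    using assms(1) by (simp add: oriented_riemannian_spin_manifold_def)
  have tw: "twistor_spinor M T s \<psi> \<longleftrightarrow> (\<forall>i\<in>charts M. \<forall>x\<in>cimg M i. \<forall>u. Z i x u = 0)"
    using Z by (simp add: twistor_spinor_def)
  have equiv: "twistor_spinor M T s \<psi> \<longleftrightarrow>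
      (\<forall>X. vector_field M X \<longrightarrow> (\<forall>i\<in>charts M. \<forall>x\<in>cimg M i. Z i x (X i x) = 0))"
  proof
    assume all: "\<forall>X. vector_field M X \<longrightarrow> (\<forall>i\<in>charts M. \<forall>x\<in>cimg M i. Z i x (X i x) = 0)"
    show "twistor_spinor M T s \<psi>"
      unfolding tw
    proof (intro ballI allI)
      fix i x u assume i: "i \<in> charts M" and x: "x \<in> cimg M i"
      obtain X :: "('i, 'n) vfield" where "vector_field M X" "X i x = u"
        using vector_field_extension[OF manifold i x] by metis
      then show "Z i x u = 0" using all i x by blast
    qed
  qed (simp add: tw)
  have square: "dirac_slash M T (dirac_slash M T \<psi>) i x =
        (n / (4 * (n - 1)) * scal M i x + n * (n - 5) / (8 * (n - 3)\<^sup>2) * norm3_sq M T i x) *\<^sub>R \<psi> i x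
        + (n * (4 - n) / (4 * (n - 3)\<^sup>2)) *\<^sub>R cmul3 M i x (T i x) (cmul3 M i x (T i x) (\<psi> i x))"
    if twistor: "twistor_spinor M T s \<psi>" and i: "i \<in> charts M" and x: "x \<in> cimg M i" for i x
  proof -
    interpret spin_chart_torsion M i T by (rule torsion[OF i])
    \<comment> \<open>\<open>dirac_slash_eq\<close> holds only on the chart image; under the outer
      derivative it is used through the locality of \<open>Dir\<close>.\<close>
    have "Dir (dirac_slash M T \<psi> i) x = Dir (\<lambda>y. Dir (\<psi> i) y + (1 / 4) *\<^sub>R act (tor_op y) (\<psi> i y)) x"
      by (rule Dir_cong[OF x]) (rule dirac_slash_eq)
    then show ?thesis
      using dirac_slash_square[OF smooth[OF i] x assms(2) n assms(6)] twistor tw i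
      by (simp add: dirac_slash_eq[OF x] cmul3_eq[OF x] Z_def)
  qed
  show ?thesis
  proof (intro conjI impI ballI)
    show "twistor_spinor M T s \<psi> \<longleftrightarrow>
        (\<forall>X. vector_field M X \<longrightarrow> (\<forall>i\<in>charts M. \<forall>x\<in>cimg M i.
          nabla M T (1/4) \<psi> i x (X i x) + (1 / n) *\<^sub>R cmul M i x (X i x) (dirac_slash M T \<psi> i x)
          + (1 / (2 * (n - 3))) *\<^sub>R cmul4 M i x (wedge3 M i x (X i x) (T i x)) (\<psi> i x) = 0))"
      by (simp only: equiv eq cong: ball_cong)
  qed (rule square)
qed

end
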